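(* Let $\Omega\subset\mathbf R^d$ be an open set with Lipschitz boundary, and let $\{u_\varepsilon\}$ be a family bounded in $L^2(\Omega)$ such that, for some $k\ge r>0$ and some $M$ independent of $\varepsilon$, $$\int_{\Omega_{k\varepsilon}}\int_{B_r}\left|\frac{u_\varepsilon(x+\varepsilon\xi)-u_\varepsilon(x)}{\varepsilon}\right|^2d\xi\,dx\le M .$$ Then there exists a family $\{w_\varepsilon\}\subset C^\infty(\Omega_{k\varepsilon})$, bounded in $H^1(\Omega_{k\varepsilon})$, such that $$\|u_\varepsilon-w_\varepsilon\|_{L^2(\Omega_{k\varepsilon})}\le C\sqrt M\,\varepsilon,\qquad\|w_\varepsilon\|_{H^1(\Omega_{k\varepsilon})}\le C\big(\sqrt M+\|u_\varepsilon\|_{L^2(\Omega)}\big),$$ where $C$ does not depend on $\varepsilon$ and $M$. In particular, up to a subsequence (as $\varepsilon\to0$), for some $u\in H^1(\Omega)$, $$u_\varepsilon\to u\ \text{ strongly in }L^2(\Omega'),\qquad w_\varepsilon\to u\ \text{ strongly in }L^2(\Omega')\text{ and weakly in }H^1(\Omega'),$$ for an arbitrary open set $\Omega'\Subset\Omega$.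
   Context: $B_r$ is the open ball of radius $r$ centred at $0$. For $\rho>0$, $\Omega_\rho=\{x\in\Omega:\mathrm{dist}(x,\partial\Omega)>\rho\}$. $\Omega'\Subset\Omega$ means that $\Omega'$ is bounded and compactly contained in $\Omega$. *)

theory Defs
  imports "HOL-Analysis.Analysis"
begin

subsection \<open>Domains\<close>

text \<open>Near each boundary point the set is the strict epigraph, in some direction \<open>e\<close>, of a
  Lipschitz function \<open>g\<close> on the hyperplane orthogonal to \<open>e\<close>.  In dimension one that
  hyperplane is the singleton of \<open>0\<close>, so that locally the set is a half-line.
  No uniformity in the boundary point is required.\<close>

definition lipschitz_boundary :: "'a::euclidean_space set \<Rightarrow> bool" where
  "lipschitz_boundary S \<longleftrightarrow>
     (\<forall>z\<in>frontier S. \<exists>\<delta> e L g. \<delta> > 0 \<and> norm e = 1 \<and> L-lipschitz_on {y. y \<bullet> e = 0} g \<and>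
        S \<inter> ball z \<delta> = {x \<in> ball z \<delta>. (g (x - (x \<bullet> e) *\<^sub>R e) :: real) < x \<bullet> e})"

text \<open>The points of \<open>S\<close> at distance larger than \<open>\<rho>\<close> from the boundary.  The distance to the
  empty set is infinite here, whereas \<^term>\<open>infdist x {} = 0\<close>; hence the first disjunct.\<close>

definition inner_region :: "'a::euclidean_space set \<Rightarrow> real \<Rightarrow> 'a set" where
  "inner_region S \<rho> = {x \<in> S. frontier S = {} \<or> infdist x (frontier S) > \<rho>}"

definition compactly_contained :: "'a::euclidean_space set \<Rightarrow> 'a set \<Rightarrow> bool" where
  "compactly_contained A S \<longleftrightarrow> bounded A \<and> compact (closure A) \<and> closure A \<subseteq> S"


subsection \<open>Smooth functions\<close>

text \<open>For \<open>i \<in> Basis\<close>, \<^term>\<open>\<lambda>x. frechet_derivative f (at x) i\<close> is the partial derivative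
  in direction \<open>i\<close>.\<close>

primrec Ck_on :: "nat \<Rightarrow> ('a::euclidean_space \<Rightarrow> real) \<Rightarrow> 'a set \<Rightarrow> bool" where
  "Ck_on 0 f S \<longleftrightarrow> continuous_on S f"
| "Ck_on (Suc n) f S \<longleftrightarrow> (\<forall>x\<in>S. f differentiable (at x)) \<and>
     (\<forall>i\<in>Basis. Ck_on n (\<lambda>x. frechet_derivative f (at x) i) S)"

definition smooth_on :: "('a::euclidean_space \<Rightarrow> real) \<Rightarrow> 'a set \<Rightarrow> bool" where
  "smooth_on f S \<longleftrightarrow> (\<forall>n. Ck_on n f S)"

definition test_function :: "'a::euclidean_space set \<Rightarrow> ('a \<Rightarrow> real) \<Rightarrow> bool" where
  "test_function A \<phi> \<longleftrightarrow>
     smooth_on \<phi> UNIV \<and> (\<exists>K. compact K \<and> K \<subseteq> A \<and> (\<forall>x. x \<notin> K \<longrightarrow> \<phi> x = 0))"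


subsection \<open>The spaces \<open>L\<^sup>2\<close> and \<open>H\<^sup>1\<close>\<close>

text \<open>Elements are total functions, of which only the restriction to \<open>A\<close> matters; functions
  equal almost everywhere are not identified, so the norms below are seminorms.  The sets
  \<open>A\<close> of interest are open.\<close>

definition L2 :: "'a::euclidean_space set \<Rightarrow> ('a \<Rightarrow> 'b::euclidean_space) set" where
  "L2 A = {f. f \<in> borel_measurable (lebesgue_on A) \<and>
              integrable (lebesgue_on A) (\<lambda>x. (norm (f x))\<^sup>2)}"

definition L2_norm :: "'a::euclidean_space set \<Rightarrow> ('a \<Rightarrow> 'b::euclidean_space) \<Rightarrow> real" where
  "L2_norm A f = sqrt (integral\<^sup>L (lebesgue_on A) (\<lambda>x. (norm (f x))\<^sup>2))"

definition is_weak_gradient ::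
    "'a::euclidean_space set \<Rightarrow> ('a \<Rightarrow> real) \<Rightarrow> ('a \<Rightarrow> 'a) \<Rightarrow> bool" where
  "is_weak_gradient A f G \<longleftrightarrow>
     (\<forall>\<phi>. test_function A \<phi> \<longrightarrow> (\<forall>i\<in>Basis.
        integral\<^sup>L (lebesgue_on A) (\<lambda>x. f x * frechet_derivative \<phi> (at x) i) =
        - integral\<^sup>L (lebesgue_on A) (\<lambda>x. (G x \<bullet> i) * \<phi> x)))"

definition H1 :: "'a::euclidean_space set \<Rightarrow> ('a \<Rightarrow> real) set" where
  "H1 A = {f \<in> L2 A. \<exists>G \<in> L2 A. is_weak_gradient A f G}"

text \<open>The weak gradient is unique up to null sets, so the choice does not affect the norm.\<close>

definition weak_gradient :: "'a::euclidean_space set \<Rightarrow> ('a \<Rightarrow> real) \<Rightarrow> 'a \<Rightarrow> 'a" where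
  "weak_gradient A f = (SOME G. G \<in> L2 A \<and> is_weak_gradient A f G)"

definition H1_norm :: "'a::euclidean_space set \<Rightarrow> ('a \<Rightarrow> real) \<Rightarrow> real" where
  "H1_norm A f = sqrt ((L2_norm A f)\<^sup>2 + (L2_norm A (weak_gradient A f))\<^sup>2)"


subsection \<open>Strong and weak convergence\<close>

text \<open>Membership is required only for large indices: the functions to which this is applied
  are defined on domains that contain \<open>A\<close> only eventually.\<close>

definition L2_strong_conv ::
    "'a::euclidean_space set \<Rightarrow> (nat \<Rightarrow> 'a \<Rightarrow> real) \<Rightarrow> ('a \<Rightarrow> real) \<Rightarrow> bool" where
  "L2_strong_conv A f v \<longleftrightarrow> (\<forall>\<^sub>F n in sequentially. f n \<in> L2 A) \<and> v \<in> L2 A \<and>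
     (\<lambda>n. L2_norm A (\<lambda>x. f n x - v x)) \<longlonglongrightarrow> 0"

text \<open>A functional bounded by the seminorm respects equality almost everywhere, so these are
  the elements of the dual of the Hilbert space \<open>H\<^sup>1(A)\<close>.\<close>

definition H1_dual :: "'a::euclidean_space set \<Rightarrow> (('a \<Rightarrow> real) \<Rightarrow> real) set" where
  "H1_dual A = {l.
     (\<forall>f\<in>H1 A. \<forall>g\<in>H1 A. \<forall>a b. l (\<lambda>x. a * f x + b * g x) = a * l f + b * l g) \<and>
     (\<exists>K. \<forall>f\<in>H1 A. \<bar>l f\<bar> \<le> K * H1_norm A f)}"

definition H1_weak_conv ::
    "'a::euclidean_space set \<Rightarrow> (nat \<Rightarrow> 'a \<Rightarrow> real) \<Rightarrow> ('a \<Rightarrow> real) \<Rightarrow> bool" where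
  "H1_weak_conv A f v \<longleftrightarrow> (\<forall>\<^sub>F n in sequentially. f n \<in> H1 A) \<and> v \<in> H1 A \<and>
     (\<forall>l\<in>H1_dual A. (\<lambda>n. l (f n)) \<longlonglongrightarrow> l v)"

end

(*
  Mollify the zero extension of u at scale eps with a bump rho supported in B_r and of integral one:
  w(x) is the integral of rho(xi) u(x + eps xi).  Since rho has integral one and its partial derivatives
  have integral zero, both u(x) - w(x) and eps times a partial derivative of w at x are integrals over B_r
  of u(x + eps xi) - u(x) against a bounded kernel, and Cauchy-Schwarz bounds them by the inner integral of
  the hypothesis.

  For the compactness, a diagonal argument makes the averages of w over all grid cells converge, and the
  Poincare inequality on the cells turns this into Cauchy sequences in L2(Omega') for Omega' compactly
  contained in Omega.  Weak limits are avoided: a bounded sequence in L2 has midpoint combinations of its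
  tails that converge in norm.  Applied to the pairs (w, grad w) this yields the limit in H1(Omega), and
  applied to subsequences in Omega' it yields the weak convergence without the Riesz representation theorem.
*)
theory Submission
  imports Defs "HOL-Complex_Analysis.Great_Picard"
begin

subsection \<open>Smooth functions\<close>

text \<open>The obstacle is the boundary: nothing is known about increments of \<open>u\<close> that
  leave \<Omega>, and the zero extension may jump there. The condition r \<le> k settles this on the
  inner region of width k\<epsilon>: for x in it and |\<xi>| < r the point x + \<epsilon>\<xi> stays
  in \<Omega>, so the mollification sees true increments only. Hence \<open>w\<close> is smooth and
  square integrable on the whole space, while its gradient is controlled on the inner region alone.
  These regions exhaust \<Omega> only as \<epsilon> tends to 0, so every limit argument works with
  gradient bounds that hold eventually on each compact set.

  The constant is read off from the mollifier: the squared L^2 norms of rho and of its partial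
  derivatives, and the volume of the ball of radius r.

  As \<open>u\<close> is merely Lebesgue measurable, it is replaced by a Borel function equal to its
  zero extension almost everywhere, to which Fubini and translations apply directly. The estimates
  use nonnegative extended integrals, so that the increments may be handled before anything is known
  to be integrable.\<close>

abbreviation pd :: "('a::euclidean_space \<Rightarrow> real) \<Rightarrow> 'a \<Rightarrow> 'a \<Rightarrow> real" where
  "pd f i \<equiv> (\<lambda>x. frechet_derivative f (at x) i)"

text \<open>The induction on the order runs over all members of \<open>F\<close> at once, so that
  its hypothesis covers the partial derivatives. The rule serves for convolutions and dilations,
  whose derivatives are again of the same form.\<close>

lemma smooth_on_coinduct:
  assumes "\<And>f. f \<in> F \<Longrightarrow> (\<forall>x. f differentiable (at x)) \<and> (\<forall>i\<in>Basis. pd f i \<in> F)"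
    and "f \<in> F"
  shows "smooth_on f S"
proof -
  have "\<forall>f\<in>F. Ck_on n f S" for n
  proof (induction n)
    case 0
    show ?case
    proof
      fix f assume "f \<in> F"
      then have "f differentiable_on S"
        using assms(1) by (meson differentiable_at_imp_differentiable_on)
      then show "Ck_on 0 f S" by (simp add: differentiable_imp_continuous_on)
    qed
  next
    case (Suc n)
    then show ?case using assms(1) by auto
  qed
  then show ?thesis using assms(2) by (auto simp: smooth_on_def)
qed

text \<open>At a successor, \<open>Ck_on\<close> asks for differentiability and for a property of
  the derivatives, not for membership in the class below; the inclusion is therefore an induction of
  its own.\<close>

lemma Ck_on_SucD: "Ck_on (Suc n) f S \<Longrightarrow> Ck_on n f S"
proof (induction n arbitrary: f)
  case 0
  then show ?case
    by (auto intro!: continuous_at_imp_continuous_on differentiable_imp_continuous_within)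
next
  case (Suc n)
  then show ?case by (metis Ck_on.simps(2))
qed

lemma Ck_on_subset: "Ck_on n f S \<Longrightarrow> T \<subseteq> S \<Longrightarrow> Ck_on n f T"
  by (induction n arbitrary: f) (auto intro: continuous_on_subset)

lemma smooth_on_subset: "smooth_on f S \<Longrightarrow> T \<subseteq> S \<Longrightarrow> smooth_on f T"
  unfolding smooth_on_def using Ck_on_subset by blast

lemma smooth_on_differentiable: "smooth_on f S \<Longrightarrow> x \<in> S \<Longrightarrow> f differentiable (at x)"
  using Ck_on.simps(2)[of 0 f S] unfolding smooth_on_def by blast

lemma smooth_on_pd: "smooth_on f S \<Longrightarrow> i \<in> Basis \<Longrightarrow> smooth_on (pd f i) S"
  using Ck_on.simps(2)[of _ f S] unfolding smooth_on_def by blast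

lemma smooth_on_continuous: "smooth_on f S \<Longrightarrow> continuous_on S f"
  unfolding smooth_on_def using Ck_on.simps(1)[of f S] by blast

lemma Ck_const: "Ck_on n (\<lambda>x. c) S"
  by (induction n arbitrary: c) auto

section \<open>Rules of differentiation and their iteration\<close>

lemma pd_add:
  assumes "f differentiable (at x)" "g differentiable (at x)"
  shows "pd (\<lambda>x. f x + g x) i x = pd f i x + pd g i x"
proof -
  have "((\<lambda>x. f x + g x) has_derivative
      (\<lambda>h. frechet_derivative f (at x) h + frechet_derivative g (at x) h)) (at x)"
    using assms by (auto intro!: has_derivative_add simp: frechet_derivative_works[symmetric])
  from frechet_derivative_at[OF this] show ?thesis by metis
qed

lemma pd_mult:
  assumes "f differentiable (at x)" "g differentiable (at x)"
  shows "pd (\<lambda>x. f x * g x) i x = f x * pd g i x + pd f i x * g x"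
proof -
  have "((\<lambda>x. f x * g x) has_derivative
      (\<lambda>h. f x * frechet_derivative g (at x) h + frechet_derivative f (at x) h * g x)) (at x)"
    using assms by (auto intro!: has_derivative_mult simp: frechet_derivative_works[symmetric])
  from frechet_derivative_at[OF this] show ?thesis by metis
qed

lemma pd_cmult:
  assumes "f differentiable (at x)"
  shows "pd (\<lambda>x. c * f x) i x = c * pd f i x"
proof -
  have "((\<lambda>x. c * f x) has_derivative (\<lambda>h. c * frechet_derivative f (at x) h)) (at x)"
    using assms by (auto intro!: has_derivative_mult_right simp: frechet_derivative_works[symmetric])
  from frechet_derivative_at[OF this] show ?thesis by metis
qed

text \<open>On \<open>UNIV\<close> the sum rule is an identity of functions and can be rewritten
  under \<open>Ck_on\<close>; on a smaller set it would be known at the points of that set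
  only.\<close>

lemma Ck_add: "Ck_on n f UNIV \<Longrightarrow> Ck_on n g UNIV \<Longrightarrow> Ck_on n (\<lambda>x. f x + g x) UNIV"
proof (induction n arbitrary: f g)
  case 0
  then show ?case by (auto intro: continuous_intros)
next
  case (Suc n)
  then show ?case by (simp add: pd_add)
qed

text \<open>The product rule brings back the undifferentiated factors, so the induction step also
  needs them at the lower order.\<close>

lemma Ck_mult: "Ck_on n f UNIV \<Longrightarrow> Ck_on n g UNIV \<Longrightarrow> Ck_on n (\<lambda>x. f x * g x) UNIV"
proof (induction n arbitrary: f g)
  case 0
  then show ?case by (auto intro: continuous_intros)
next
  case (Suc n)
  have "Ck_on n f UNIV" "Ck_on n g UNIV" using Suc.prems Ck_on_SucD by blast+
  with Suc show ?case by (auto simp: pd_mult intro!: Ck_add)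
qed

lemma smooth_const: "smooth_on (\<lambda>x. c) S"
  by (simp add: smooth_on_def Ck_const)

lemma smooth_add: "smooth_on f UNIV \<Longrightarrow> smooth_on g UNIV \<Longrightarrow> smooth_on (\<lambda>x. f x + g x) UNIV"
  by (simp add: smooth_on_def Ck_add)

lemma smooth_mult: "smooth_on f UNIV \<Longrightarrow> smooth_on g UNIV \<Longrightarrow> smooth_on (\<lambda>x. f x * g x) UNIV"
  by (simp add: smooth_on_def Ck_mult)

lemma smooth_diff:
  assumes "smooth_on f UNIV" "smooth_on g UNIV"
  shows "smooth_on (\<lambda>x. f x - g x) UNIV"
  using smooth_add[OF assms(1) smooth_mult[OF smooth_const[of "-1"] assms(2)]] by simp

lemma smooth_sum:
  "(\<And>i. i \<in> I \<Longrightarrow> smooth_on (f i) UNIV) \<Longrightarrow> smooth_on (\<lambda>x. \<Sum>i\<in>I. f i x) UNIV"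
  by (induction I rule: infinite_finite_induct) (auto intro: smooth_add smooth_const)

lemma smooth_prod:
  "(\<And>i. i \<in> I \<Longrightarrow> smooth_on (f i) UNIV) \<Longrightarrow> smooth_on (\<lambda>x. \<Prod>i\<in>I. f i x) UNIV"
  by (induction I rule: infinite_finite_induct) (auto intro: smooth_mult smooth_const)

lemma smooth_inner: "smooth_on (\<lambda>x. x \<bullet> b) UNIV"
proof -
  have d: "((\<lambda>x. x \<bullet> b) has_derivative (\<lambda>h. h \<bullet> b)) (at x)" for x :: 'a
    by (auto intro!: derivative_eq_intros)
  have "Ck_on (Suc n) (\<lambda>x. x \<bullet> b) UNIV" for n
    using d frechet_derivative_at[OF d] by (auto simp: Ck_const differentiable_def)
  then show ?thesis using Ck_on_SucD smooth_on_def by blast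
qed

text \<open>The outer function is taken from a class \<open>G\<close> closed under differentiation:
  the chain rule gives g'(f x) times a partial derivative of f, and g' is again in \<open>G\<close>,
  so the induction hypothesis for the whole class applies to the first factor.\<close>

lemma smooth_compose:
  fixes G :: "(real \<Rightarrow> real) set"
  assumes G: "\<And>g. g \<in> G \<Longrightarrow> \<exists>g'\<in>G. \<forall>t. (g has_real_derivative g' t) (at t)"
    and g: "g \<in> G" and f: "smooth_on f UNIV"
  shows "smooth_on (\<lambda>x. g (f x)) UNIV"
proof -
  have "\<forall>g\<in>G. Ck_on n (\<lambda>x. g (f x)) UNIV" for n
  proof (induction n)
    case 0
    show ?case
    proof
      fix g assume "g \<in> G"
      then have "continuous_on UNIV g" using G[of g]
        by (auto intro!: continuous_at_imp_continuous_on intro: DERIV_isCont)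
      then have "continuous_on (f ` UNIV) g" using continuous_on_subset by blast
      from continuous_on_compose2[OF this smooth_on_continuous[OF f]]
      show "Ck_on 0 (\<lambda>x. g (f x)) UNIV" by simp
    qed
  next
    case (Suc n)
    show ?case
    proof
      fix g assume "g \<in> G"
      then obtain g' where g': "g' \<in> G" "\<And>t. (g has_real_derivative g' t) (at t)"
        using G by blast
      have d: "((\<lambda>x. g (f x)) has_derivative (\<lambda>h. g' (f x) * frechet_derivative f (at x) h)) (at x)" for x
        by (rule has_derivative_compose[of f _ x UNIV g "\<lambda>y. g' (f x) * y", simplified])
           (use g' smooth_on_differentiable[OF f] in
             \<open>auto simp: frechet_derivative_works[symmetric] has_field_derivative_def\<close>)
      have "pd (\<lambda>x. g (f x)) i = (\<lambda>x. g' (f x) * pd f i x)" for i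
        using frechet_derivative_at[OF d] by metis
      moreover have "Ck_on n (\<lambda>x. g' (f x) * pd f i x) UNIV" if "i \<in> Basis" for i
        using Suc.IH g'(1) smooth_on_pd[OF f that] by (intro Ck_mult) (auto simp: smooth_on_def)
      ultimately show "Ck_on (Suc n) (\<lambda>x. g (f x)) UNIV"
        using d by (auto simp: differentiable_def)
    qed
  qed
  then show ?thesis using g by (auto simp: smooth_on_def)
qed

text \<open>A class that contains exp(-1/t), extended by 0 to t \<le> 0, and that is closed under
  differentiation: each derivative is a polynomial in 1/t times the exponential.\<close>

definition flat :: "real poly \<Rightarrow> real \<Rightarrow> real" where
  "flat p t = (if t \<le> 0 then 0 else poly p (inverse t) * exp (- inverse t))"

lemma poly_times_exp_neg_tendsto_0: "((\<lambda>s. poly p s * exp (- s)) \<longlongrightarrow> (0::real)) at_top"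
proof -
  have "((\<lambda>s. \<Sum>i\<le>degree p. coeff p i * (s ^ i / exp s)) \<longlongrightarrow> (\<Sum>i\<le>degree p. coeff p i * 0)) at_top"
    by (intro tendsto_sum tendsto_mult tendsto_const tendsto_power_div_exp_0)
  moreover have "(\<Sum>i\<le>degree p. coeff p i * (s ^ i / exp s)) = poly p s * exp (- s)" for s
    by (simp add: poly_altdef sum_distrib_right exp_minus divide_inverse mult.assoc)
  ultimately show ?thesis by simp
qed

lemma flat_tendsto_0: "((\<lambda>t. flat p t) \<longlongrightarrow> 0) (at 0)"
proof -
  have "((\<lambda>t. poly p (inverse t) * exp (- inverse t)) \<longlongrightarrow> 0) (at_right 0)"
    using filterlim_compose[OF poly_times_exp_neg_tendsto_0 filterlim_inverse_at_top_right] by simp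
  then have "(flat p \<longlongrightarrow> 0) (at_right 0)"
    by (rule Lim_transform_eventually) (auto simp: flat_def eventually_at_filter)
  moreover have "(flat p \<longlongrightarrow> 0) (at_left 0)"
    by (rule Lim_transform_eventually[OF tendsto_const]) (auto simp: flat_def eventually_at_filter)
  ultimately show ?thesis by (simp add: filterlim_split_at)
qed

text \<open>For t > 0 the derivative of p(1/t) exp(-1/t) is t^(-2) (p - p')(1/t) exp(-1/t); the
  factor \<open>[:0,0,1:]\<close>, the square of the variable, accounts for t^(-2).\<close>

lemma flat_has_derivative:
  "(flat p has_real_derivative flat ([:0,0,1:] * (p - pderiv p)) t) (at t)"
proof -
  consider "t > 0" | "t < 0" | "t = 0" by linarith
  then show ?thesis
  proof cases
    case 1
    have "((\<lambda>t. poly p (inverse t) * exp (- inverse t)) has_real_derivative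
        flat ([:0,0,1:] * (p - pderiv p)) t) (at t)"
      using 1 by (auto intro!: derivative_eq_intros
          simp: flat_def divide_simps power2_eq_square) (simp add: algebra_simps)
    then show ?thesis
      by (rule has_field_derivative_transform_within_open[of _ _ _ "{0<..}"])
        (use 1 in \<open>auto simp: flat_def\<close>)
  next
    case 2
    have "((\<lambda>t. 0) has_real_derivative flat ([:0,0,1:] * (p - pderiv p)) t) (at t)"
      using 2 by (auto simp: flat_def)
    then show ?thesis
      by (rule has_field_derivative_transform_within_open[of _ _ _ "{..<0}"])
        (use 2 in \<open>auto simp: flat_def\<close>)
  next
    case 3
    \<comment> \<open>The difference quotient of \<open>flat p\<close> at 0 is again a
      \<open>flat\<close> function, because dividing by h multiplies the polynomial by its
      variable.\<close>
    have "((\<lambda>t. flat ([:0,1:] * p) t) \<longlongrightarrow> 0) (at 0)" by (rule flat_tendsto_0)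
    then have "((\<lambda>h. (flat p (0 + h) - flat p 0) / h) \<longlongrightarrow> 0) (at 0)"
      by (rule Lim_transform_eventually)
        (auto simp: flat_def eventually_at_filter divide_simps intro!: always_eventually)
    then show ?thesis using 3 by (simp add: DERIV_def flat_def)
  qed
qed

lemma smooth_flat: "smooth_on f UNIV \<Longrightarrow> smooth_on (\<lambda>x. flat p (f x)) UNIV"
  by (rule smooth_compose[of "range flat"]) (use flat_has_derivative in blast)+

lemma flat_one_bounds: "0 \<le> flat 1 t" "flat 1 t \<le> 1" "flat 1 t = 0 \<longleftrightarrow> t \<le> 0"
  by (auto simp: flat_def)

section \<open>Test functions, bumps and smooth approximations of boxes\<close>

lemma test_function_pd:
  assumes "test_function A \<phi>" "i \<in> Basis"
  shows "test_function A (pd \<phi> i)"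
proof -
  obtain K where K: "compact K" "K \<subseteq> A" "\<And>x. x \<notin> K \<Longrightarrow> \<phi> x = 0"
    using assms by (auto simp: test_function_def)
  \<comment> \<open>The complement of \<open>K\<close> is open, so \<phi> vanishes near x; the same
    compact set supports the derivative.\<close>
  have "pd \<phi> i x = 0" if "x \<notin> K" for x
  proof -
    have "((\<lambda>x. 0) has_derivative (\<lambda>h. 0)) (at x)" by simp
    then have "(\<phi> has_derivative (\<lambda>h. 0)) (at x)"
      by (rule has_derivative_transform_within_open[of _ _ _ _ "- K"])
        (use K that in \<open>auto simp: open_Compl compact_imp_closed\<close>)
    from frechet_derivative_at[OF this] show ?thesis by metis
  qed
  then show ?thesis using assms K smooth_on_pd by (auto simp: test_function_def)
qed

lemma test_function_mult:
  "test_function A \<phi> \<Longrightarrow> smooth_on f UNIV \<Longrightarrow> test_function A (\<lambda>x. f x * \<phi> x)"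
  by (auto simp: test_function_def intro: smooth_mult)

lemma test_function_mono: "test_function A \<phi> \<Longrightarrow> A \<subseteq> B \<Longrightarrow> test_function B \<phi>"
  by (auto simp: test_function_def)

text \<open>The squared norm is a polynomial in the coordinates, which keeps the function smooth at
  the origin as well.\<close>

definition bump :: "real \<Rightarrow> 'a::euclidean_space \<Rightarrow> real" where
  "bump r x = flat 1 (r\<^sup>2 - (norm x)\<^sup>2)"

lemma smooth_norm_sq: "smooth_on (\<lambda>x::'a::euclidean_space. (norm x)\<^sup>2) UNIV"
proof -
  have "(\<lambda>x::'a. (norm x)\<^sup>2) = (\<lambda>x. \<Sum>b\<in>Basis. (x \<bullet> b) * (x \<bullet> b))"
    by (rule ext, simp add: power2_norm_eq_inner, subst euclidean_inner, simp)
  then show ?thesis by (simp add: smooth_sum smooth_mult smooth_inner)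
qed

lemma smooth_bump: "smooth_on (bump r) UNIV"
  unfolding bump_def[abs_def] by (intro smooth_flat smooth_diff smooth_const smooth_norm_sq)

lemma bump_eq_0_iff: "0 < r \<Longrightarrow> bump r x = 0 \<longleftrightarrow> norm x \<ge> r"
  by (auto simp: bump_def flat_one_bounds power2_le_iff_abs_le)

text \<open>Each factor exp(-1/((n+1)t)) tends to 1 for t > 0 and is 0 for t \<le> 0. The product
  thus approximates the indicator of the open box by test functions supported in the closed
  one.\<close>

definition box_approx :: "nat \<Rightarrow> 'a::euclidean_space \<Rightarrow> 'a \<Rightarrow> 'a \<Rightarrow> real" where
  "box_approx n a b x = (\<Prod>i\<in>Basis. flat 1 (real (Suc n) * (x \<bullet> i - a \<bullet> i)) *
     flat 1 (real (Suc n) * (b \<bullet> i - x \<bullet> i)))"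

lemma test_function_box_approx: "cbox a b \<subseteq> A \<Longrightarrow> test_function A (box_approx n a b)"
  unfolding test_function_def
proof (intro conjI exI[of _ "cbox a b"])
  show "smooth_on (box_approx n a b) UNIV"
    unfolding box_approx_def[abs_def]
    by (intro smooth_prod smooth_mult smooth_flat smooth_diff smooth_const smooth_inner)
  show "\<forall>x. x \<notin> cbox a b \<longrightarrow> box_approx n a b x = 0"
    by (auto simp: box_approx_def mem_box flat_one_bounds zero_le_mult_iff mult_le_0_iff
        intro!: bexI)
qed auto

lemma box_approx_bounds: "0 \<le> box_approx n a b x" "box_approx n a b x \<le> 1"
  unfolding box_approx_def
  by (auto intro!: prod_nonneg prod_le_1 mult_nonneg_nonneg mult_le_one simp: flat_one_bounds)

lemma box_approx_tendsto: "(\<lambda>n. box_approx n a b x) \<longlonglongrightarrow> indicator (box a b) x"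
proof -
  have "(\<lambda>n. flat 1 (real (Suc n) * t)) \<longlonglongrightarrow> (if 0 < t then 1 else 0)" for t
  proof (cases "0 < t")
    case True
    have "(\<lambda>n. exp (- (inverse (real (Suc n)) * inverse t))) \<longlonglongrightarrow> exp (- (0 * inverse t))"
      by (intro tendsto_intros LIMSEQ_inverse_real_of_nat)
    moreover have "flat 1 (real (Suc n) * t) = exp (- (inverse (real (Suc n)) * inverse t))" for n
      using True by (simp add: flat_def mult_le_0_iff)
    ultimately show ?thesis using True by simp
  next
    case False
    then have "flat 1 (real (Suc n) * t) = 0" for n by (simp add: flat_one_bounds mult_le_0_iff)
    then show ?thesis using False by simp
  qed
  then have "(\<lambda>n. box_approx n a b x) \<longlonglongrightarrow> (\<Prod>i\<in>Basis. (if 0 < x \<bullet> i - a \<bullet> i then 1 else 0) *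
     (if 0 < b \<bullet> i - x \<bullet> i then 1 else 0))"
    unfolding box_approx_def by (intro tendsto_prod tendsto_mult)
  also have "(\<Prod>i\<in>Basis. (if 0 < x \<bullet> i - a \<bullet> i then 1 else 0) *
     (if 0 < b \<bullet> i - x \<bullet> i then 1 else 0)) = (indicator (box a b) x :: real)"
    by (auto simp: indicator_def mem_box intro!: prod.neutral)
  finally show ?thesis .
qed

subsection \<open>Convolution with test functions\<close>

definition grad :: "('a::euclidean_space \<Rightarrow> real) \<Rightarrow> 'a \<Rightarrow> 'a" where
  "grad f x = (\<Sum>i\<in>Basis. pd f i x *\<^sub>R i)"

lemma grad_inner_Basis: "i \<in> Basis \<Longrightarrow> grad f x \<bullet> i = pd f i x"
  by (simp add: grad_def)

lemma frechet_derivative_eq_grad: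
  assumes "f differentiable (at x)"
  shows "frechet_derivative f (at x) h = grad f x \<bullet> h"
proof -
  interpret linear "frechet_derivative f (at x)"
    using assms linear_frechet_derivative by blast
  have "frechet_derivative f (at x) h = frechet_derivative f (at x) (\<Sum>i\<in>Basis. (h \<bullet> i) *\<^sub>R i)"
    by (simp add: euclidean_representation)
  also have "\<dots> = (\<Sum>i\<in>Basis. (h \<bullet> i) * pd f i x)" by (simp add: sum scaleR)
  also have "\<dots> = grad f x \<bullet> h"
    by (simp add: grad_def inner_sum_left inner_commute[of h] mult.commute)
  finally show ?thesis .
qed

lemma smooth_has_derivative_grad:
  assumes "smooth_on f UNIV"
  shows "(f has_derivative (\<lambda>h. grad f x \<bullet> h)) (at x)"
proof -
  have d: "f differentiable (at x)" using assms smooth_on_differentiable by blast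
  then have "(f has_derivative frechet_derivative f (at x)) (at x)"
    by (simp add: frechet_derivative_works)
  moreover have "frechet_derivative f (at x) = (\<lambda>h. grad f x \<bullet> h)"
    by (rule ext) (rule frechet_derivative_eq_grad[OF d])
  ultimately show ?thesis by simp
qed

lemma continuous_on_grad: "smooth_on f UNIV \<Longrightarrow> continuous_on UNIV (grad f)"
  unfolding grad_def[abs_def]
  by (intro continuous_intros smooth_on_continuous smooth_on_pd)

lemma grad_diff:
  assumes "smooth_on f UNIV" "smooth_on g UNIV"
  shows "grad (\<lambda>x. f x - g x) x = grad f x - grad g x"
proof -
  have "pd (\<lambda>x. f x - g x) i x = pd f i x - pd g i x" for i
    using pd_add[OF smooth_on_differentiable[OF assms(1)]
        smooth_on_differentiable[OF smooth_mult[OF smooth_const[of "-1"] assms(2)]], of x i]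
      pd_cmult[OF smooth_on_differentiable[OF assms(2)], of x "-1" i] by simp
  then show ?thesis by (simp add: grad_def scaleR_left_diff_distrib sum_subtractf)
qed

text \<open>Borel rather than Lebesgue measurability is required because it is stable under
  composition with continuous maps such as (x, z) \<mapsto> x + \<epsilon>z, as the later uses of
  Fubini demand.\<close>

definition locally_integrable :: "('a::euclidean_space \<Rightarrow> real) \<Rightarrow> bool" where
  "locally_integrable u \<longleftrightarrow> u \<in> borel_measurable borel \<and>
     (\<forall>R. integrable lborel (\<lambda>x. indicator (cball 0 R) x * u x))"

lemma locally_integrable_const: "locally_integrable (\<lambda>x. c)"
  by (auto simp: locally_integrable_def intro!: integrable_mult_left integrable_real_indicator
      emeasure_lborel_cball_finite)

lemma test_function_support:
  fixes \<psi> :: "'a::euclidean_space \<Rightarrow> real"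
  assumes "test_function UNIV \<psi>"
  obtains R where "0 < R" "\<And>x. norm x > R \<Longrightarrow> \<psi> x = 0"
    "\<And>x i. norm x > R \<Longrightarrow> i \<in> Basis \<Longrightarrow> pd \<psi> i x = 0"
proof -
  obtain K where K: "compact K" "\<And>x. x \<notin> K \<Longrightarrow> \<psi> x = 0" "smooth_on \<psi> UNIV"
    using assms by (auto simp: test_function_def)
  then obtain R where R: "0 < R" "K \<subseteq> cball 0 R"
    using bounded_subset_ballD[OF compact_imp_bounded[OF K(1)], of 0] ball_subset_cball by blast
  have "test_function (cball 0 R) \<psi>"
    using K R unfolding test_function_def by blast
  from this test_function_pd[OF this] show ?thesis
    by (intro that[OF R(1)]) (fastforce simp: test_function_def)+
qed

lemma test_function_bounded:
  assumes "test_function A \<psi>"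
  obtains B where "0 \<le> B" "\<And>x. \<bar>\<psi> x\<bar> \<le> B"
proof -
  obtain K where K: "compact K" "\<And>x. x \<notin> K \<Longrightarrow> \<psi> x = 0" "smooth_on \<psi> UNIV"
    using assms by (auto simp: test_function_def)
  have "bounded (\<psi> ` K)"
    using K by (intro compact_imp_bounded compact_continuous_image)
      (auto intro: continuous_on_subset smooth_on_continuous)
  then obtain B where "\<And>x. x \<in> K \<Longrightarrow> \<bar>\<psi> x\<bar> \<le> B" by (auto simp: bounded_iff)
  then have "\<bar>\<psi> x\<bar> \<le> max B 0" for x using K(2)[of x] by (cases "x \<in> K") fastforce+
  then show ?thesis using that by (metis max.cobounded2)
qed

lemma test_function_smooth: "test_function A \<psi> \<Longrightarrow> smooth_on \<psi> UNIV"
  by (simp add: test_function_def)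

lemma test_function_UNIV: "test_function A \<psi> \<Longrightarrow> test_function UNIV \<psi>"
  using test_function_mono by blast

text \<open>The mean value inequality, with the sum of the bounds of the partial derivatives as
  constant. It provides the majorant for differentiation under the integral sign.\<close>

lemma test_function_lipschitz:
  fixes \<psi> :: "'a::euclidean_space \<Rightarrow> real"
  assumes "test_function UNIV \<psi>"
  obtains B where "0 \<le> B" "\<And>x. norm (grad \<psi> x) \<le> B" "\<And>x h. \<bar>\<psi> (x + h) - \<psi> x\<bar> \<le> B * norm h"
proof -
  have "\<exists>B. \<forall>i\<in>Basis. 0 \<le> B i \<and> (\<forall>x. \<bar>pd \<psi> i x\<bar> \<le> B i)"
    using test_function_bounded[OF test_function_pd[OF assms]] by (intro bchoice ballI) metis
  then obtain B where B: "\<And>i. i \<in> Basis \<Longrightarrow> 0 \<le> B i" "\<And>i x. i \<in> Basis \<Longrightarrow> \<bar>pd \<psi> i x\<bar> \<le> B i"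
    by metis
  define C where "C = (\<Sum>i\<in>Basis. B i)"
  have C: "norm (grad \<psi> x) \<le> C" for x
    unfolding grad_def C_def by (rule order_trans[OF norm_sum sum_mono]) (simp add: B)
  have "norm (\<psi> (x + h) - \<psi> x) \<le> C * norm (x + h - x)" for x h
  proof (rule differentiable_bound[of UNIV \<psi> "\<lambda>x h. grad \<psi> x \<bullet> h"])
    fix y :: 'a
    show "(\<psi> has_derivative (\<lambda>h. grad \<psi> y \<bullet> h)) (at y)"
      by (rule smooth_has_derivative_grad[OF test_function_smooth[OF assms]])
    show "onorm (\<lambda>h. grad \<psi> y \<bullet> h) \<le> C"
    proof (rule onorm_le)
      fix h
      have "\<bar>grad \<psi> y \<bullet> h\<bar> \<le> norm (grad \<psi> y) * norm h" by (rule Cauchy_Schwarz_ineq2)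
      also have "\<dots> \<le> C * norm h" by (intro mult_right_mono C) simp
      finally show "norm (grad \<psi> y \<bullet> h) \<le> C * norm h" by simp
    qed
  qed auto
  then show ?thesis using that[of C] C B by (auto simp: C_def sum_nonneg)
qed

text \<open>The kernel is reflected in comparison with the usual convolution: evaluated at y - x, it
  turns under y = x + \<epsilon>z into a weighted mean of u(x + \<epsilon>z), the values that occur
  in the hypothesis of the theorem. The price is a minus sign in each derivative.\<close>

definition conv :: "('a::euclidean_space \<Rightarrow> real) \<Rightarrow> ('a \<Rightarrow> real) \<Rightarrow> 'a \<Rightarrow> real" where
  "conv \<psi> u x = (\<integral>y. \<psi> (y - x) * u y \<partial>lborel)"

lemma test_function_borel [measurable_dest]:
  "test_function A \<psi> \<Longrightarrow> \<psi> \<in> borel_measurable borel"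
  by (intro borel_measurable_continuous_onI smooth_on_continuous test_function_smooth)

lemma conv_integrable:
  fixes \<psi> :: "'a::euclidean_space \<Rightarrow> real"
  assumes \<psi>: "test_function UNIV \<psi>" and u: "locally_integrable u"
  shows "integrable lborel (\<lambda>y. \<psi> (y - x) * u y)"
proof -
  note [measurable] = test_function_borel[OF \<psi>]
  have [measurable]: "u \<in> borel_measurable borel" using u by (simp add: locally_integrable_def)
  obtain R where R: "\<And>x. norm x > R \<Longrightarrow> \<psi> x = 0" using test_function_support[OF \<psi>] by metis
  obtain B where B: "0 \<le> B" "\<And>x. \<bar>\<psi> x\<bar> \<le> B" using test_function_bounded[OF \<psi>] by metis
  have "integrable lborel (\<lambda>y. B * (indicator (cball 0 (R + norm x)) y * u y))"
    using u by (simp add: locally_integrable_def)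
  then show ?thesis
  proof (rule Bochner_Integration.integrable_bound)
    show "AE y in lborel. norm (\<psi> (y - x) * u y) \<le>
        norm (B * (indicator (cball 0 (R + norm x)) y * u y))"
    proof (rule AE_I2)
      fix y
      show "norm (\<psi> (y - x) * u y) \<le> norm (B * (indicator (cball 0 (R + norm x)) y * u y))"
      proof (cases "norm y \<le> R + norm x")
        case True
        then show ?thesis using B by (simp add: abs_mult mult_right_mono)
      next
        case False
        then have "norm (y - x) > R" using norm_triangle_ineq2[of y x] by linarith
        then show ?thesis using R by simp
      qed
    qed
  qed simp
qed

text \<open>Differentiation under the integral sign. Since \<open>u\<close> is merely locally
  integrable, the expansion is made in the kernel, and the remainder is dominated by a multiple of
  |u| on a fixed ball.\<close>

lemma conv_has_derivative:
  fixes \<psi> :: "'a::euclidean_space \<Rightarrow> real"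
  assumes \<psi>: "test_function UNIV \<psi>" and u: "locally_integrable u"
  shows "(conv \<psi> u has_derivative (\<lambda>h. \<Sum>i\<in>Basis. (h \<bullet> i) * conv (\<lambda>z. - pd \<psi> i z) u x)) (at x)"
proof -
  note [measurable] = test_function_borel[OF \<psi>]
  have [measurable]: "u \<in> borel_measurable borel" using u by (simp add: locally_integrable_def)
  have [measurable]: "grad \<psi> \<in> borel_measurable borel"
    by (intro borel_measurable_continuous_onI continuous_on_grad test_function_smooth[OF \<psi>])
  obtain R where R: "\<And>x. norm x > R \<Longrightarrow> \<psi> x = 0"
      "\<And>x i. norm x > R \<Longrightarrow> i \<in> Basis \<Longrightarrow> pd \<psi> i x = 0"
    using test_function_support[OF \<psi>] by metis
  have Rg: "grad \<psi> z = 0" if "norm z > R" for z using R(2)[OF that] by (simp add: grad_def)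
  obtain B where B: "0 \<le> B" "\<And>x. norm (grad \<psi> x) \<le> B"
      "\<And>x h. \<bar>\<psi> (x + h) - \<psi> x\<bar> \<le> B * norm h"
    using test_function_lipschitz[OF \<psi>] by metis
  define L where "L h = (\<Sum>i\<in>Basis. (h \<bullet> i) * conv (\<lambda>z. - pd \<psi> i z) u x)" for h :: 'a
  have pdi: "integrable lborel (\<lambda>y. pd \<psi> i (y - x) * u y)" if "i \<in> Basis" for i
    using conv_integrable[OF test_function_pd[OF \<psi> that] u] .
  have Lint: "L h = - (\<integral>y. (grad \<psi> (y - x) \<bullet> h) * u y \<partial>lborel)"
    and Lintg: "integrable lborel (\<lambda>y. (grad \<psi> (y - x) \<bullet> h) * u y)" for h
  proof -
    have e: "(\<lambda>y. (grad \<psi> (y - x) \<bullet> h) * u y) = (\<lambda>y. \<Sum>i\<in>Basis. (h \<bullet> i) * (pd \<psi> i (y - x) * u y))"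
      by (rule ext) (simp add: grad_def inner_sum_left sum_distrib_left sum_distrib_right
          inner_commute[of h] mult_ac)
    show "integrable lborel (\<lambda>y. (grad \<psi> (y - x) \<bullet> h) * u y)"
      unfolding e by (intro Bochner_Integration.integrable_sum integrable_mult_right pdi)
    show "L h = - (\<integral>y. (grad \<psi> (y - x) \<bullet> h) * u y \<partial>lborel)"
      unfolding e L_def conv_def
      by (subst Bochner_Integration.integral_sum)
        (auto intro: pdi simp: sum_negf)
  qed
  have "((\<lambda>h. norm (conv \<psi> u (x + h) - conv \<psi> u x - L h) / norm h) \<longlongrightarrow> 0) (at 0)"
    unfolding tendsto_at_iff_sequentially
  proof (intro allI impI)
    fix X :: "nat \<Rightarrow> 'a" assume X0: "\<forall>i. X i \<in> UNIV - {0}" and X: "X \<longlonglongrightarrow> 0"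
    obtain b where b: "\<And>n. norm (X n) \<le> b"
      using X by (meson BseqE convergentI convergent_imp_Bseq)
    \<comment> \<open>The remainder quotient of the kernel. Moving x by \<open>X n\<close> moves the
      argument y - x by \<open>- X n\<close>, whence the sign. Dominated convergence needs
      sequences, so the limit is tested along an arbitrary null sequence \<open>X\<close>.\<close>
    define F where "F n y = (\<psi> (y - x - X n) - \<psi> (y - x) - grad \<psi> (y - x) \<bullet> (- X n)) / norm (X n) * u y"
      for n y
    \<comment> \<open>The increment of the kernel and its linear part are each at most B |X n|,
      which gives 2B. Since |X n| \<le> b, both are zero outside the ball of radius R + |x| +
      b.\<close>
    define W where "W y = 2 * B * \<bar>indicator (cball 0 (R + norm x + b)) y * u y\<bar>" for y
    have [measurable]: "F n \<in> borel_measurable borel" for n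
      unfolding F_def[abs_def] by measurable
    have eq: "conv \<psi> u (x + X n) - conv \<psi> u x - L (X n) = norm (X n) * (\<integral>y. F n y \<partial>lborel)" for n
    proof -
      have "conv \<psi> u (x + X n) - conv \<psi> u x - L (X n) =
        (\<integral>y. \<psi> (y - (x + X n)) * u y - \<psi> (y - x) * u y + (grad \<psi> (y - x) \<bullet> X n) * u y \<partial>lborel)"
        unfolding conv_def Lint
        by (subst Bochner_Integration.integral_add Bochner_Integration.integral_diff;
            (intro conv_integrable \<psi> u Lintg Bochner_Integration.integrable_diff)?)+ simp
      also have "\<dots> = (\<integral>y. norm (X n) * F n y \<partial>lborel)"
      proof (intro Bochner_Integration.integral_cong refl)
        fix y
        have "norm (X n) * F n y = (\<psi> (y - x - X n) - \<psi> (y - x) - grad \<psi> (y - x) \<bullet> (- X n)) * u y"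
          using X0 by (simp add: F_def)
        then show "\<psi> (y - (x + X n)) * u y - \<psi> (y - x) * u y + (grad \<psi> (y - x) \<bullet> X n) * u y
            = norm (X n) * F n y"
          by (simp add: algebra_simps)
      qed
      finally show ?thesis by simp
    qed
    have "(\<lambda>n. \<integral>y. F n y \<partial>lborel) \<longlonglongrightarrow> (\<integral>y. 0 \<partial>(lborel :: 'a measure))"
    proof (rule integral_dominated_convergence[where w = W])
      show "integrable lborel W" unfolding W_def[abs_def]
        using u by (intro integrable_mult_right integrable_abs) (simp add: locally_integrable_def)
      show "AE y in lborel. (\<lambda>n. F n y) \<longlonglongrightarrow> 0"
      proof (rule AE_I2)
        fix y
        have "(\<psi> has_derivative (\<lambda>h. grad \<psi> (y - x) \<bullet> h)) (at (y - x))"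
          by (rule smooth_has_derivative_grad[OF test_function_smooth[OF \<psi>]])
        then have "((\<lambda>h. norm (\<psi> (y - x + h) - \<psi> (y - x) - grad \<psi> (y - x) \<bullet> h) / norm h) \<longlongrightarrow> 0) (at 0)"
          by (simp add: has_derivative_at)
        then have "((\<lambda>h. norm (\<psi> (y - x + h) - \<psi> (y - x) - grad \<psi> (y - x) \<bullet> h) / norm h)
            \<circ> (\<lambda>n. - X n)) \<longlonglongrightarrow> 0"
          using X0 tendsto_minus[OF X] unfolding tendsto_at_iff_sequentially by simp
        then have "(\<lambda>n. \<bar>F n y\<bar>) \<longlonglongrightarrow> 0 * \<bar>u y\<bar>"
          by (intro Lim_transform_eventually[OF tendsto_mult[OF _ tendsto_const[of "\<bar>u y\<bar>"]]])
            (auto simp: F_def abs_mult o_def)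
        then show "(\<lambda>n. F n y) \<longlonglongrightarrow> 0" by (simp add: tendsto_rabs_zero_iff)
      qed
      fix n
      show "AE y in lborel. norm (F n y) \<le> W y"
      proof (rule AE_I2)
        fix y
        show "norm (F n y) \<le> W y"
        proof (cases "norm y \<le> R + norm x + b")
          case True
          have "\<bar>\<psi> (y - x - X n) - \<psi> (y - x) - grad \<psi> (y - x) \<bullet> (- X n)\<bar> \<le> 2 * B * norm (X n)"
          proof -
            have "\<bar>\<psi> (y - x - X n) - \<psi> (y - x)\<bar> \<le> B * norm (X n)"
              using B(3)[of "y - x" "- X n"] by simp
            moreover have "\<bar>grad \<psi> (y - x) \<bullet> (- X n)\<bar> \<le> B * norm (X n)"
              using Cauchy_Schwarz_ineq2[of "grad \<psi> (y - x)" "- X n"] B(2)[of "y - x"]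
              by (metis mult_right_mono norm_ge_zero norm_minus_cancel order_trans)
            ultimately show ?thesis by linarith
          qed
          then have "\<bar>(\<psi> (y - x - X n) - \<psi> (y - x) - grad \<psi> (y - x) \<bullet> (- X n)) / norm (X n)\<bar> \<le> 2 * B"
            using X0 by (simp add: abs_divide pos_divide_le_eq)
          from mult_right_mono[OF this, of "\<bar>u y\<bar>"]
          have "norm (F n y) \<le> 2 * B * \<bar>u y\<bar>" unfolding F_def abs_mult[symmetric] by simp
          then show ?thesis using True by (simp add: W_def)
        next
          case False
          have "norm (y - x) > R" using False b[of n] norm_triangle_ineq2[of y x] norm_ge_zero[of "X n"]
            by linarith
          moreover have "norm (y - x - X n) > R"
            using False b[of n] norm_triangle_ineq2[of y "x + X n"] norm_triangle_ineq[of x "X n"]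
            by (simp add: diff_diff_eq)
          ultimately have "F n y = 0" using R(1) Rg by (simp add: F_def)
          then show ?thesis using B by (simp add: W_def)
        qed
      qed
    qed simp_all
    then have "(\<lambda>n. \<bar>\<integral>y. F n y \<partial>lborel\<bar>) \<longlonglongrightarrow> 0" by (simp add: tendsto_rabs_zero_iff)
    then show "((\<lambda>h. norm (conv \<psi> u (x + h) - conv \<psi> u x - L h) / norm h) \<circ> X) \<longlonglongrightarrow> 0"
      using X0 by (simp add: o_def eq abs_mult)
  qed
  moreover have "bounded_linear L" unfolding L_def
    by (intro bounded_linear_sum bounded_linear_mult_const bounded_linear_inner_left)
  ultimately show ?thesis unfolding has_derivative_at L_def[abs_def] by simp
qed

lemma test_function_uminus: "test_function A \<psi> \<Longrightarrow> test_function A (\<lambda>z. - \<psi> z)"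
  using test_function_mult[OF _ smooth_const[of "-1"]] by simp

lemma pd_conv:
  fixes \<psi> :: "'a::euclidean_space \<Rightarrow> real"
  assumes \<psi>: "test_function UNIV \<psi>" and u: "locally_integrable u" and i: "i \<in> Basis"
  shows "pd (conv \<psi> u) i = conv (\<lambda>z. - pd \<psi> i z) u"
proof
  fix x
  have "pd (conv \<psi> u) i x = (\<Sum>j\<in>Basis. (i \<bullet> j) * conv (\<lambda>z. - pd \<psi> j z) u x)"
    using fun_cong[OF frechet_derivative_at[OF conv_has_derivative[OF \<psi> u, of x]], of i] by (rule sym)
  also have "\<dots> = (\<Sum>j\<in>Basis. if j = i then conv (\<lambda>z. - pd \<psi> j z) u x else 0)"
    using i by (intro sum.cong) (auto simp: inner_Basis)
  also have "\<dots> = conv (\<lambda>z. - pd \<psi> i z) u x" using i by simp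
  finally show "pd (conv \<psi> u) i x = conv (\<lambda>z. - pd \<psi> i z) u x" .
qed

lemma smooth_conv:
  fixes \<psi> :: "'a::euclidean_space \<Rightarrow> real"
  assumes \<psi>: "test_function UNIV \<psi>" and u: "locally_integrable u"
  shows "smooth_on (conv \<psi> u) UNIV"
proof (rule smooth_on_coinduct[of "{conv \<psi> u | \<psi>. test_function UNIV \<psi>}"])
  fix f assume "f \<in> {conv \<psi> u | \<psi>. test_function UNIV \<psi>}"
  then obtain \<psi> where \<psi>: "f = conv \<psi> u" "test_function UNIV \<psi>" by auto
  show "(\<forall>x. f differentiable (at x)) \<and> (\<forall>i\<in>Basis. pd f i \<in> {conv \<psi> u | \<psi>. test_function UNIV \<psi>})"
  proof (intro conjI allI ballI)
    fix x show "f differentiable (at x)"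
      using conv_has_derivative[OF \<psi>(2) u] \<psi>(1) by (auto simp: differentiable_def)
  next
    fix i :: 'a assume i: "i \<in> Basis"
    have "pd f i = conv (\<lambda>z. - pd \<psi> i z) u" using pd_conv[OF \<psi>(2) u i] \<psi>(1) by simp
    then show "pd f i \<in> {conv \<psi> u | \<psi>. test_function UNIV \<psi>}"
      using test_function_uminus[OF test_function_pd[OF \<psi>(2) i]] by blast
  qed
qed (use \<psi> in blast)

section \<open>Changes of variables and integration by parts\<close>

lemma lborel_integral_affine:
  fixes f :: "'a::euclidean_space \<Rightarrow> real"
  assumes [measurable]: "f \<in> borel_measurable borel" and c: "0 < c"
  shows "(\<integral>y. f y \<partial>lborel) = c ^ DIM('a) * (\<integral>z. f (t + c *\<^sub>R z) \<partial>lborel)"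
proof -
  have "(\<integral>y. f y \<partial>lborel) =
      (\<integral>y. f y \<partial>density (distr lborel borel (\<lambda>x. t + c *\<^sub>R x)) (\<lambda>_. ennreal (c ^ DIM('a))))"
    using lborel_affine[of c t] c by (simp add: ennreal_power)
  also have "\<dots> = c ^ DIM('a) * (\<integral>z. f (t + c *\<^sub>R z) \<partial>lborel)"
    using c by (subst integral_density) (auto simp: integral_distr)
  finally show ?thesis .
qed

lemma lborel_nn_integral_affine:
  fixes f :: "'a::euclidean_space \<Rightarrow> ennreal"
  assumes [measurable]: "f \<in> borel_measurable borel" and c: "0 < c"
  shows "(\<integral>\<^sup>+y. f y \<partial>lborel) = ennreal (c ^ DIM('a)) * (\<integral>\<^sup>+z. f (t + c *\<^sub>R z) \<partial>lborel)"
proof -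
  have "(\<integral>\<^sup>+y. f y \<partial>lborel) =
      (\<integral>\<^sup>+y. f y \<partial>density (distr lborel borel (\<lambda>x. t + c *\<^sub>R x)) (\<lambda>_. ennreal (c ^ DIM('a))))"
    using lborel_affine[of c t] c by (simp add: ennreal_power)
  also have "\<dots> = ennreal (c ^ DIM('a)) * (\<integral>\<^sup>+z. f (t + c *\<^sub>R z) \<partial>lborel)"
    using c by (subst nn_integral_density) (auto simp: nn_integral_distr nn_integral_cmult)
  finally show ?thesis .
qed

lemma test_function_integrable: "test_function UNIV \<psi> \<Longrightarrow> integrable lborel \<psi>"
  using conv_integrable[OF _ locally_integrable_const[of 1], of \<psi> 0] by simp

text \<open>By translation invariance the convolution with the constant 1 is constant; its
  derivative, which is zero, is minus the integral in question.\<close>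

lemma integral_pd_test_function:
  fixes \<psi> :: "'a::euclidean_space \<Rightarrow> real"
  assumes \<psi>: "test_function UNIV \<psi>" and i: "i \<in> Basis"
  shows "(\<integral>y. pd \<psi> i y \<partial>lborel) = 0"
proof -
  have "conv \<psi> (\<lambda>x. 1) = (\<lambda>x. (\<integral>y. \<psi> y \<partial>lborel))"
  proof
    fix x show "conv \<psi> (\<lambda>x. 1) x = (\<integral>y. \<psi> y \<partial>lborel)"
      using lborel_integral_affine[of \<psi> 1 "- x"] test_function_borel[OF \<psi>] by (simp add: conv_def)
  qed
  then have "pd (conv \<psi> (\<lambda>x. 1)) i 0 = 0"
    using frechet_derivative_const by simp
  then have "conv (\<lambda>z. - pd \<psi> i z) (\<lambda>x. 1) 0 = 0"
    using pd_conv[OF \<psi> locally_integrable_const i, of 1] by metis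
  then show ?thesis by (simp add: conv_def)
qed

text \<open>The product of f and \<phi> is a test function, so its partial derivative integrates to
  zero; the product rule splits that integral.\<close>

lemma integral_by_parts:
  fixes \<phi> :: "'a::euclidean_space \<Rightarrow> real"
  assumes \<phi>: "test_function UNIV \<phi>" and f: "smooth_on f UNIV" and i: "i \<in> Basis"
  shows "(\<integral>y. f y * pd \<phi> i y \<partial>lborel) = - (\<integral>y. pd f i y * \<phi> y \<partial>lborel)"
proof -
  have "pd (\<lambda>x. f x * \<phi> x) i y = f y * pd \<phi> i y + pd f i y * \<phi> y" for y
    using smooth_on_differentiable f test_function_smooth[OF \<phi>] by (intro pd_mult) auto
  then have "(\<integral>y. f y * pd \<phi> i y + pd f i y * \<phi> y \<partial>lborel) = 0"
    using integral_pd_test_function[OF test_function_mult[OF \<phi> f] i] by simp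
  moreover have "integrable lborel (\<lambda>y. f y * pd \<phi> i y)" "integrable lborel (\<lambda>y. pd f i y * \<phi> y)"
    using f \<phi> i by (auto intro!: test_function_integrable test_function_mult test_function_pd smooth_on_pd)
  ultimately show ?thesis by simp
qed

lemma integral_lebesgue_on_eq_lborel:
  fixes f :: "'a::euclidean_space \<Rightarrow> real"
  assumes "A \<in> sets borel" "f \<in> borel_measurable borel" "\<And>x. x \<notin> A \<Longrightarrow> f x = 0"
  shows "(\<integral>x. f x \<partial>lebesgue_on A) = (\<integral>x. f x \<partial>lborel)"
proof -
  have "(\<integral>x. f x \<partial>lebesgue_on A) = (\<integral>x. indicator A x *\<^sub>R f x \<partial>lebesgue)"
    using assms by (subst integral_restrict_space) auto
  also have "(\<lambda>x. indicator A x *\<^sub>R f x) = f" using assms(3) by (auto simp: fun_eq_iff indicator_def)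
  finally show ?thesis using assms by (simp add: integral_completion)
qed

text \<open>A test function of \<open>A\<close> and its derivatives vanish off \<open>A\<close>, so
  integrals over \<open>A\<close> are integrals over the whole space, where integration by parts has
  no boundary term.\<close>

lemma smooth_is_weak_gradient:
  fixes f :: "'a::euclidean_space \<Rightarrow> real"
  assumes f: "smooth_on f UNIV" and A: "open A"
  shows "is_weak_gradient A f (grad f)"
  unfolding is_weak_gradient_def
proof (intro allI impI ballI)
  fix \<phi> i assume \<phi>: "test_function A \<phi>" and i: "i \<in> (Basis :: 'a set)"
  have [measurable]: "f \<in> borel_measurable borel" "pd f i \<in> borel_measurable borel"
    using f i by (auto intro!: borel_measurable_continuous_onI smooth_on_continuous smooth_on_pd)
  have z: "pd \<phi> i x = 0" "\<phi> x = 0" if "x \<notin> A" for x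
    using test_function_pd[OF \<phi> i] \<phi> that by (auto simp: test_function_def)
  note [measurable] = test_function_borel[OF \<phi>] test_function_borel[OF test_function_pd[OF \<phi> i]]
  have "(\<integral>x. f x * pd \<phi> i x \<partial>lebesgue_on A) = (\<integral>x. f x * pd \<phi> i x \<partial>lborel)"
    using A z by (intro integral_lebesgue_on_eq_lborel) auto
  also have "\<dots> = - (\<integral>x. pd f i x * \<phi> x \<partial>lborel)"
    by (rule integral_by_parts[OF test_function_UNIV[OF \<phi>] f i])
  also have "(\<integral>x. pd f i x * \<phi> x \<partial>lborel) = (\<integral>x. pd f i x * \<phi> x \<partial>lebesgue_on A)"
    using A z by (intro integral_lebesgue_on_eq_lborel[symmetric]) auto
  finally show "(\<integral>x. f x * pd \<phi> i x \<partial>lebesgue_on A) =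
      - (\<integral>x. (grad f x \<bullet> i) * \<phi> x \<partial>lebesgue_on A)"
    using i by (simp add: grad_inner_Basis)
qed

subsection \<open>The space \<open>L\<^sup>2\<close>\<close>

lemma L2_norm_nonneg [simp]: "0 \<le> L2_norm A f"
  by (simp add: L2_norm_def)

lemma L2_norm_sq: "(L2_norm A f)\<^sup>2 = (\<integral>x. (norm (f x))\<^sup>2 \<partial>lebesgue_on A)"
  by (simp add: L2_norm_def)

lemma L2_D:
  "f \<in> L2 A \<Longrightarrow> f \<in> borel_measurable (lebesgue_on A)"
  "f \<in> L2 A \<Longrightarrow> integrable (lebesgue_on A) (\<lambda>x. (norm (f x))\<^sup>2)"
  by (auto simp: L2_def)

lemma norm_add_sq_le: "(norm (x + y))\<^sup>2 \<le> 2 * (norm x)\<^sup>2 + 2 * (norm (y :: 'b::real_inner))\<^sup>2"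
proof -
  have "(norm (x + y))\<^sup>2 + (norm (x - y))\<^sup>2 = 2 * (norm x)\<^sup>2 + 2 * (norm y)\<^sup>2"
    by (simp add: power2_norm_eq_inner algebra_simps inner_commute)
  then show ?thesis by (smt (verit) zero_le_power2)
qed

text \<open>Bounds L^1 norms on sets of finite measure by squared L^2 norms.\<close>

lemma abs_le_one_plus_sq: "\<bar>t\<bar> \<le> 1 + (t::real)\<^sup>2"
proof -
  have "0 \<le> (\<bar>t\<bar> - 1)\<^sup>2" by simp
  then show ?thesis using abs_ge_zero[of t] unfolding power2_diff by simp
qed

lemma L2_bound:
  assumes "f \<in> borel_measurable (lebesgue_on A)" "integrable (lebesgue_on A) g"
    "\<And>x. (norm (f x))\<^sup>2 \<le> g x"
  shows "f \<in> L2 A"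
proof -
  have "integrable (lebesgue_on A) (\<lambda>x. (norm (f x))\<^sup>2)"
    by (rule Bochner_Integration.integrable_bound[OF assms(2)])
      (use assms(1,3) in \<open>auto intro!: AE_I2 order_trans[OF assms(3) abs_ge_self]\<close>)
  then show ?thesis using assms(1) by (simp add: L2_def)
qed

lemma L2_scaleR: "f \<in> L2 A \<Longrightarrow> (\<lambda>x. c *\<^sub>R f x) \<in> L2 A"
  by (auto simp: L2_def power_mult_distrib)

lemma L2_add: "f \<in> L2 A \<Longrightarrow> g \<in> L2 A \<Longrightarrow> (\<lambda>x. f x + g x) \<in> L2 A"
  by (rule L2_bound[where g = "\<lambda>x. 2 * (norm (f x))\<^sup>2 + 2 * (norm (g x))\<^sup>2"])
    (auto simp: norm_add_sq_le L2_def)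

lemma L2_diff: "f \<in> L2 A \<Longrightarrow> g \<in> L2 A \<Longrightarrow> (\<lambda>x. f x - g x) \<in> L2 A"
  using L2_add[of f A "\<lambda>x. - 1 *\<^sub>R g x"] L2_scaleR[of g A "-1"] by simp

lemma L2_zero: "(\<lambda>x. 0) \<in> L2 A"
  by (simp add: L2_def)

lemma L2_inner_left: "f \<in> L2 A \<Longrightarrow> (\<lambda>x. f x \<bullet> i) \<in> L2 A"
proof (rule L2_bound[where g = "\<lambda>x. (norm i)\<^sup>2 * (norm (f x))\<^sup>2"])
  fix x assume "f \<in> L2 A"
  have "\<bar>f x \<bullet> i\<bar>\<^sup>2 \<le> (norm i * norm (f x))\<^sup>2"
    using Cauchy_Schwarz_ineq2[of "f x" i] by (intro power_mono) (auto simp: mult.commute)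
  then show "(norm (f x \<bullet> i))\<^sup>2 \<le> (norm i)\<^sup>2 * (norm (f x))\<^sup>2" by (simp add: power_mult_distrib)
qed (auto simp: L2_def)

lemma L2_norm_mult_integrable:
  assumes "f \<in> L2 A" "g \<in> L2 A"
  shows "integrable (lebesgue_on A) (\<lambda>x. norm (f x) * norm (g x))"
proof (rule Bochner_Integration.integrable_bound)
  show "integrable (lebesgue_on A) (\<lambda>x. (norm (f x))\<^sup>2 + (norm (g x))\<^sup>2)"
    using assms by (auto simp: L2_def)
  show "AE x in lebesgue_on A. norm (norm (f x) * norm (g x)) \<le> norm ((norm (f x))\<^sup>2 + (norm (g x))\<^sup>2)"
  proof (rule AE_I2)
    fix x
    have "0 \<le> (norm (f x) - norm (g x))\<^sup>2" "0 \<le> (norm (f x))\<^sup>2" "0 \<le> (norm (g x))\<^sup>2" by auto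
    then have "norm (f x) * norm (g x) \<le> (norm (f x))\<^sup>2 + (norm (g x))\<^sup>2"
      unfolding power2_diff by linarith
    then show "norm (norm (f x) * norm (g x)) \<le> norm ((norm (f x))\<^sup>2 + (norm (g x))\<^sup>2)" by simp
  qed
qed (use L2_D(1)[OF assms(1)] L2_D(1)[OF assms(2)] in measurable)

lemma L2_Cauchy_Schwarz:
  assumes "f \<in> L2 A" "g \<in> L2 A"
  shows "(\<integral>x. norm (f x) * norm (g x) \<partial>lebesgue_on A) \<le> L2_norm A f * L2_norm A g"
proof -
  let ?M = "lebesgue_on A"
  have [measurable]: "f \<in> borel_measurable ?M" "g \<in> borel_measurable ?M"
    using assms by (auto simp: L2_def)
  let ?I = "\<integral>x. norm (f x) * norm (g x) \<partial>?M"
  have I: "ennreal ?I = (\<integral>\<^sup>+x. ennreal (norm (f x)) * ennreal (norm (g x)) \<partial>?M)"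
    by (subst nn_integral_eq_integral[OF L2_norm_mult_integrable[OF assms], symmetric])
      (auto simp: ennreal_mult)
  have sq: "ennreal ((L2_norm A h)\<^sup>2) = (\<integral>\<^sup>+x. (ennreal (norm (h x)))\<^sup>2 \<partial>?M)"
    if "h \<in> L2 A" for h :: "'a \<Rightarrow> 'e::euclidean_space"
    unfolding L2_norm_sq
    by (subst nn_integral_eq_integral[OF L2_D(2)[OF that], symmetric]) (auto simp: ennreal_power)
  have "(ennreal ?I)\<^sup>2 \<le> ennreal ((L2_norm A f)\<^sup>2) * ennreal ((L2_norm A g)\<^sup>2)"
    unfolding I sq[OF assms(1)] sq[OF assms(2)] by (rule Cauchy_Schwarz_nn_integral) measurable
  then have "?I\<^sup>2 \<le> (L2_norm A f * L2_norm A g)\<^sup>2"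
    by (simp add: ennreal_power flip: ennreal_mult power_mult_distrib)
  then show ?thesis by (rule power2_le_imp_le) simp
qed

lemma L2_inner_integrable:
  assumes "f \<in> L2 A" "g \<in> L2 A"
  shows "integrable (lebesgue_on A) (\<lambda>x. f x \<bullet> g x)"
  by (rule Bochner_Integration.integrable_bound[OF L2_norm_mult_integrable[OF assms]])
    (use L2_D(1)[OF assms(1)] L2_D(1)[OF assms(2)] in
      \<open>auto intro!: AE_I2 Cauchy_Schwarz_ineq2 borel_measurable_inner\<close>)

lemma L2_inner_bound:
  assumes "f \<in> L2 A" "g \<in> L2 A"
  shows "\<bar>\<integral>x. f x \<bullet> g x \<partial>lebesgue_on A\<bar> \<le> L2_norm A f * L2_norm A g"
proof -
  have "\<bar>\<integral>x. f x \<bullet> g x \<partial>lebesgue_on A\<bar> \<le> (\<integral>x. \<bar>f x \<bullet> g x\<bar> \<partial>lebesgue_on A)"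
    using integral_norm_bound[of "lebesgue_on A" "\<lambda>x. f x \<bullet> g x"] by simp
  also have "\<dots> \<le> (\<integral>x. norm (f x) * norm (g x) \<partial>lebesgue_on A)"
    by (intro integral_mono integrable_abs L2_inner_integrable L2_norm_mult_integrable assms
        Cauchy_Schwarz_ineq2)
  also have "\<dots> \<le> L2_norm A f * L2_norm A g" by (rule L2_Cauchy_Schwarz[OF assms])
  finally show ?thesis .
qed

lemma L2_norm_scaleR: "L2_norm A (\<lambda>x. c *\<^sub>R f x) = \<bar>c\<bar> * L2_norm A f"
  by (simp add: L2_norm_def power_mult_distrib real_sqrt_mult)

lemma L2_norm_triangle:
  assumes "f \<in> L2 A" "g \<in> L2 A"
  shows "L2_norm A (\<lambda>x. f x + g x) \<le> L2_norm A f + L2_norm A g"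
proof -
  note i = L2_D(2)[OF assms(1)] L2_D(2)[OF assms(2)] L2_norm_mult_integrable[OF assms]
  have "(L2_norm A (\<lambda>x. f x + g x))\<^sup>2 \<le>
    (\<integral>x. (norm (f x))\<^sup>2 + 2 * (norm (f x) * norm (g x)) + (norm (g x))\<^sup>2 \<partial>lebesgue_on A)"
    unfolding L2_norm_sq
  proof (rule integral_mono)
    fix x
    have "(norm (f x + g x))\<^sup>2 \<le> (norm (f x) + norm (g x))\<^sup>2"
      by (intro power_mono norm_triangle_ineq) simp
    then show "(norm (f x + g x))\<^sup>2 \<le> (norm (f x))\<^sup>2 + 2 * (norm (f x) * norm (g x)) + (norm (g x))\<^sup>2"
      by (simp add: power2_sum)
  qed (use i L2_D(2)[OF L2_add[OF assms]] in auto)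
  also have "\<dots> = (L2_norm A f)\<^sup>2 + 2 * (\<integral>x. norm (f x) * norm (g x) \<partial>lebesgue_on A) + (L2_norm A g)\<^sup>2"
    using i by (simp add: L2_norm_sq)
  also have "\<dots> \<le> (L2_norm A f + L2_norm A g)\<^sup>2"
    using L2_Cauchy_Schwarz[OF assms] by (simp add: power2_sum)
  finally show ?thesis by (rule power2_le_imp_le) simp
qed

lemma L2_norm_minus_commute: "L2_norm A (\<lambda>x. f x - g x) = L2_norm A (\<lambda>x. g x - f x)"
  by (simp add: L2_norm_def norm_minus_commute)

lemma L2_norm_diff_triangle:
  assumes "f \<in> L2 A" "g \<in> L2 A" "h \<in> L2 A"
  shows "L2_norm A (\<lambda>x. f x - h x) \<le> L2_norm A (\<lambda>x. f x - g x) + L2_norm A (\<lambda>x. g x - h x)"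
  using L2_norm_triangle[OF L2_diff[OF assms(1,2)] L2_diff[OF assms(2,3)]] by simp

lemma L2_norm_mono:
  assumes "g \<in> L2 A" "f \<in> L2 A" "\<And>x. norm (f x) \<le> norm (g x)"
  shows "L2_norm A f \<le> L2_norm A g"
  unfolding L2_norm_def
  using assms by (intro real_sqrt_le_mono integral_mono) (auto simp: L2_def power_mono)

lemma L2_norm_cong_AE:
  assumes "AE x in lebesgue_on A. f x = g x"
    "f \<in> borel_measurable (lebesgue_on A)" "g \<in> borel_measurable (lebesgue_on A)"
  shows "L2_norm A f = L2_norm A g"
  unfolding L2_norm_def using assms by (intro arg_cong[of _ _ sqrt] integral_cong_AE) auto

lemma L2_norm_eq_0_AE:
  assumes "f \<in> L2 A" "L2_norm A f = 0"
  shows "AE x in lebesgue_on A. f x = 0"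
  using integral_nonneg_eq_0_iff_AE[OF L2_D(2)[OF assms(1)]] assms(2)
  by (simp add: L2_norm_def)

lemma L2_subset:
  assumes "f \<in> L2 A" "B \<subseteq> A" "A \<in> sets lebesgue" "B \<in> sets lebesgue"
  shows "f \<in> L2 B" "L2_norm B f \<le> L2_norm A f"
proof -
  have i: "integrable lebesgue (\<lambda>x. indicator A x *\<^sub>R (norm (f x))\<^sup>2)"
    using L2_D(2)[OF assms(1)] assms(3) by (subst (asm) integrable_restrict_space) auto
  have ib: "integrable lebesgue (\<lambda>x. indicator B x *\<^sub>R (norm (f x))\<^sup>2)"
    using set_integrable_subset[of lebesgue A "\<lambda>x. (norm (f x))\<^sup>2" B] i assms
    by (simp add: set_integrable_def)
  have m: "f \<in> borel_measurable (lebesgue_on B)"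
    using assms measurable_restrict_mono[OF L2_D(1)[OF assms(1)] assms(2)] by simp
  then show "f \<in> L2 B" using ib assms(4) by (auto simp: L2_def integrable_restrict_space)
  have "(\<integral>x. (norm (f x))\<^sup>2 \<partial>lebesgue_on B) \<le> (\<integral>x. (norm (f x))\<^sup>2 \<partial>lebesgue_on A)"
    using assms(3,4) i ib assms(2)
    by (subst (1 2) integral_restrict_space) (auto intro!: integral_mono simp: indicator_def)
  then show "L2_norm B f \<le> L2_norm A f" by (simp add: L2_norm_def)
qed

text \<open>Written with the midpoint: a lower bound on the norm of midpoints becomes an upper bound
  on distances, the form that almost minimal elements call for.\<close>

lemma L2_parallelogram:
  assumes "f \<in> L2 A" "g \<in> L2 A"
  shows "(L2_norm A (\<lambda>x. f x - g x))\<^sup>2 =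
    2 * (L2_norm A f)\<^sup>2 + 2 * (L2_norm A g)\<^sup>2 - 4 * (L2_norm A (\<lambda>x. (1/2) *\<^sub>R (f x + g x)))\<^sup>2"
proof -
  note i = L2_D(2)[OF assms(1)] L2_D(2)[OF assms(2)]
    L2_D(2)[OF L2_scaleR[OF L2_add[OF assms], of "1/2"]]
  have "(norm (f x - g x))\<^sup>2 = 2 * (norm (f x))\<^sup>2 + 2 * (norm (g x))\<^sup>2 -
      4 * (norm ((1/2) *\<^sub>R (f x + g x)))\<^sup>2" for x
    unfolding power2_norm_eq_inner by (simp add: algebra_simps inner_commute)
  then have "(L2_norm A (\<lambda>x. f x - g x))\<^sup>2 = (\<integral>x. 2 * (norm (f x))\<^sup>2 + 2 * (norm (g x))\<^sup>2 -
      4 * (norm ((1/2) *\<^sub>R (f x + g x)))\<^sup>2 \<partial>lebesgue_on A)" unfolding L2_norm_sq by presburger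
  also have "\<dots> = 2 * (L2_norm A f)\<^sup>2 + 2 * (L2_norm A g)\<^sup>2 - 4 * (L2_norm A (\<lambda>x. (1/2) *\<^sub>R (f x + g x)))\<^sup>2"
    unfolding L2_norm_sq
    by (subst Bochner_Integration.integral_diff Bochner_Integration.integral_add;
        (intro Bochner_Integration.integrable_add integrable_mult_right i)?)+ simp
  finally show ?thesis .
qed

lemma L2_nn_integral:
  "f \<in> L2 A \<Longrightarrow> (\<integral>\<^sup>+x. ennreal ((norm (f x))\<^sup>2) \<partial>lebesgue_on A) = ennreal ((L2_norm A f)\<^sup>2)"
  unfolding L2_norm_sq by (intro nn_integral_eq_integral L2_D) auto

lemma L2_nn_integralI:
  assumes "f \<in> borel_measurable (lebesgue_on A)" "0 \<le> c"
    "(\<integral>\<^sup>+x. ennreal ((norm (f x))\<^sup>2) \<partial>lebesgue_on A) \<le> ennreal (c\<^sup>2)"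
  shows "f \<in> L2 A" "L2_norm A f \<le> c"
proof -
  show "f \<in> L2 A" using assms by (auto simp: L2_def integrable_iff_bounded
        intro: order_le_less_trans[OF _ ennreal_less_top])
  from L2_nn_integral[OF this] assms(3) have "(L2_norm A f)\<^sup>2 \<le> c\<^sup>2" by simp
  then show "L2_norm A f \<le> c" using assms(2) by (rule power2_le_imp_le)
qed

text \<open>Riesz-Fischer: a rapidly converging subsequence has a limit almost everywhere, and
  Fatou's lemma makes it the limit of the whole sequence in norm.\<close>

lemma L2_complete:
  fixes F :: "nat \<Rightarrow> 'a::euclidean_space \<Rightarrow> 'b::euclidean_space"
  assumes F: "\<And>n. F n \<in> L2 A"
    and C: "\<And>e. 0 < e \<Longrightarrow> \<exists>N. \<forall>m\<ge>N. \<forall>n\<ge>N. L2_norm A (\<lambda>x. F m x - F n x) < e"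
  obtains G where "G \<in> L2 A" "(\<lambda>n. L2_norm A (\<lambda>x. F n x - G x)) \<longlonglongrightarrow> 0"
proof -
  let ?M = "lebesgue_on A"
  have [measurable]: "F n \<in> borel_measurable ?M" for n using F by (auto simp: L2_def)
  \<comment> \<open>The rate 3^(-k) is chosen against the weight 4^k below: the weighted squares
    have integrals at most (4/9)^k, a summable sequence, and finiteness of their sum at a point
    forces decay like 2^(-k) there.\<close>
  have "\<forall>k. \<exists>N. \<forall>m\<ge>N. \<forall>n\<ge>N. L2_norm A (\<lambda>x. F m x - F n x) < (1/3) ^ k"
    using C by simp
  then obtain N where N: "\<And>k m n. m \<ge> N k \<Longrightarrow> n \<ge> N k \<Longrightarrow> L2_norm A (\<lambda>x. F m x - F n x) < (1/3) ^ k"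
    by metis
  \<comment> \<open>Running maxima make the indices nondecreasing, so that \<open>s k\<close> and
    \<open>s (Suc k)\<close> both lie beyond \<open>N k\<close>.\<close>
  define s where "s k = Max (N ` {..k})" for k
  have s: "N k \<le> s k" "s k \<le> s (Suc k)" for k
    unfolding s_def by (auto intro!: Max_mono)
  define D where "D k x = norm (F (s (Suc k)) x - F (s k) x)" for k x
  have [measurable]: "D k \<in> borel_measurable ?M" for k unfolding D_def[abs_def] by measurable
  have D: "(\<integral>\<^sup>+x. ennreal (4 ^ k * (D k x)\<^sup>2) \<partial>?M) \<le> ennreal ((4/9) ^ k)" for k
  proof -
    let ?f = "\<lambda>x. F (s (Suc k)) x - F (s k) x"
    have "(\<integral>\<^sup>+x. ennreal (4 ^ k * (D k x)\<^sup>2) \<partial>?M) = (\<integral>\<^sup>+x. ennreal (4 ^ k) * ennreal ((norm (?f x))\<^sup>2) \<partial>?M)"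
      by (simp add: D_def ennreal_mult)
    also have "\<dots> = ennreal (4 ^ k) * ennreal ((L2_norm A ?f)\<^sup>2)"
      by (subst nn_integral_cmult) (use L2_nn_integral[OF L2_diff[OF F F]] in auto)
    also have "\<dots> = ennreal (4 ^ k * (L2_norm A ?f)\<^sup>2)" by (simp add: ennreal_mult)
    also have "\<dots> \<le> ennreal (4 ^ k * ((1/3) ^ k)\<^sup>2)"
      using N[of k "s (Suc k)" "s k"] s[of k]
      by (intro ennreal_leI mult_left_mono power_mono) auto
    also have "(4::real) ^ k * ((1/3) ^ k)\<^sup>2 = (4/9) ^ k"
      by (simp add: power2_eq_square flip: power_mult_distrib)
    finally show ?thesis .
  qed
  have "(\<integral>\<^sup>+x. (\<Sum>k. ennreal (4 ^ k * (D k x)\<^sup>2)) \<partial>?M) = (\<Sum>k. \<integral>\<^sup>+x. ennreal (4 ^ k * (D k x)\<^sup>2) \<partial>?M)"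
    by (rule nn_integral_suminf) measurable
  also have "\<dots> \<le> (\<Sum>k. ennreal ((4/9) ^ k))" by (intro suminf_le D) auto
  also have "\<dots> = ennreal (\<Sum>k. (4/9) ^ k)" by (intro suminf_ennreal2) (auto intro: summable_geometric)
  also have "\<dots> < top" by simp
  finally have "AE x in ?M. (\<Sum>k. ennreal (4 ^ k * (D k x)\<^sup>2)) \<noteq> \<infinity>"
    by (intro nn_integral_PInf_AE) (auto simp: less_top)
  then have conv: "AE x in ?M. (\<lambda>k. F (s k) x) \<longlonglongrightarrow> lim (\<lambda>k. F (s k) x)"
  proof eventually_elim
    case (elim x)
    have sm: "summable (\<lambda>k. 4 ^ k * (D k x)\<^sup>2)"
      using elim by (intro summable_suminf_not_top) (auto simp: infinity_ennreal_def)
    define K where "K = (\<Sum>k. 4 ^ k * (D k x)\<^sup>2)"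
    have "(2 ^ k * D k x)\<^sup>2 \<le> K" for k
    proof -
      have "((2::real) ^ k)\<^sup>2 = 4 ^ k" by (simp add: power2_eq_square flip: power_mult_distrib)
      then show ?thesis
        using sum_le_suminf[OF sm, of "{k}"] by (simp add: K_def power_mult_distrib)
    qed
    then have "2 ^ k * D k x \<le> sqrt K" for k
      by (rule real_le_rsqrt)
    then have DK: "D k x \<le> sqrt K * (1/2) ^ k" for k
      by (simp add: field_simps power_one_over)
    have "summable (\<lambda>k. F (s (Suc k)) x - F (s k) x)"
    proof (rule summable_comparison_test)
      show "\<exists>N. \<forall>k\<ge>N. norm (F (s (Suc k)) x - F (s k) x) \<le> sqrt K * (1/2) ^ k"
        using DK by (auto simp: D_def)
      show "summable (\<lambda>k. sqrt K * (1/2) ^ k)" by (intro summable_mult summable_geometric) simp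
    qed
    then have "convergent (\<lambda>n. \<Sum>k<n. F (s (Suc k)) x - F (s k) x)"
      by (simp add: summable_iff_convergent)
    then have "convergent (\<lambda>n. F (s n) x - F (s 0) x)" by (simp only: sum_lessThan_telescope[of "\<lambda>k. F (s k) x"])
    then have "convergent (\<lambda>n. F (s n) x)"
      by (simp add: convergent_diff_const_right_iff)
    then show ?case by (simp add: convergent_LIMSEQ_iff)
  qed
  define G where "G x = lim (\<lambda>k. F (s k) x)" for x
  have [measurable]: "G \<in> borel_measurable ?M"
    unfolding G_def[abs_def] by (rule borel_measurable_lim_metric) measurable
  \<comment> \<open>With n fixed, Fatou's lemma along the subsequence passes the Cauchy estimate to
    the pointwise limit. It also gives square integrability of the difference, hence of
    \<open>G\<close>.\<close>
  have key: "L2_norm A (\<lambda>x. F n x - G x) \<le> (1/3) ^ k \<and> (\<lambda>x. F n x - G x) \<in> L2 A" if n: "n \<ge> N k" for n k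
  proof -
    have Ns: "N k \<le> s l" if "l \<ge> k" for l
      unfolding s_def using that by (intro Max_ge) auto
    have "(\<integral>\<^sup>+x. ennreal ((norm (F n x - G x))\<^sup>2) \<partial>?M) =
        (\<integral>\<^sup>+x. liminf (\<lambda>l. ennreal ((norm (F n x - F (s l) x))\<^sup>2)) \<partial>?M)"
    proof (rule nn_integral_cong_AE)
      show "AE x in ?M. ennreal ((norm (F n x - G x))\<^sup>2) = liminf (\<lambda>l. ennreal ((norm (F n x - F (s l) x))\<^sup>2))"
        using conv
      proof eventually_elim
        case (elim x)
        have "(\<lambda>l. ennreal ((norm (F n x - F (s l) x))\<^sup>2)) \<longlonglongrightarrow> ennreal ((norm (F n x - G x))\<^sup>2)"
          unfolding G_def using elim by (intro tendsto_intros tendsto_ennrealI)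
        from lim_imp_Liminf[OF _ this] show ?case by simp
      qed
    qed
    also have "\<dots> \<le> liminf (\<lambda>l. \<integral>\<^sup>+x. ennreal ((norm (F n x - F (s l) x))\<^sup>2) \<partial>?M)"
      by (rule nn_integral_liminf) measurable
    also have "\<dots> \<le> ennreal (((1/3) ^ k)\<^sup>2)"
    proof (rule Liminf_le)
      show "\<forall>\<^sub>F l in sequentially. (\<integral>\<^sup>+x. ennreal ((norm (F n x - F (s l) x))\<^sup>2) \<partial>?M) \<le> ennreal (((1/3) ^ k)\<^sup>2)"
        using eventually_ge_at_top[of k]
      proof eventually_elim
        case (elim l)
        then show ?case using N[OF n Ns[OF elim]]
          by (subst L2_nn_integral[OF L2_diff[OF F F]]) (auto intro!: ennreal_leI power_mono)
      qed
    qed simp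
    finally show ?thesis by (intro conjI L2_nn_integralI) auto
  qed
  have "G \<in> L2 A"
    using L2_diff[OF F[of "N 0"] conjunct2[OF key[of 0 "N 0"]]] by simp
  moreover have "(\<lambda>n. L2_norm A (\<lambda>x. F n x - G x)) \<longlonglongrightarrow> 0"
  proof (rule LIMSEQ_I)
    fix e :: real assume "0 < e"
    then obtain k where "(1/3) ^ k < e" using real_arch_pow_inv[of e "1/3"] by auto
    then show "\<exists>no. \<forall>n\<ge>no. norm (L2_norm A (\<lambda>x. F n x - G x) - 0) < e"
      using key[of k] by (intro exI[of _ "N k"]) fastforce
  qed
  ultimately show ?thesis by (rule that)
qed

text \<open>The dyadic convex combinations of the members with index at least \<open>m\<close>.
  Closure under midpoints is what the parallelogram law uses, and it leaves a single binary case in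
  each induction over the hull.\<close>

inductive_set tail_hull :: "(nat \<Rightarrow> 'a \<Rightarrow> 'b::real_vector) \<Rightarrow> nat \<Rightarrow> ('a \<Rightarrow> 'b) set" for F m where
  base: "m \<le> n \<Longrightarrow> F n \<in> tail_hull F m"
| mid: "f \<in> tail_hull F m \<Longrightarrow> g \<in> tail_hull F m \<Longrightarrow> (\<lambda>x. (1/2) *\<^sub>R (f x + g x)) \<in> tail_hull F m"

lemma tail_hull_antimono: "m \<le> l \<Longrightarrow> tail_hull F l \<subseteq> tail_hull F m"
proof
  fix f assume "m \<le> l" "f \<in> tail_hull F l"
  from this(2,1) show "f \<in> tail_hull F m"
    by (induction rule: tail_hull.induct) (auto intro: tail_hull.intros)
qed

lemma tail_hull_L2:
  "f \<in> tail_hull F m \<Longrightarrow> (\<And>n. F n \<in> L2 A) \<Longrightarrow> f \<in> L2 A"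
  by (induction rule: tail_hull.induct) (auto intro: L2_scaleR L2_add)

text \<open>A form of the Banach--Saks and Mazur theorems: almost minimal elements of the
  decreasing midpoint-convex tails form a Cauchy sequence by the parallelogram law.\<close>

lemma tail_hull_converges:
  fixes F :: "nat \<Rightarrow> 'a::euclidean_space \<Rightarrow> 'b::euclidean_space"
  assumes F: "\<And>n. F n \<in> L2 A" and B: "\<And>n. L2_norm A (F n) \<le> B"
  obtains y G where "\<And>m. y m \<in> tail_hull F m" "\<And>m. y m \<in> L2 A" "G \<in> L2 A"
    "(\<lambda>m. L2_norm A (\<lambda>x. y m x - G x)) \<longlonglongrightarrow> 0"
proof -
  define S where "S m = (\<lambda>f. (L2_norm A f)\<^sup>2) ` tail_hull F m" for m
  \<comment> \<open>The tails shrink, so these infima increase, and they are bounded by the square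
    of \<open>B\<close>; their convergence is what makes the distances below small.\<close>
  define d where "d m = Inf (S m)" for m
  have bdd: "bdd_below (S m)" for m by (rule bdd_belowI[of _ 0]) (auto simp: S_def)
  have ne: "S m \<noteq> {}" for m using tail_hull.base[of m m F] by (auto simp: S_def)
  have d_le: "d m \<le> (L2_norm A f)\<^sup>2" if "f \<in> tail_hull F m" for f m
    unfolding d_def using that bdd by (intro cInf_lower) (auto simp: S_def)
  have inc: "incseq d"
    unfolding d_def incseq_def
    by (intro allI impI cInf_superset_mono ne bdd)
      (use tail_hull_antimono in \<open>auto simp: S_def intro!: image_mono\<close>)
  have "d m \<le> B\<^sup>2" for m
    using d_le[OF tail_hull.base[of m m F]] B[of m] power_mono[of "L2_norm A (F m)" B 2] by simp
  then obtain L where "d \<longlonglongrightarrow> L" using incseq_convergent[OF inc] by blast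
  then have "Cauchy d" by (rule LIMSEQ_imp_Cauchy)
  have "\<exists>f\<in>tail_hull F m. (L2_norm A f)\<^sup>2 < d m + inverse (real (Suc m))" for m
    using cInf_lessD[OF ne, of m "d m + inverse (real (Suc m))"] unfolding d_def S_def by auto
  then obtain y where y: "\<And>m. y m \<in> tail_hull F m"
      "\<And>m. (L2_norm A (y m))\<^sup>2 < d m + inverse (real (Suc m))" by metis
  have yL: "y m \<in> L2 A" for m using tail_hull_L2[OF y(1) F] .
  \<comment> \<open>Both functions lie in the tail from m, hence so does their midpoint, whose
    squared norm is then at least \<open>d m\<close>. Each of the two is within the reciprocal of
    its index of its own infimum.\<close>
  have est: "(L2_norm A (\<lambda>x. y m x - y l x))\<^sup>2 \<le>
      2 * (d l - d m) + 2 * inverse (real (Suc m)) + 2 * inverse (real (Suc l))" if "m \<le> l" for m l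
  proof -
    have "y l \<in> tail_hull F m" using tail_hull_antimono[OF that] y(1) by blast
    from d_le[OF tail_hull.mid[OF y(1) this]]
    have "d m \<le> (L2_norm A (\<lambda>x. (1/2) *\<^sub>R (y m x + y l x)))\<^sup>2" .
    with L2_parallelogram[OF yL[of m] yL[of l]] y(2)[of m] y(2)[of l] show ?thesis by argo
  qed
  have "\<exists>N. \<forall>m\<ge>N. \<forall>n\<ge>N. L2_norm A (\<lambda>x. y m x - y n x) < e" if "0 < e" for e
  proof -
    \<comment> \<open>Three terms of the estimate, each below twice this number, add up to at most
      three quarters of the square of e.\<close>
    have e: "0 < e\<^sup>2 / 8" using that by simp
    obtain N1 where N1: "\<And>m n. m \<ge> N1 \<Longrightarrow> n \<ge> N1 \<Longrightarrow> \<bar>d m - d n\<bar> < e\<^sup>2 / 8"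
      using CauchyD[OF \<open>Cauchy d\<close> e] by auto
    obtain N2 where N2: "inverse (real (Suc N2)) < e\<^sup>2 / 8" using reals_Archimedean[OF e] by auto
    have inv: "inverse (real (Suc m)) < e\<^sup>2 / 8" if "m \<ge> N2" for m
      using that N2 by (intro le_less_trans[OF _ N2]) (simp add: field_simps)
    have *: "L2_norm A (\<lambda>x. y m x - y n x) < e" if "m \<ge> max N1 N2" "m \<le> n" for m n
    proof -
      have c: "N1 \<le> m" "N1 \<le> n" "N2 \<le> m" "N2 \<le> n" using that by auto
      have "(L2_norm A (\<lambda>x. y m x - y n x))\<^sup>2 < e\<^sup>2"
        using est[OF that(2)] N1[OF c(2,1)] abs_ge_self[of "d n - d m"] inv[OF c(3)] inv[OF c(4)]
          zero_less_power[OF \<open>0 < e\<close>, of 2] by argo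
      then show ?thesis using \<open>0 < e\<close> by (simp add: power2_less_imp_less)
    qed
    then have "L2_norm A (\<lambda>x. y m x - y n x) < e" if "m \<ge> max N1 N2" "n \<ge> max N1 N2" for m n
      using that *[of m n] *[of n m] L2_norm_minus_commute[of A "y m" "y n"] by (cases "m \<le> n") auto
    then show ?thesis by blast
  qed
  from L2_complete[OF yL this] that[OF y(1) yL] show ?thesis by blast
qed

subsection \<open>Weak gradients\<close>

lemma L2_indicator:
  assumes "f \<in> L2 A" "A \<in> sets lebesgue"
  shows "(\<lambda>x. indicator A x *\<^sub>R f x) \<in> borel_measurable lebesgue"
    "integrable lebesgue (\<lambda>x. (norm (indicator A x *\<^sub>R f x))\<^sup>2)"
proof -
  show "(\<lambda>x. indicator A x *\<^sub>R f x) \<in> borel_measurable lebesgue"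
    using assms by (subst borel_measurable_restrict_space_iff[symmetric]) (auto simp: L2_def)
  have "integrable lebesgue (\<lambda>x. indicator A x *\<^sub>R (norm (f x))\<^sup>2)"
    using assms by (subst integrable_restrict_space[symmetric]) (auto simp: L2_def)
  moreover have "(\<lambda>x. indicator A x *\<^sub>R (norm (f x))\<^sup>2) = (\<lambda>x. (norm (indicator A x *\<^sub>R f x))\<^sup>2)"
    by (auto simp: fun_eq_iff indicator_def)
  ultimately show "integrable lebesgue (\<lambda>x. (norm (indicator A x *\<^sub>R f x))\<^sup>2)" by simp
qed

text \<open>The test functions \<^const>\<open>box_approx\<close> increase to indicators of boxes, so the integral of \<open>f\<close>
  over every box vanishes, and \<open>f\<close> is a.e. the limit of its averages over shrinking cubes.\<close>

lemma fundamental_lemma_L2: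
  fixes f :: "'a::euclidean_space \<Rightarrow> real"
  assumes A: "open A" and f: "f \<in> L2 A"
    and 0: "\<And>\<phi>. test_function A \<phi> \<Longrightarrow> (\<integral>x. f x * \<phi> x \<partial>lebesgue_on A) = 0"
  shows "AE x in lebesgue_on A. f x = 0"
proof -
  have As: "A \<in> sets lebesgue" using A by simp
  define F where "F x = indicator A x * f x" for x
  have Fm [measurable]: "F \<in> borel_measurable lebesgue" and F2: "integrable lebesgue (\<lambda>x. (F x)\<^sup>2)"
    using L2_indicator[OF f As] by (auto simp: F_def[abs_def])
  have Fb: "set_integrable lebesgue S F" if S: "S \<in> lmeasurable" for S
    unfolding set_integrable_def
  proof (rule Bochner_Integration.integrable_bound)
    show "integrable lebesgue (\<lambda>x. indicator S x + (F x)\<^sup>2)"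
      using S F2 by (intro Bochner_Integration.integrable_add) (auto simp: fmeasurable_def)
    show "AE x in lebesgue. norm (indicator S x *\<^sub>R F x) \<le> norm (indicator S x + (F x)\<^sup>2)"
    proof (rule AE_I2)
      fix x
      show "norm (indicator S x *\<^sub>R F x) \<le> norm (indicator S x + (F x)\<^sup>2)"
        using abs_le_one_plus_sq[of "F x"] by (auto simp: indicator_def)
    qed
  qed (use S in \<open>auto simp: fmeasurable_def\<close>)
  have box0: "integral (cbox a b) F = 0" if ab: "cbox a b \<subseteq> A" for a b
  proof -
    have "(\<lambda>n. \<integral>x. F x * box_approx n a b x \<partial>lebesgue) \<longlonglongrightarrow> (\<integral>x. F x * indicator (box a b) x \<partial>lebesgue)"
    proof (rule integral_dominated_convergence[where w = "\<lambda>x. \<bar>indicator (cbox a b) x *\<^sub>R F x\<bar>"])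
      show "integrable lebesgue (\<lambda>x. \<bar>indicator (cbox a b) x *\<^sub>R F x\<bar>)"
        using Fb[of "cbox a b"] by (intro integrable_abs) (simp add: set_integrable_def)
      show "AE x in lebesgue. (\<lambda>n. F x * box_approx n a b x) \<longlonglongrightarrow> F x * indicator (box a b) x"
        by (intro AE_I2 tendsto_mult tendsto_const box_approx_tendsto)
      fix n
      have z: "box_approx n a b x = 0" if "x \<notin> cbox a b" for x
        using test_function_box_approx[of a b "cbox a b" n] that by (auto simp: test_function_def)
      show "AE x in lebesgue. norm (F x * box_approx n a b x) \<le> \<bar>indicator (cbox a b) x *\<^sub>R F x\<bar>"
      proof (rule AE_I2)
        fix x show "norm (F x * box_approx n a b x) \<le> \<bar>indicator (cbox a b) x *\<^sub>R F x\<bar>"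
          using z[of x] box_approx_bounds[of n a b x]
          by (cases "x \<in> cbox a b") (auto simp: abs_mult mult_left_le)
      qed
      show "(\<lambda>x. F x * box_approx n a b x) \<in> borel_measurable lebesgue"
        using test_function_borel[OF test_function_box_approx[of a b UNIV n]]
        by (intro borel_measurable_times Fm) (auto simp: measurable_completion)
    qed (auto intro!: borel_measurable_times borel_measurable_indicator)
    moreover have "(\<integral>x. F x * box_approx n a b x \<partial>lebesgue) = 0" for n
    proof -
      have "(\<integral>x. F x * box_approx n a b x \<partial>lebesgue) = (\<integral>x. f x * box_approx n a b x \<partial>lebesgue_on A)"
        using As by (subst integral_restrict_space) (auto simp: F_def mult.assoc)
      then show ?thesis using 0[OF test_function_box_approx[OF ab]] by simp
    qed
    ultimately have "(\<integral>x. F x * indicator (box a b) x \<partial>lebesgue) = 0"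
      by (simp add: LIMSEQ_const_iff)
    then have "integral (box a b) F = 0"
      using set_lebesgue_integral_eq_integral(2)[OF Fb[of "box a b"]]
      by (simp add: set_lebesgue_integral_def mult.commute)
    then show ?thesis by (simp add: integral_open_interval)
  qed
  have "F integrable_on cbox a b" for a b
    using set_lebesgue_integral_eq_integral(1)[OF Fb[of "cbox a b"]] by simp
  \<comment> \<open>The Lebesgue differentiation theorem for cubes that have x as a corner.\<close>
  from integrable_ccontinuous_explicit[OF this]
  obtain N where N: "negligible N" "\<And>x e. \<lbrakk>x \<notin> N; 0 < e\<rbrakk> \<Longrightarrow>
      \<exists>d>0. \<forall>h. 0 < h \<and> h < d \<longrightarrow> norm (integral (cbox x (x + h *\<^sub>R One)) F /\<^sub>R h ^ DIM('a) - F x) < e"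
    by metis
  have F0: "F x = 0" if x: "x \<in> A" "x \<notin> N" for x
  proof (rule ccontr)
    assume "F x \<noteq> 0"
    then obtain d where d: "d > 0" "\<And>h. 0 < h \<Longrightarrow> h < d \<Longrightarrow>
        norm (integral (cbox x (x + h *\<^sub>R One)) F /\<^sub>R h ^ DIM('a) - F x) < \<bar>F x\<bar>"
      using N(2)[OF x(2), of "\<bar>F x\<bar>"] by auto
    obtain \<delta> where \<delta>: "0 < \<delta>" "ball x \<delta> \<subseteq> A" using A x(1) openE by blast
    \<comment> \<open>Below d for the differentiation theorem; and, since the l1 norm of y - x is at
      most h times the dimension, small enough for the cube to stay in the ball of radius
      \<delta>.\<close>
    define h where "h = min (d / 2) (\<delta> / (2 * DIM('a)))"
    have h: "0 < h" "h < d" "h * DIM('a) < \<delta>"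
      using d(1) \<delta>(1) by (auto simp: h_def min_def field_simps)
    have "cbox x (x + h *\<^sub>R One) \<subseteq> A"
    proof
      fix y assume y: "y \<in> cbox x (x + h *\<^sub>R One)"
      have "norm (y - x) \<le> (\<Sum>i\<in>Basis. \<bar>(y - x) \<bullet> i\<bar>)" by (rule norm_le_l1)
      also have "\<dots> \<le> (\<Sum>i\<in>(Basis::'a set). h)"
        using y by (intro sum_mono) (auto simp: mem_box inner_diff_left inner_add_left)
      also have "\<dots> < \<delta>" using h by (simp add: mult.commute)
      finally show "y \<in> A" using \<delta>(2) by (auto simp: dist_norm norm_minus_commute)
    qed
    from box0[OF this] d(2)[OF h(1,2)] show False by simp
  qed
  have "AE x in lebesgue. x \<in> A \<longrightarrow> f x = 0"
  proof (rule AE_I')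
    show "N \<in> null_sets lebesgue" using N(1) by (simp add: negligible_iff_null_sets)
    show "{x \<in> space lebesgue. \<not> (x \<in> A \<longrightarrow> f x = 0)} \<subseteq> N" using F0 by (auto simp: F_def)
  qed
  then show ?thesis using As by (subst AE_restrict_space_iff) auto
qed

lemma test_function_L2:
  fixes \<phi> :: "'a::euclidean_space \<Rightarrow> real"
  assumes \<phi>: "test_function B \<phi>" and A: "open A"
  shows "\<phi> \<in> L2 A"
proof -
  have m: "\<phi> \<in> borel_measurable lebesgue"
    using test_function_borel[OF \<phi>] by (simp add: measurable_completion)
  have "integrable lborel (\<lambda>x. \<phi> x * \<phi> x)"
    using \<phi> by (intro test_function_integrable test_function_mult)
      (auto intro: test_function_smooth test_function_UNIV)
  then have "integrable lebesgue (\<lambda>x. (norm (\<phi> x))\<^sup>2)"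
    using \<phi> by (subst integrable_completion) (auto simp: power2_eq_square test_function_borel)
  then have "integrable lebesgue (\<lambda>x. indicator A x *\<^sub>R (norm (\<phi> x))\<^sup>2)"
    using A by (intro integrable_mult_indicator) auto
  then show ?thesis using A m
    by (auto simp: L2_def integrable_restrict_space intro: measurable_restrict_space1)
qed

text \<open>Each component of the difference integrates to zero against every test function, and
  finitely many null sets are collected over the basis.\<close>

lemma weak_gradient_unique:
  fixes f :: "'a::euclidean_space \<Rightarrow> real"
  assumes A: "open A" and G: "G \<in> L2 A" "is_weak_gradient A f G"
    and H: "H \<in> L2 A" "is_weak_gradient A f H"
  shows "AE x in lebesgue_on A. G x = H x"
proof -
  have "AE x in lebesgue_on A. (G x - H x) \<bullet> i = 0" if i: "i \<in> Basis" for i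
  proof (rule fundamental_lemma_L2[OF A])
    show "(\<lambda>x. (G x - H x) \<bullet> i) \<in> L2 A" by (intro L2_inner_left L2_diff G H)
    fix \<phi> assume \<phi>: "test_function A \<phi>"
    have "(\<integral>x. (G x \<bullet> i) * \<phi> x \<partial>lebesgue_on A) = (\<integral>x. (H x \<bullet> i) * \<phi> x \<partial>lebesgue_on A)"
      using G(2) H(2) \<phi> i by (simp add: is_weak_gradient_def)
    moreover have "integrable (lebesgue_on A) (\<lambda>x. (K x \<bullet> i) * \<phi> x)" if "K \<in> L2 A" for K
      using L2_inner_integrable[OF L2_inner_left[OF that, of i] test_function_L2[OF \<phi> A]] by simp
    ultimately show "(\<integral>x. ((G x - H x) \<bullet> i) * \<phi> x \<partial>lebesgue_on A) = 0"
      using G H by (simp add: inner_diff_left left_diff_distrib)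
  qed
  then have "AE x in lebesgue_on A. \<forall>i\<in>Basis. (G x - H x) \<bullet> i = 0"
    by (intro AE_finite_allI) auto
  then show ?thesis by eventually_elim (auto intro: euclidean_eqI simp: inner_diff_left)
qed

section \<open>Pairs of a function and its weak gradient\<close>

lemma L2_Pair: "f \<in> L2 A \<Longrightarrow> g \<in> L2 A \<Longrightarrow> (\<lambda>x. (f x, g x)) \<in> L2 A"
  by (auto simp: L2_def norm_Pair)

lemma L2_norm_Pair:
  "f \<in> L2 A \<Longrightarrow> g \<in> L2 A \<Longrightarrow> L2_norm A (\<lambda>x. (f x, g x)) = sqrt ((L2_norm A f)\<^sup>2 + (L2_norm A g)\<^sup>2)"
  unfolding L2_norm_sq by (auto simp: L2_norm_def norm_Pair L2_def)

lemma norm_fst_le': "norm (fst p) \<le> norm p"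
  by (metis norm_fst_le prod.collapse)

lemma L2_fst: "f \<in> L2 A \<Longrightarrow> (\<lambda>x. fst (f x)) \<in> L2 A"
proof (rule L2_bound[where g = "\<lambda>x. (norm (f x))\<^sup>2"])
  assume "f \<in> L2 A"
  then show "(\<lambda>x. fst (f x)) \<in> borel_measurable (lebesgue_on A)"
    by (intro measurable_compose[OF L2_D(1) borel_measurable_continuous_onI] continuous_intros)
qed (auto simp: L2_def norm_fst_le' intro!: power_mono simp del: real_norm_def)

lemma norm_snd_le': "norm (snd p) \<le> norm p"
  by (metis norm_snd_le prod.collapse)

lemma L2_snd: "f \<in> L2 A \<Longrightarrow> (\<lambda>x. snd (f x)) \<in> L2 A"
proof (rule L2_bound[where g = "\<lambda>x. (norm (f x))\<^sup>2"])
  assume "f \<in> L2 A"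
  then show "(\<lambda>x. snd (f x)) \<in> borel_measurable (lebesgue_on A)"
    by (intro measurable_compose[OF L2_D(1) borel_measurable_continuous_onI] continuous_intros)
qed (auto simp: L2_def norm_snd_le' intro!: power_mono simp del: real_norm_def)

lemma H1_I: "f \<in> L2 A \<Longrightarrow> G \<in> L2 A \<Longrightarrow> is_weak_gradient A f G \<Longrightarrow> f \<in> H1 A"
  by (auto simp: H1_def)

text \<open>Frees the norm from the choice made in \<open>weak_gradient\<close>: any square
  integrable weak gradient gives the same value. The pair (f, G), with values in the product space,
  can then be treated as one L^2 function.\<close>

lemma H1_norm_eq:
  assumes A: "open A" and f: "f \<in> L2 A" and G: "G \<in> L2 A" "is_weak_gradient A f G"
  shows "H1_norm A f = L2_norm A (\<lambda>x. (f x, G x))"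
proof -
  have W: "weak_gradient A f \<in> L2 A \<and> is_weak_gradient A f (weak_gradient A f)"
    unfolding weak_gradient_def by (rule someI[of _ G]) (use G in auto)
  then have "L2_norm A (weak_gradient A f) = L2_norm A G"
    by (intro L2_norm_cong_AE weak_gradient_unique[OF A _ _ G]) (use G in \<open>auto simp: L2_def\<close>)
  then show ?thesis using L2_norm_Pair[OF f G(1)] by (simp add: H1_norm_def)
qed

lemma is_weak_gradient_lincomb:
  assumes A: "open A" and f: "f \<in> L2 A" "F \<in> L2 A" "is_weak_gradient A f F"
    and g: "g \<in> L2 A" "G \<in> L2 A" "is_weak_gradient A g G"
  shows "is_weak_gradient A (\<lambda>x. a * f x + b * g x) (\<lambda>x. a *\<^sub>R F x + b *\<^sub>R G x)"
  unfolding is_weak_gradient_def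
proof (intro allI impI ballI)
  fix \<phi> i assume \<phi>: "test_function A \<phi>" and i: "i \<in> (Basis :: 'a set)"
  have 1: "integrable (lebesgue_on A) (\<lambda>x. h x * pd \<phi> i x)" if "h \<in> L2 A" for h
    using L2_inner_integrable[OF that test_function_L2[OF test_function_pd[OF \<phi> i] A]] by simp
  have 2: "integrable (lebesgue_on A) (\<lambda>x. (K x \<bullet> i) * \<phi> x)" if "K \<in> L2 A" for K
    using L2_inner_integrable[OF L2_inner_left[OF that, of i] test_function_L2[OF \<phi> A]] by simp
  have "(\<integral>x. (a * f x + b * g x) * pd \<phi> i x \<partial>lebesgue_on A) =
      a * (\<integral>x. f x * pd \<phi> i x \<partial>lebesgue_on A) + b * (\<integral>x. g x * pd \<phi> i x \<partial>lebesgue_on A)"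
    using 1[OF f(1)] 1[OF g(1)] by (simp add: distrib_right mult.assoc)
  also have "\<dots> = - (a * (\<integral>x. (F x \<bullet> i) * \<phi> x \<partial>lebesgue_on A) + b * (\<integral>x. (G x \<bullet> i) * \<phi> x \<partial>lebesgue_on A))"
    using f(3) g(3) \<phi> i by (simp add: is_weak_gradient_def)
  also have "\<dots> = - (\<integral>x. ((a *\<^sub>R F x + b *\<^sub>R G x) \<bullet> i) * \<phi> x \<partial>lebesgue_on A)"
    using 2[OF f(2)] 2[OF g(2)] by (simp add: distrib_right mult.assoc inner_add_left)
  finally show "(\<integral>x. (a * f x + b * g x) * pd \<phi> i x \<partial>lebesgue_on A) =
      - (\<integral>x. ((a *\<^sub>R F x + b *\<^sub>R G x) \<bullet> i) * \<phi> x \<partial>lebesgue_on A)" .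
qed

lemma L2_inner_tendsto:
  assumes "\<And>n. f n \<in> L2 A" "g \<in> L2 A" "h \<in> L2 A" "(\<lambda>n. L2_norm A (\<lambda>x. f n x - g x)) \<longlonglongrightarrow> 0"
  shows "(\<lambda>n. \<integral>x. f n x \<bullet> h x \<partial>lebesgue_on A) \<longlonglongrightarrow> (\<integral>x. g x \<bullet> h x \<partial>lebesgue_on A)"
proof -
  have "(\<lambda>n. (\<integral>x. f n x \<bullet> h x \<partial>lebesgue_on A) - (\<integral>x. g x \<bullet> h x \<partial>lebesgue_on A)) \<longlonglongrightarrow> 0"
  proof (rule Lim_null_comparison)
    show "\<forall>\<^sub>F n in sequentially. norm ((\<integral>x. f n x \<bullet> h x \<partial>lebesgue_on A) - (\<integral>x. g x \<bullet> h x \<partial>lebesgue_on A))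
        \<le> L2_norm A (\<lambda>x. f n x - g x) * L2_norm A h"
    proof (intro always_eventually allI)
      fix n
      have "(\<integral>x. f n x \<bullet> h x \<partial>lebesgue_on A) - (\<integral>x. g x \<bullet> h x \<partial>lebesgue_on A) =
          (\<integral>x. (f n x - g x) \<bullet> h x \<partial>lebesgue_on A)"
        using assms by (simp add: inner_diff_left L2_inner_integrable)
      then show "norm ((\<integral>x. f n x \<bullet> h x \<partial>lebesgue_on A) - (\<integral>x. g x \<bullet> h x \<partial>lebesgue_on A))
        \<le> L2_norm A (\<lambda>x. f n x - g x) * L2_norm A h"
        using L2_inner_bound[OF L2_diff[OF assms(1,2)] assms(3)] by simp
    qed
    show "(\<lambda>n. L2_norm A (\<lambda>x. f n x - g x) * L2_norm A h) \<longlonglongrightarrow> 0"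
      using tendsto_mult_left_zero[OF assms(4)] by simp
  qed
  then show ?thesis by (simp add: LIM_zero_iff)
qed

lemma is_weak_gradient_cong_AE:
  assumes A: "open A" and "f \<in> L2 A" "g \<in> L2 A" "AE x in lebesgue_on A. f x = g x"
    and "is_weak_gradient A f G"
  shows "is_weak_gradient A g G"
proof -
  have "(\<integral>x. f x * pd \<phi> i x \<partial>lebesgue_on A) = (\<integral>x. g x * pd \<phi> i x \<partial>lebesgue_on A)"
    if "test_function A \<phi>" "i \<in> Basis" for \<phi> i
  proof (rule integral_cong_AE)
    have "pd \<phi> i \<in> L2 A" by (rule test_function_L2[OF test_function_pd[OF that] A])
    then show "(\<lambda>x. f x * pd \<phi> i x) \<in> borel_measurable (lebesgue_on A)"
      "(\<lambda>x. g x * pd \<phi> i x) \<in> borel_measurable (lebesgue_on A)"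
      using assms(2,3) by (auto simp: L2_def intro!: borel_measurable_times)
    show "AE x in lebesgue_on A. f x * pd \<phi> i x = g x * pd \<phi> i x"
      using assms(4) by eventually_elim simp
  qed
  then show ?thesis using assms(5) by (simp add: is_weak_gradient_def)
qed

text \<open>The graph of the weak gradient is closed: its defining relation equates two inner
  products, against (pd \<phi> i, 0) and, up to sign, (0, \<phi> i), and both are continuous in
  L^2.\<close>

lemma is_weak_gradient_limit:
  fixes y :: "nat \<Rightarrow> 'a::euclidean_space \<Rightarrow> real \<times> 'a"
  assumes A: "open A" and y: "\<And>m. y m \<in> L2 A"
    "\<And>m. is_weak_gradient A (\<lambda>x. fst (y m x)) (\<lambda>x. snd (y m x))"
    and G: "G \<in> L2 A" and lim: "(\<lambda>m. L2_norm A (\<lambda>x. y m x - G x)) \<longlonglongrightarrow> 0"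
  shows "is_weak_gradient A (\<lambda>x. fst (G x)) (\<lambda>x. snd (G x))"
  unfolding is_weak_gradient_def
proof (intro allI impI ballI)
  fix \<phi> i assume \<phi>: "test_function A \<phi>" and i: "i \<in> (Basis :: 'a set)"
  have L: "\<phi> \<in> L2 A" "pd \<phi> i \<in> L2 A"
    using test_function_L2[OF \<phi> A] test_function_L2[OF test_function_pd[OF \<phi> i] A] by auto
  have 1: "(\<lambda>m. \<integral>x. y m x \<bullet> (pd \<phi> i x, 0) \<partial>lebesgue_on A) \<longlonglongrightarrow> (\<integral>x. G x \<bullet> (pd \<phi> i x, 0) \<partial>lebesgue_on A)"
    by (intro L2_inner_tendsto[OF y(1) G _ lim] L2_Pair L L2_zero)
  have "(\<lambda>x. \<phi> x *\<^sub>R i) \<in> L2 A"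
    using L(1) i by (auto simp: L2_def power_mult_distrib)
  then have 2: "(\<lambda>m. \<integral>x. y m x \<bullet> (0, \<phi> x *\<^sub>R i) \<partial>lebesgue_on A) \<longlonglongrightarrow> (\<integral>x. G x \<bullet> (0, \<phi> x *\<^sub>R i) \<partial>lebesgue_on A)"
    by (intro L2_inner_tendsto[OF y(1) G _ lim] L2_Pair L L2_zero)
  have "(\<integral>x. y m x \<bullet> (pd \<phi> i x, 0) \<partial>lebesgue_on A) = - (\<integral>x. y m x \<bullet> (0, \<phi> x *\<^sub>R i) \<partial>lebesgue_on A)" for m
    using y(2) \<phi> i by (simp add: is_weak_gradient_def inner_prod_def mult.commute)
  with 1 have "(\<lambda>m. - (\<integral>x. y m x \<bullet> (0, \<phi> x *\<^sub>R i) \<partial>lebesgue_on A)) \<longlonglongrightarrow>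
      (\<integral>x. G x \<bullet> (pd \<phi> i x, 0) \<partial>lebesgue_on A)" by simp
  from LIMSEQ_unique[OF this tendsto_minus[OF 2]]
  show "(\<integral>x. fst (G x) * pd \<phi> i x \<partial>lebesgue_on A) = - (\<integral>x. (snd (G x) \<bullet> i) * \<phi> x \<partial>lebesgue_on A)"
    by (simp add: inner_prod_def mult.commute)
qed

text \<open>The relation between a function and its weak gradient is linear, so midpoints preserve
  it. It is demanded from index \<open>m\<close> on only, because later the gradients are genuine on
  a given set only for large indices.\<close>

lemma tail_hull_weak_gradient:
  fixes F :: "nat \<Rightarrow> 'a::euclidean_space \<Rightarrow> real \<times> 'a"
  assumes A: "open A" and F: "\<And>n. F n \<in> L2 A"
    "\<And>n. n \<ge> m \<Longrightarrow> is_weak_gradient A (\<lambda>x. fst (F n x)) (\<lambda>x. snd (F n x))"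
    and y: "y \<in> tail_hull F m"
  shows "is_weak_gradient A (\<lambda>x. fst (y x)) (\<lambda>x. snd (y x))"
  using y
proof (induction rule: tail_hull.induct)
  case (mid f g)
  then have "f \<in> L2 A" "g \<in> L2 A" using tail_hull_L2[OF _ F(1)] by auto
  from is_weak_gradient_lincomb[OF A L2_fst[OF this(1)] L2_snd[OF this(1)] mid.IH(1)
      L2_fst[OF this(2)] L2_snd[OF this(2)] mid.IH(2), of "1/2" "1/2"]
  show ?case by (simp add: scaleR_right_distrib)
qed (use F in auto)

text \<open>Norm balls are convex. The smaller set \<open>B\<close> allows a nearness that holds
  locally while the sequence is bounded on all of \<open>A\<close>.\<close>

lemma tail_hull_fst_near:
  fixes F :: "nat \<Rightarrow> 'a::euclidean_space \<Rightarrow> real \<times> 'a"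
  assumes y: "y \<in> tail_hull F m" and F: "\<And>n. F n \<in> L2 A" and v: "v \<in> L2 B"
    and B: "B \<subseteq> A" "A \<in> sets lebesgue" "B \<in> sets lebesgue"
    and e: "\<And>n. n \<ge> m \<Longrightarrow> L2_norm B (\<lambda>x. fst (F n x) - v x) \<le> e"
  shows "L2_norm B (\<lambda>x. fst (y x) - v x) \<le> e"
  using y
proof (induction rule: tail_hull.induct)
  case (mid f g)
  have "f \<in> L2 B" "g \<in> L2 B"
    using L2_subset(1)[OF tail_hull_L2[OF mid.hyps(1) F] B]
      L2_subset(1)[OF tail_hull_L2[OF mid.hyps(2) F] B] by simp_all
  then have "(\<lambda>x. fst (f x) - v x) \<in> L2 B" "(\<lambda>x. fst (g x) - v x) \<in> L2 B"
    using v by (auto intro: L2_diff L2_fst)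
  note t = L2_norm_triangle[OF this]
  have "(\<lambda>x. fst ((1/2) *\<^sub>R (f x + g x)) - v x) =
      (\<lambda>x. (1/2) *\<^sub>R ((fst (f x) - v x) + (fst (g x) - v x)))"
    by (auto simp: fun_eq_iff field_simps)
  then have "L2_norm B (\<lambda>x. fst ((1/2) *\<^sub>R (f x + g x)) - v x) =
     1/2 * L2_norm B (\<lambda>x. (fst (f x) - v x) + (fst (g x) - v x))"
    by (simp only: L2_norm_scaleR abs_of_nonneg)
  then show ?case using t mid.IH by linarith
qed (use e in auto)

text \<open>The hull elements of the pairs converge to some \<open>H\<close>. Their first components
  stay as close to \<open>v\<close> as the tail does, so \<open>H\<close> has first component
  \<open>v\<close> almost everywhere, and its second component is the weak gradient of
  \<open>v\<close>.\<close>

lemma H1_bounded_tail_hull_converges: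
  fixes f :: "nat \<Rightarrow> 'a::euclidean_space \<Rightarrow> real" and g :: "nat \<Rightarrow> 'a \<Rightarrow> 'a"
  assumes A: "open A" and f: "\<And>n. f n \<in> L2 A" "\<And>n. g n \<in> L2 A" "\<And>n. is_weak_gradient A (f n) (g n)"
    and B: "\<And>n. L2_norm A (\<lambda>x. (f n x, g n x)) \<le> B"
    and v: "v \<in> L2 A" "(\<lambda>n. L2_norm A (\<lambda>x. f n x - v x)) \<longlonglongrightarrow> 0"
  obtains y G where "\<And>m. y m \<in> tail_hull (\<lambda>n x. (f n x, g n x)) m" "G \<in> L2 A" "is_weak_gradient A v G"
    "(\<lambda>m. L2_norm A (\<lambda>x. y m x - (v x, G x))) \<longlonglongrightarrow> 0"
proof -
  have As: "A \<in> sets lebesgue" using A by simp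
  let ?F = "\<lambda>n x. (f n x, g n x)"
  have F: "?F n \<in> L2 A" for n by (intro L2_Pair f)
  obtain y H where y: "\<And>m. y m \<in> tail_hull ?F m" "\<And>m. y m \<in> L2 A" and H: "H \<in> L2 A"
    "(\<lambda>m. L2_norm A (\<lambda>x. y m x - H x)) \<longlonglongrightarrow> 0"
    by (rule tail_hull_converges[where F = ?F, OF F B]) (rule that; assumption)
  have w: "is_weak_gradient A (\<lambda>x. fst (H x)) (\<lambda>x. snd (H x))"
    using tail_hull_weak_gradient[OF A F _ y(1)] f(3)
    by (intro is_weak_gradient_limit[OF A y(2) _ H]) auto
  have "(\<lambda>m. L2_norm A (\<lambda>x. fst (y m x) - v x)) \<longlonglongrightarrow> 0"
  proof (rule LIMSEQ_I)
    fix e :: real assume "0 < e"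
    then obtain N where N: "\<And>n. n \<ge> N \<Longrightarrow> L2_norm A (\<lambda>x. f n x - v x) < e / 2"
      using LIMSEQ_D[OF v(2), of "e/2"] by auto
    have "L2_norm A (\<lambda>x. fst (y m x) - v x) \<le> e / 2" if "m \<ge> N" for m
      using that N by (intro tail_hull_fst_near[OF y(1) F v(1) subset_refl As As]) (auto intro: less_imp_le)
    then show "\<exists>no. \<forall>n\<ge>no. norm (L2_norm A (\<lambda>x. fst (y n x) - v x) - 0) < e"
      using \<open>0 < e\<close> by (intro exI[of _ N]) fastforce
  qed
  then have lim: "(\<lambda>m. L2_norm A (\<lambda>x. y m x - H x) + L2_norm A (\<lambda>x. fst (y m x) - v x)) \<longlonglongrightarrow> 0"
    using tendsto_add[OF H(2)] by fastforce
  have d: "(\<lambda>x. fst (H x) - v x) \<in> L2 A" by (intro L2_diff L2_fst H v)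
  have le: "L2_norm A (\<lambda>x. fst (H x) - v x) \<le>
      L2_norm A (\<lambda>x. y m x - H x) + L2_norm A (\<lambda>x. fst (y m x) - v x)" for m
  proof -
    have "L2_norm A (\<lambda>x. fst (H x) - fst (y m x)) \<le> L2_norm A (\<lambda>x. y m x - H x)"
      by (rule L2_norm_mono[OF L2_diff[OF y(2) H(1)] L2_diff[OF L2_fst[OF H(1)] L2_fst[OF y(2)]]])
        (metis fst_diff norm_fst_le' norm_minus_commute)
    then show ?thesis
      using L2_norm_diff_triangle[OF L2_fst[OF H(1)] L2_fst[OF y(2)[of m]] v(1)] by linarith
  qed
  have "L2_norm A (\<lambda>x. fst (H x) - v x) \<le> 0"
    by (rule LIMSEQ_le_const[OF lim]) (use le in blast)
  then have "L2_norm A (\<lambda>x. fst (H x) - v x) = 0" by (simp add: antisym)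
  from L2_norm_eq_0_AE[OF d this] have ae: "AE x in lebesgue_on A. fst (H x) = v x" by simp
  have sL: "(\<lambda>x. snd (H x)) \<in> L2 A" by (rule L2_snd[OF H(1)])
  have "L2_norm A (\<lambda>x. y m x - H x) = L2_norm A (\<lambda>x. y m x - (v x, snd (H x)))" for m
  proof (rule L2_norm_cong_AE)
    show "AE x in lebesgue_on A. y m x - H x = y m x - (v x, snd (H x))"
      using ae by eventually_elim (auto simp: prod_eq_iff)
  qed (use L2_D(1)[OF L2_diff[OF y(2) H(1)]] L2_D(1)[OF L2_diff[OF y(2) L2_Pair[OF v(1) sL]]] in auto)
  then have "(\<lambda>m. L2_norm A (\<lambda>x. y m x - (v x, snd (H x)))) \<longlonglongrightarrow> 0" using H(2) by simp
  with that[OF y(1) sL is_weak_gradient_cong_AE[OF A L2_fst[OF H(1)] v(1) ae w]] show ?thesis by blast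
qed

text \<open>If \<open>l (f n)\<close> stayed away from \<open>l v\<close> along a subsequence, it would stay away on the whole
  midpoint hull of the subsequence, which contains a sequence converging to \<open>v\<close> in norm.\<close>

lemma H1_weak_convI:
  fixes f :: "nat \<Rightarrow> 'a::euclidean_space \<Rightarrow> real" and g :: "nat \<Rightarrow> 'a \<Rightarrow> 'a"
  assumes A: "open A" and f: "\<And>n. f n \<in> L2 A" "\<And>n. g n \<in> L2 A" "\<And>n. is_weak_gradient A (f n) (g n)"
    and B: "\<And>n. L2_norm A (\<lambda>x. (f n x, g n x)) \<le> B"
    and v: "v \<in> L2 A" "(\<lambda>n. L2_norm A (\<lambda>x. f n x - v x)) \<longlonglongrightarrow> 0"
  shows "H1_weak_conv A f v"
proof -
  have "\<exists>G\<in>L2 A. is_weak_gradient A v G"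
    by (rule H1_bounded_tail_hull_converges[OF A f B v]) blast
  then have vH: "v \<in> H1 A" using v by (auto intro: H1_I)
  have fH: "f n \<in> H1 A" for n using f by (auto intro: H1_I)
  \<comment> \<open>The sign \<sigma> selects one side of \<open>l v\<close>. The resulting
    condition describes a half-space, which midpoints do not leave, whereas a lower bound on the
    absolute value would not be convex.\<close>
  have sub: False
    if l: "l \<in> H1_dual A" and s: "strict_mono (s :: nat \<Rightarrow> nat)" and e: "e > 0"
      and far: "\<And>n. \<sigma> * (l (f (s n)) - l v) \<ge> e" for l s e and \<sigma> :: real
  proof -
    obtain K where lin: "\<And>f g a b. f \<in> H1 A \<Longrightarrow> g \<in> H1 A \<Longrightarrow> l (\<lambda>x. a * f x + b * g x) = a * l f + b * l g"
      and K: "\<And>f. f \<in> H1 A \<Longrightarrow> \<bar>l f\<bar> \<le> K * H1_norm A f"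
      using l unfolding H1_dual_def by blast
    let ?F = "\<lambda>n x. (f (s n) x, g (s n) x)"
    have F: "?F n \<in> L2 A" for n by (intro L2_Pair f)
    have vs: "(\<lambda>n. L2_norm A (\<lambda>x. f (s n) x - v x)) \<longlonglongrightarrow> 0"
      using LIMSEQ_subseq_LIMSEQ[OF v(2) s] by (simp add: o_def)
    obtain y G where y: "\<And>m. y m \<in> tail_hull ?F m" and G: "G \<in> L2 A" "is_weak_gradient A v G"
      and lim: "(\<lambda>m. L2_norm A (\<lambda>x. y m x - (v x, G x))) \<longlonglongrightarrow> 0"
      by (rule H1_bounded_tail_hull_converges[where f = "\<lambda>n. f (s n)" and g = "\<lambda>n. g (s n)",
          OF A f B v(1) vs]) (rule that; assumption)
    have hull: "(\<lambda>x. fst (z x)) \<in> H1 A \<and> \<sigma> * (l (\<lambda>x. fst (z x)) - l v) \<ge> e"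
      if "z \<in> tail_hull ?F m" for z m
      using that
    proof (induction rule: tail_hull.induct)
      case (base n)
      then show ?case using fH far by simp
    next
      case (mid p q)
      have "(\<lambda>x. (1/2) *\<^sub>R (p x + q x)) \<in> tail_hull ?F m" using mid.hyps by (rule tail_hull.mid)
      note h = this
      have "(\<lambda>x. fst ((1/2) *\<^sub>R (p x + q x))) \<in> H1 A"
        using tail_hull_L2[OF h F] tail_hull_weak_gradient[OF A F _ h] f(3)
        by (intro H1_I[where G = "\<lambda>x. snd ((1/2) *\<^sub>R (p x + q x))"] L2_fst L2_snd) auto
      moreover have "l (\<lambda>x. fst ((1/2) *\<^sub>R (p x + q x))) = 1/2 * l (\<lambda>x. fst (p x)) + 1/2 * l (\<lambda>x. fst (q x))"
        using lin[of "\<lambda>x. fst (p x)" "\<lambda>x. fst (q x)" "1/2" "1/2"] mid.IH by (simp add: distrib_left)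
      ultimately show ?case using mid.IH by (simp add: algebra_simps)
    qed
    \<comment> \<open>The gap \<open>e\<close> persists on the hull, while boundedness of
      \<open>l\<close> limits it by a multiple of the H^1 distance to \<open>v\<close>, which tends
      to 0.\<close>
    have bd: "e \<le> \<bar>\<sigma>\<bar> * (K * L2_norm A (\<lambda>x. y m x - (v x, G x)))" for m
    proof -
      have yL: "y m \<in> L2 A" using tail_hull_L2[OF y F] .
      let ?z = "\<lambda>x. fst (y m x) - v x" and ?Z = "\<lambda>x. snd (y m x) - G x"
      have zw: "is_weak_gradient A ?z ?Z"
        using is_weak_gradient_lincomb[OF A L2_fst[OF yL] L2_snd[OF yL]
            tail_hull_weak_gradient[OF A F _ y] v(1) G, where a = 1 and b = "-1"] f(3) by simp
      have zL: "?z \<in> L2 A" "?Z \<in> L2 A" by (intro L2_diff L2_fst L2_snd yL v G)+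
      have n: "H1_norm A ?z = L2_norm A (\<lambda>x. y m x - (v x, G x))"
        by (subst H1_norm_eq[OF A zL zw]) (auto intro!: arg_cong[of _ _ "L2_norm A"] simp: prod_eq_iff)
      have "l ?z = l (\<lambda>x. fst (y m x)) - l v"
        using lin[of "\<lambda>x. fst (y m x)" v 1 "-1"] hull[OF y] vH by simp
      moreover have "\<bar>l ?z\<bar> \<le> K * H1_norm A ?z" using K H1_I[OF zL zw] by blast
      moreover have "e \<le> \<bar>\<sigma> * (l (\<lambda>x. fst (y m x)) - l v)\<bar>"
        using hull[OF y, of m] abs_ge_self order_trans by blast
      ultimately show ?thesis unfolding abs_mult n
        by (smt (verit) mult_left_mono abs_ge_zero)
    qed
    have "(\<lambda>m. \<bar>\<sigma>\<bar> * (K * L2_norm A (\<lambda>x. y m x - (v x, G x)))) \<longlonglongrightarrow> \<bar>\<sigma>\<bar> * (K * 0)"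
      by (intro tendsto_intros lim)
    from LIMSEQ_le_const[OF this, of e] bd e show False by auto
  qed
  have "(\<lambda>n. l (f n)) \<longlonglongrightarrow> l v" if l: "l \<in> H1_dual A" for l
  proof (rule ccontr)
    assume "\<not> (\<lambda>n. l (f n)) \<longlonglongrightarrow> l v"
    then obtain e where e: "e > 0" "\<And>N. \<exists>n\<ge>N. \<bar>l (f n) - l v\<bar> \<ge> e"
      unfolding LIMSEQ_iff by (auto simp: not_less)
    have "infinite {n. \<bar>l (f n) - l v\<bar> \<ge> e}"
      unfolding infinite_nat_iff_unbounded_le using e(2) by auto
    moreover have "{n. \<bar>l (f n) - l v\<bar> \<ge> e} \<subseteq>
        {n. 1 * (l (f n) - l v) \<ge> e} \<union> {n. -1 * (l (f n) - l v) \<ge> e}" by auto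
    \<comment> \<open>Infinitely many indices are far from the limit, so infinitely many are far on
      the same side; their enumeration is the subsequence.\<close>
    ultimately obtain \<sigma> :: real where "infinite {n. \<sigma> * (l (f n) - l v) \<ge> e}"
      by (metis finite_UnI finite_subset)
    from infinite_enumerate[OF this] sub[OF l _ e(1)] show False by blast
  qed
  then show ?thesis using fH vH by (auto simp: H1_weak_conv_def)
qed

subsection \<open>Mollification\<close>

text \<open>Completion does not change the nonnegative integral of any function. The identity
  therefore applies to the iterated integral of the hypothesis, whose inner integral comes from a
  function that is only Lebesgue measurable.\<close>

lemma nn_integral_lebesgue_on:
  assumes "A \<in> sets borel"
  shows "(\<integral>\<^sup>+x. f x \<partial>lebesgue_on A) = (\<integral>\<^sup>+x. f x * indicator A x \<partial>(lborel :: 'a::euclidean_space measure))"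
  using assms by (subst nn_integral_restrict_space) (auto simp: nn_integral_completion)

lemma lborel_integrable_affine:
  fixes f :: "'a::euclidean_space \<Rightarrow> real"
  assumes f: "integrable lborel f" and c: "0 < c"
  shows "integrable lborel (\<lambda>z. f (t + c *\<^sub>R z))"
proof -
  have [measurable]: "f \<in> borel_measurable borel" using f by auto
  have "integrable (density (distr lborel borel (\<lambda>x. t + c *\<^sub>R x)) (\<lambda>_. ennreal (c ^ DIM('a)))) f"
    using f lborel_affine[of c t] c by (simp add: ennreal_power)
  then have "integrable (distr lborel borel (\<lambda>x. t + c *\<^sub>R x)) (\<lambda>z. c ^ DIM('a) *\<^sub>R f z)"
    by (subst (asm) integrable_density) (use c in auto)
  then have "integrable lborel (\<lambda>z. c ^ DIM('a) *\<^sub>R f (t + c *\<^sub>R z))"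
    by (subst (asm) integrable_distr_eq) auto
  then show ?thesis using c by simp
qed

text \<open>Affine maps preserve null sets. This carries an almost everywhere identity in y over to
  almost all z when y = t + c z.\<close>

lemma lborel_AE_affine:
  fixes t :: "'a::euclidean_space"
  assumes "AE x in lborel. P x" and c: "0 < c"
  shows "AE z in lborel. P (t + c *\<^sub>R z)"
proof -
  obtain N where N': "{x \<in> space lborel. \<not> P x} \<subseteq> N" "emeasure lborel N = 0" "N \<in> sets lborel"
    using assms(1) by (rule AE_E)
  then have N: "N \<in> null_sets lborel" "\<And>x. \<not> P x \<Longrightarrow> x \<in> N" by (auto simp: null_sets_def)
  then have [measurable]: "N \<in> sets borel" by auto
  have "AE x in lborel. x \<notin> N" using N(1) by (rule AE_not_in)
  then have "AE x in density (distr lborel borel (\<lambda>x. t + c *\<^sub>R x)) (\<lambda>_. ennreal (c ^ DIM('a))). x \<notin> N"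
  proof -
    have "lborel = density (distr lborel borel (\<lambda>x. t + c *\<^sub>R x)) (\<lambda>_. ennreal (c ^ DIM('a)))"
      using lborel_affine[of c t] c by (simp add: ennreal_power)
    then show ?thesis using \<open>AE x in lborel. x \<notin> N\<close> by (simp only:)
  qed
  then have "AE x in distr lborel borel (\<lambda>x. t + c *\<^sub>R x). x \<notin> N"
    using c by (subst (asm) AE_density) auto
  then have "AE z in lborel. t + c *\<^sub>R z \<notin> N"
    by (subst (asm) AE_distr_iff) auto
  then show ?thesis by eventually_elim (use N(2) in blast)
qed

lemma locally_integrable_square_integrable:
  fixes u :: "'a::euclidean_space \<Rightarrow> real"
  assumes u: "u \<in> borel_measurable borel" "integrable lborel (\<lambda>x. (u x)\<^sup>2)"
  shows "locally_integrable u"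
  unfolding locally_integrable_def
proof (intro conjI allI u(1))
  fix R :: real
  show "integrable lborel (\<lambda>x. indicator (cball 0 R) x * u x)"
  proof (rule Bochner_Integration.integrable_bound)
    show "integrable lborel (\<lambda>x. indicator (cball 0 R) x + (u x)\<^sup>2)"
      by (intro Bochner_Integration.integrable_add u(2) integrable_real_indicator
          emeasure_lborel_cball_finite) auto
    show "AE x in lborel. norm (indicator (cball 0 R) x * u x) \<le> norm (indicator (cball 0 R) x + (u x)\<^sup>2)"
    proof (rule AE_I2)
      fix x
      show "norm (indicator (cball 0 R) x * u x) \<le> norm (indicator (cball 0 R) x + (u x)\<^sup>2)"
        using abs_le_one_plus_sq[of "u x"] by (auto simp: indicator_def)
    qed
    show "(\<lambda>x. indicator (cball 0 R) x * u x) \<in> borel_measurable lborel"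
      using u(1) by (auto intro!: borel_measurable_times borel_measurable_indicator)
  qed
qed

text \<open>A bump of half the radius has its compact support inside the open ball. Its integral is
  nonzero since it is positive on a nonempty open set, so it can be normalised.\<close>

lemma exists_mollifier:
  assumes "0 < r"
  obtains \<rho> :: "'a::euclidean_space \<Rightarrow> real" where "test_function (ball 0 r) \<rho>" "(\<integral>x. \<rho> x \<partial>lborel) = 1"
proof -
  let ?b = "bump (r / 2) :: 'a \<Rightarrow> real"
  have b: "test_function (ball 0 r) ?b"
    unfolding test_function_def
    by (intro conjI exI[of _ "cball 0 (r / 2)"]) (use assms in \<open>auto simp: smooth_bump bump_eq_0_iff\<close>)
  have int: "integrable lborel ?b" by (rule test_function_integrable[OF test_function_UNIV[OF b]])
  have nn: "0 \<le> ?b x" for x by (simp add: bump_def flat_one_bounds)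
  have "(\<integral>x. ?b x \<partial>lborel) \<noteq> 0"
  proof
    assume "(\<integral>x. ?b x \<partial>lborel) = 0"
    then have "AE x in lborel. ?b x = 0" using integral_nonneg_eq_0_iff_AE[OF int] nn by simp
    then have "AE x in lborel. x \<notin> ball (0::'a) (r / 2)"
      by eventually_elim (use assms in \<open>auto simp: bump_eq_0_iff\<close>)
    then have "ball (0::'a) (r / 2) \<in> null_sets lborel"
      by (simp add: AE_iff_null_sets)
    then have "negligible (ball (0::'a) (r / 2))"
      by (simp add: negligible_iff_null_sets null_sets_completionI)
    then show False using open_not_negligible[of "ball (0::'a) (r / 2)"] assms by simp
  qed
  then have "(\<integral>x. (1 / (\<integral>x. ?b x \<partial>lborel)) * ?b x \<partial>lborel) = 1" using int by simp
  with test_function_mult[OF b smooth_const] show ?thesis by (rule that)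
qed

lemma pd_scale:
  fixes f :: "'a::euclidean_space \<Rightarrow> real"
  assumes f: "smooth_on f UNIV"
  shows "((\<lambda>z. a * f (c *\<^sub>R z)) has_derivative (\<lambda>h. a * (c * frechet_derivative f (at (c *\<^sub>R z)) h))) (at z)"
    and "pd (\<lambda>z. a * f (c *\<^sub>R z)) i z = a * (c * pd f i (c *\<^sub>R z))"
proof -
  let ?D = "frechet_derivative f (at (c *\<^sub>R z))"
  have D: "(f has_derivative ?D) (at (c *\<^sub>R z))"
    using smooth_on_differentiable[OF f] by (simp add: frechet_derivative_works[symmetric])
  have "((\<lambda>z. f (c *\<^sub>R z)) has_derivative (\<lambda>h. ?D (c *\<^sub>R h))) (at z)"
    by (rule has_derivative_compose[where g = f and f = "\<lambda>z. c *\<^sub>R z", OF _ D])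
      (auto intro!: derivative_eq_intros)
  moreover have "?D (c *\<^sub>R h) = c * ?D h" for h
    using linear_scale[OF has_derivative_linear[OF D]] by simp
  ultimately show *: "((\<lambda>z. a * f (c *\<^sub>R z)) has_derivative (\<lambda>h. a * (c * ?D h))) (at z)"
    by (auto intro!: has_derivative_mult_right)
  show "pd (\<lambda>z. a * f (c *\<^sub>R z)) i z = a * (c * pd f i (c *\<^sub>R z))"
    using fun_cong[OF frechet_derivative_at[OF *], of i] by (rule sym)
qed

lemma smooth_scale:
  fixes f :: "'a::euclidean_space \<Rightarrow> real"
  assumes f: "smooth_on f UNIV"
  shows "smooth_on (\<lambda>z. a * f (c *\<^sub>R z)) UNIV"
proof (rule smooth_on_coinduct[of "{\<lambda>z. a * f (c *\<^sub>R z) | a f. smooth_on f UNIV}"])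
  fix h :: "'a \<Rightarrow> real" assume "h \<in> {\<lambda>z. a * f (c *\<^sub>R z) | a f. smooth_on f UNIV}"
  then obtain a f where h: "h = (\<lambda>z. a * f (c *\<^sub>R z))" and f: "smooth_on f UNIV" by blast
  have p: "pd h i = (\<lambda>z. (a * c) * pd f i (c *\<^sub>R z))" for i
    unfolding h pd_scale(2)[OF f] by (simp add: mult.assoc)
  show "(\<forall>x. h differentiable (at x)) \<and>
      (\<forall>i\<in>Basis. pd h i \<in> {\<lambda>z. a * f (c *\<^sub>R z) | a f. smooth_on f UNIV})"
  proof (intro conjI allI ballI)
    show "h differentiable (at x)" for x
      unfolding h differentiable_def using pd_scale(1)[OF f] by blast
    show "pd h i \<in> {\<lambda>z. a * f (c *\<^sub>R z) | a f. smooth_on f UNIV}" if "i \<in> Basis" for i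
      unfolding p
      by (intro CollectI exI[of _ "a * c"] exI[of _ "pd f i"] conjI refl smooth_on_pd[OF f that])
  qed
qed (use f in blast)

text \<open>The dilation to scale \<epsilon> that preserves the integral, so that the substitution y
  = x + \<epsilon>z removes all powers of \<epsilon>.\<close>

definition scaled :: "real \<Rightarrow> ('a::euclidean_space \<Rightarrow> real) \<Rightarrow> 'a \<Rightarrow> real" where
  "scaled \<epsilon> \<rho> z = inverse (\<epsilon> ^ DIM('a)) * \<rho> (inverse \<epsilon> *\<^sub>R z)"

lemma test_function_scaled:
  fixes \<rho> :: "'a::euclidean_space \<Rightarrow> real"
  assumes \<rho>: "test_function UNIV \<rho>" and \<epsilon>: "0 < \<epsilon>"
  shows "test_function UNIV (scaled \<epsilon> \<rho>)"
proof -
  obtain K where K: "compact K" "\<And>x. x \<notin> K \<Longrightarrow> \<rho> x = 0"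
    using \<rho> by (auto simp: test_function_def)
  have "compact ((\<lambda>z. \<epsilon> *\<^sub>R z) ` K)"
    by (intro compact_continuous_image K continuous_intros)
  moreover have "scaled \<epsilon> \<rho> z = 0" if "z \<notin> (\<lambda>z. \<epsilon> *\<^sub>R z) ` K" for z
  proof -
    have "inverse \<epsilon> *\<^sub>R z \<notin> K"
    proof
      assume "inverse \<epsilon> *\<^sub>R z \<in> K"
      from imageI[OF this, of "\<lambda>z. \<epsilon> *\<^sub>R z"] \<epsilon> that show False by simp
    qed
    then show ?thesis by (simp add: scaled_def K)
  qed
  ultimately show ?thesis unfolding test_function_def scaled_def[abs_def]
    using smooth_scale[OF test_function_smooth[OF \<rho>]] by auto
qed

text \<open>The factor 1/\<epsilon> is the one by which the increments are divided in the
  hypothesis.\<close>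

lemma pd_scaled:
  assumes "smooth_on \<rho> UNIV"
  shows "pd (scaled \<epsilon> \<rho>) i z = inverse \<epsilon> * scaled \<epsilon> (pd \<rho> i) z"
  unfolding scaled_def[abs_def] pd_scale(2)[OF assms] by simp

lemma conv_scaled:
  fixes \<rho> :: "'a::euclidean_space \<Rightarrow> real"
  assumes [measurable]: "\<rho> \<in> borel_measurable borel" "u \<in> borel_measurable borel" and \<epsilon>: "0 < \<epsilon>"
  shows "conv (scaled \<epsilon> \<rho>) u x = (\<integral>z. \<rho> z * u (x + \<epsilon> *\<^sub>R z) \<partial>lborel)"
proof -
  have "(\<lambda>y. scaled \<epsilon> \<rho> (y - x) * u y) \<in> borel_measurable borel"
    unfolding scaled_def by measurable
  from lborel_integral_affine[OF this \<epsilon>, of x] \<epsilon> show ?thesis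
    by (simp add: conv_def scaled_def mult.assoc)
qed

text \<open>Cauchy-Schwarz between the kernel and \<open>g\<close> cut off to the ball, which
  contains the support of the kernel. The right-hand side may be infinite.\<close>

lemma weighted_integral_sq_le:
  fixes g :: "'a::euclidean_space \<Rightarrow> real"
  assumes \<kappa>: "test_function (ball 0 r) \<kappa>" and [measurable]: "g \<in> borel_measurable borel"
  shows "ennreal ((\<integral>z. \<kappa> z * g z \<partial>lborel)\<^sup>2) \<le>
    ennreal (\<integral>z. (\<kappa> z)\<^sup>2 \<partial>lborel) * (\<integral>\<^sup>+z. ennreal ((g z)\<^sup>2) * indicator (ball 0 r) z \<partial>lborel)"
proof -
  note [measurable] = test_function_borel[OF \<kappa>]
  have [measurable]: "ball (0::'a) r \<in> sets borel" by simp
  have k0: "\<kappa> z = 0" if "z \<notin> ball 0 r" for z using \<kappa> that by (auto simp: test_function_def)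
  have k2: "integrable lborel (\<lambda>z. (\<kappa> z)\<^sup>2)"
    using test_function_integrable[OF test_function_mult[OF test_function_UNIV[OF \<kappa>] test_function_smooth[OF \<kappa>]]]
    by (simp add: power2_eq_square)
  have "ennreal \<bar>\<integral>z. \<kappa> z * g z \<partial>lborel\<bar> \<le> (\<integral>\<^sup>+z. ennreal \<bar>\<kappa> z * g z\<bar> \<partial>lborel)"
  \<comment> \<open>Without integrability the Bochner integral is 0 by convention, and the bound is
    trivial.\<close>
  proof (cases "integrable lborel (\<lambda>z. \<kappa> z * g z)")
    case True
    from integral_norm_bound_ennreal[OF this] show ?thesis by simp
  qed (simp add: not_integrable_integral_eq)
  also have "\<dots> = (\<integral>\<^sup>+z. ennreal \<bar>\<kappa> z\<bar> * (ennreal \<bar>g z\<bar> * indicator (ball 0 r) z) \<partial>lborel)"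
    by (intro nn_integral_cong) (auto simp: k0 abs_mult ennreal_mult indicator_def)
  finally have "(ennreal \<bar>\<integral>z. \<kappa> z * g z \<partial>lborel\<bar>)\<^sup>2 \<le>
      (\<integral>\<^sup>+z. ennreal \<bar>\<kappa> z\<bar> * (ennreal \<bar>g z\<bar> * indicator (ball 0 r) z) \<partial>lborel)\<^sup>2"
    by (intro power_mono) auto
  also have "\<dots> \<le> (\<integral>\<^sup>+z. (ennreal \<bar>\<kappa> z\<bar>)\<^sup>2 \<partial>lborel) *
      (\<integral>\<^sup>+z. (ennreal \<bar>g z\<bar> * indicator (ball 0 r) z)\<^sup>2 \<partial>lborel)"
    by (rule Cauchy_Schwarz_nn_integral) measurable
  also have "(\<integral>\<^sup>+z. (ennreal \<bar>\<kappa> z\<bar>)\<^sup>2 \<partial>lborel) = ennreal (\<integral>z. (\<kappa> z)\<^sup>2 \<partial>lborel)"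
    by (subst nn_integral_eq_integral[OF k2, symmetric]) (auto simp: ennreal_power)
  also have "(\<integral>\<^sup>+z. (ennreal \<bar>g z\<bar> * indicator (ball 0 r) z)\<^sup>2 \<partial>lborel) =
      (\<integral>\<^sup>+z. ennreal ((g z)\<^sup>2) * indicator (ball 0 r) z \<partial>lborel)"
    by (intro nn_integral_cong) (auto simp: ennreal_power indicator_def)
  finally show ?thesis by (simp add: ennreal_power)
qed

text \<open>Used with c = u x. For a kernel of integral one it produces the difference of
  mollification and function, for a kernel of integral zero it introduces increments at no
  cost.\<close>

lemma integral_test_function_affine_diff:
  fixes \<kappa> :: "'a::euclidean_space \<Rightarrow> real"
  assumes \<kappa>: "test_function UNIV \<kappa>" and u: "u \<in> borel_measurable borel" "integrable lborel (\<lambda>x. (u x)\<^sup>2)"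
    and \<epsilon>: "0 < \<epsilon>"
  shows "(\<integral>z. \<kappa> z * (u (x + \<epsilon> *\<^sub>R z) - c) \<partial>lborel) =
    (\<integral>z. \<kappa> z * u (x + \<epsilon> *\<^sub>R z) \<partial>lborel) - c * (\<integral>z. \<kappa> z \<partial>lborel)"
proof -
  have "locally_integrable (\<lambda>z. u (x + \<epsilon> *\<^sub>R z))"
    using u lborel_integrable_affine[OF u(2) \<epsilon>]
    by (intro locally_integrable_square_integrable) auto
  from conv_integrable[OF \<kappa> this, of 0] test_function_integrable[OF \<kappa>]
  show ?thesis by (simp add: right_diff_distrib mult.commute)
qed

abbreviation sq_increments :: "real \<Rightarrow> real \<Rightarrow> ('a::euclidean_space \<Rightarrow> real) \<Rightarrow> 'a \<Rightarrow> ennreal" where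
  "sq_increments r \<epsilon> u x \<equiv>
    \<integral>\<^sup>+z. ennreal (((u (x + \<epsilon> *\<^sub>R z) - u x) / \<epsilon>)\<^sup>2) * indicator (ball 0 r) z \<partial>lborel"

text \<open>All three bounds are pointwise in x, with a constant determined by the mollifier before
  \<open>u\<close>, \<epsilon> and x. Integration over x is postponed, since the first two bounds
  are to be integrated over inner regions and the third over the whole space.\<close>

lemma mollifier_estimates:
  fixes \<rho> :: "'a::euclidean_space \<Rightarrow> real"
  assumes \<rho>: "test_function (ball 0 r) \<rho>" "(\<integral>x. \<rho> x \<partial>lborel) = 1"
  obtains C where "0 < C"
    "\<And>u \<epsilon> x. \<lbrakk>u \<in> borel_measurable borel; integrable lborel (\<lambda>x. (u x)\<^sup>2); 0 < \<epsilon>\<rbrakk> \<Longrightarrow>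
       ennreal ((u x - conv (scaled \<epsilon> \<rho>) u x)\<^sup>2) \<le>
       ennreal (C * \<epsilon>\<^sup>2) * sq_increments r \<epsilon> u x"
    "\<And>u \<epsilon> x. \<lbrakk>u \<in> borel_measurable borel; integrable lborel (\<lambda>x. (u x)\<^sup>2); 0 < \<epsilon>\<rbrakk> \<Longrightarrow>
       ennreal ((norm (grad (conv (scaled \<epsilon> \<rho>) u) x))\<^sup>2) \<le>
       ennreal C * sq_increments r \<epsilon> u x"
    "\<And>u \<epsilon> x. \<lbrakk>u \<in> borel_measurable borel; integrable lborel (\<lambda>x. (u x)\<^sup>2); 0 < \<epsilon>\<rbrakk> \<Longrightarrow>
       ennreal ((conv (scaled \<epsilon> \<rho>) u x)\<^sup>2) \<le>
       ennreal C * (\<integral>\<^sup>+z. ennreal ((u (x + \<epsilon> *\<^sub>R z))\<^sup>2) * indicator (ball 0 r) z \<partial>lborel)"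
proof -
  have \<rho>U: "test_function UNIV \<rho>" by (rule test_function_UNIV[OF \<rho>(1)])
  note [measurable] = test_function_borel[OF \<rho>U]
  define K where "K \<kappa> = (\<integral>z. (\<kappa> z)\<^sup>2 \<partial>lborel)" for \<kappa> :: "'a \<Rightarrow> real"
  have K0: "0 \<le> K \<kappa>" for \<kappa> by (simp add: K_def)
  \<comment> \<open>The squared norms of the mollifier and of its partial derivatives; the 1 only
    secures positivity.\<close>
  define C where "C = 1 + K \<rho> + (\<Sum>i\<in>Basis. K (pd \<rho> i))"
  have C: "0 < C" "K \<rho> \<le> C" "(\<Sum>i\<in>Basis. K (pd \<rho> i)) \<le> C"
    using K0[of \<rho>] sum_nonneg[of "Basis :: 'a set" "\<lambda>i. K (pd \<rho> i)", OF K0] unfolding C_def by linarith+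
  show ?thesis
  proof (rule that[OF C(1)])
    fix u :: "'a \<Rightarrow> real" and \<epsilon> :: real and x
    assume u: "u \<in> borel_measurable borel" "integrable lborel (\<lambda>x. (u x)\<^sup>2)" and \<epsilon>: "0 < \<epsilon>"
    note [measurable] = u(1)
    let ?d = "\<lambda>z. (u (x + \<epsilon> *\<^sub>R z) - u x) / \<epsilon>"
    let ?I = "\<integral>\<^sup>+z. ennreal ((?d z)\<^sup>2) * indicator (ball 0 r) z \<partial>lborel"
    have lint: "locally_integrable u" by (rule locally_integrable_square_integrable[OF u])
    have conv: "conv (scaled \<epsilon> \<kappa>) u x = (\<integral>z. \<kappa> z * u (x + \<epsilon> *\<^sub>R z) \<partial>lborel)"
      if "test_function UNIV \<kappa>" for \<kappa>
      using test_function_borel[OF that] u(1) \<epsilon> by (rule conv_scaled)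
    \<comment> \<open>The mollifier has integral one, so u x can be moved under the integral;
      extracting \<epsilon> then leaves the difference quotient of the hypothesis.\<close>
    have "conv (scaled \<epsilon> \<rho>) u x - u x = (\<integral>z. \<rho> z * (u (x + \<epsilon> *\<^sub>R z) - u x) \<partial>lborel)"
      using integral_test_function_affine_diff[OF \<rho>U u \<epsilon>, of x "u x"] conv[OF \<rho>U] \<rho>(2) by simp
    also have "\<dots> = (\<integral>z. \<epsilon> * (\<rho> z * ?d z) \<partial>lborel)" using \<epsilon> by (simp add: mult.left_commute)
    also have "\<dots> = \<epsilon> * (\<integral>z. \<rho> z * ?d z \<partial>lborel)" by (rule integral_mult_right_zero)
    finally have "u x - conv (scaled \<epsilon> \<rho>) u x = - (\<epsilon> * (\<integral>z. \<rho> z * ?d z \<partial>lborel))" by linarith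
    then have *: "(u x - conv (scaled \<epsilon> \<rho>) u x)\<^sup>2 = \<epsilon>\<^sup>2 * (\<integral>z. \<rho> z * ?d z \<partial>lborel)\<^sup>2"
      by (simp only: power2_minus power_mult_distrib)
    have "ennreal ((u x - conv (scaled \<epsilon> \<rho>) u x)\<^sup>2) \<le> ennreal (\<epsilon>\<^sup>2) * (ennreal (K \<rho>) * ?I)"
      unfolding * K_def ennreal_mult[OF zero_le_power2 zero_le_power2]
      by (intro mult_left_mono weighted_integral_sq_le \<rho>(1)) auto
    also have "\<dots> \<le> ennreal (\<epsilon>\<^sup>2) * (ennreal C * ?I)"
      using C by (intro mult_left_mono mult_right_mono ennreal_leI) auto
    also have "\<dots> = ennreal (C * \<epsilon>\<^sup>2) * ?I" using C by (simp add: ennreal_mult mult_ac)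
    finally show "ennreal ((u x - conv (scaled \<epsilon> \<rho>) u x)\<^sup>2) \<le> ennreal (C * \<epsilon>\<^sup>2) * ?I" .
    have "ennreal ((conv (scaled \<epsilon> \<rho>) u x)\<^sup>2) \<le>
       ennreal (K \<rho>) * (\<integral>\<^sup>+z. ennreal ((u (x + \<epsilon> *\<^sub>R z))\<^sup>2) * indicator (ball 0 r) z \<partial>lborel)"
      unfolding conv[OF \<rho>U] K_def by (rule weighted_integral_sq_le[OF \<rho>(1)]) measurable
    also have "\<dots> \<le> ennreal C * (\<integral>\<^sup>+z. ennreal ((u (x + \<epsilon> *\<^sub>R z))\<^sup>2) * indicator (ball 0 r) z \<partial>lborel)"
      using C by (intro mult_right_mono ennreal_leI) auto
    finally show "ennreal ((conv (scaled \<epsilon> \<rho>) u x)\<^sup>2) \<le>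
       ennreal C * (\<integral>\<^sup>+z. ennreal ((u (x + \<epsilon> *\<^sub>R z))\<^sup>2) * indicator (ball 0 r) z \<partial>lborel)" .
    have pd: "ennreal ((pd (conv (scaled \<epsilon> \<rho>) u) i x)\<^sup>2) \<le> ennreal (K (pd \<rho> i)) * ?I" if i: "i \<in> Basis" for i
    proof -
      have pdU: "test_function UNIV (pd \<rho> i)" by (rule test_function_pd[OF \<rho>U i])
      \<comment> \<open>Differentiating the kernel costs 1/\<epsilon>. The derivative of the
        mollifier has integral zero, so u x may be subtracted, and 1/\<epsilon> becomes the
        denominator of the difference quotient.\<close>
      have "pd (conv (scaled \<epsilon> \<rho>) u) i x = - (inverse \<epsilon> * conv (scaled \<epsilon> (pd \<rho> i)) u x)"
        using fun_cong[OF pd_conv[OF test_function_scaled[OF \<rho>U \<epsilon>] lint i], of x]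
        by (simp add: conv_def mult.assoc pd_scaled[OF test_function_smooth[OF \<rho>U]])
      also have "conv (scaled \<epsilon> (pd \<rho> i)) u x = (\<integral>z. pd \<rho> i z * (u (x + \<epsilon> *\<^sub>R z) - u x) \<partial>lborel)"
        using integral_test_function_affine_diff[OF pdU u \<epsilon>, of x "u x"] conv[OF pdU]
          integral_pd_test_function[OF \<rho>U i] by simp
      also have "inverse \<epsilon> * \<dots> = (\<integral>z. inverse \<epsilon> * (pd \<rho> i z * (u (x + \<epsilon> *\<^sub>R z) - u x)) \<partial>lborel)"
        by simp
      also have "\<dots> = (\<integral>z. pd \<rho> i z * ?d z \<partial>lborel)"
        by (intro Bochner_Integration.integral_cong) (auto simp: divide_inverse mult_ac)
      finally have "(pd (conv (scaled \<epsilon> \<rho>) u) i x)\<^sup>2 = (\<integral>z. pd \<rho> i z * ?d z \<partial>lborel)\<^sup>2" by simp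
      then show ?thesis unfolding K_def
        using weighted_integral_sq_le[OF test_function_pd[OF \<rho>(1) i], of ?d] by simp
    qed
    have "(norm (grad (conv (scaled \<epsilon> \<rho>) u) x))\<^sup>2 = (\<Sum>i\<in>Basis. (pd (conv (scaled \<epsilon> \<rho>) u) i x)\<^sup>2)"
      by (subst power2_norm_eq_inner, subst euclidean_inner) (simp add: grad_inner_Basis power2_eq_square)
    then have "ennreal ((norm (grad (conv (scaled \<epsilon> \<rho>) u) x))\<^sup>2) =
        (\<Sum>i\<in>Basis. ennreal ((pd (conv (scaled \<epsilon> \<rho>) u) i x)\<^sup>2))"
      by (simp add: sum_ennreal)
    also have "\<dots> \<le> (\<Sum>i\<in>Basis. ennreal (K (pd \<rho> i)) * ?I)" by (intro sum_mono pd)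
    also have "\<dots> = ennreal (\<Sum>i\<in>Basis. K (pd \<rho> i)) * ?I"
      using K0 by (simp add: sum_ennreal flip: sum_distrib_right)
    also have "\<dots> \<le> ennreal C * ?I" using C by (intro mult_right_mono ennreal_leI) auto
    finally show "ennreal ((norm (grad (conv (scaled \<epsilon> \<rho>) u) x))\<^sup>2) \<le> ennreal C * ?I" .
  qed
qed

text \<open>After exchanging the integrals, the inner one is the squared norm of a translate of
  \<open>u\<close>, the same for every z; integrating over z yields the volume of
  \<open>B\<close>.\<close>

lemma conv_scaled_L2_bound:
  fixes u :: "'a::euclidean_space \<Rightarrow> real"
  assumes [measurable]: "B \<in> sets borel" and u [measurable]: "u \<in> borel_measurable borel" and c: "0 < \<epsilon>"
    and est: "\<And>x. ennreal ((w x)\<^sup>2) \<le>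
       ennreal C * (\<integral>\<^sup>+z. ennreal ((u (x + \<epsilon> *\<^sub>R z))\<^sup>2) * indicator B z \<partial>lborel)"
  shows "(\<integral>\<^sup>+x. ennreal ((w x)\<^sup>2) \<partial>lborel) \<le>
    ennreal C * (emeasure lborel B * (\<integral>\<^sup>+x. ennreal ((u x)\<^sup>2) \<partial>lborel))"
proof -
  let ?J = "\<integral>\<^sup>+x. ennreal ((u x)\<^sup>2) \<partial>lborel"
  have tr: "(\<integral>\<^sup>+x. ennreal ((u (x + \<epsilon> *\<^sub>R z))\<^sup>2) \<partial>lborel) = ?J" for z
    using lborel_nn_integral_affine[of "\<lambda>x. ennreal ((u x)\<^sup>2)" 1 "\<epsilon> *\<^sub>R z"] by (simp add: add.commute)
  have "(\<integral>\<^sup>+x. ennreal ((w x)\<^sup>2) \<partial>lborel) \<le>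
    (\<integral>\<^sup>+x. ennreal C * (\<integral>\<^sup>+z. ennreal ((u (x + \<epsilon> *\<^sub>R z))\<^sup>2) * indicator B z \<partial>lborel) \<partial>lborel)"
    by (intro nn_integral_mono est)
  also have "\<dots> = ennreal C *
      (\<integral>\<^sup>+x. (\<integral>\<^sup>+z. ennreal ((u (x + \<epsilon> *\<^sub>R z))\<^sup>2) * indicator B z \<partial>lborel) \<partial>lborel)"
    by (rule nn_integral_cmult) measurable
  also have "(\<integral>\<^sup>+x. (\<integral>\<^sup>+z. ennreal ((u (x + \<epsilon> *\<^sub>R z))\<^sup>2) * indicator B z \<partial>lborel) \<partial>lborel) =
      (\<integral>\<^sup>+z. (\<integral>\<^sup>+x. ennreal ((u (x + \<epsilon> *\<^sub>R z))\<^sup>2) * indicator B z \<partial>lborel) \<partial>lborel)"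
    by (rule lborel_pair.Fubini') measurable
  also have "\<dots> = (\<integral>\<^sup>+z. ?J * indicator B z \<partial>lborel)"
    by (subst nn_integral_multc) (auto simp: tr)
  also have "\<dots> = emeasure lborel B * ?J"
    by (subst nn_integral_cmult_indicator) (auto simp: mult.commute)
  finally show ?thesis .
qed

subsection \<open>The Poincare inequality on grid cells\<close>

lemma ennreal_integral_le_nn_integral:
  "ennreal \<bar>\<integral>x. f x \<partial>M\<bar> \<le> (\<integral>\<^sup>+x. ennreal \<bar>f x\<bar> \<partial>M)"
proof (cases "integrable M f")
  case True
  from integral_norm_bound_ennreal[OF this] show ?thesis by simp
qed (simp add: not_integrable_integral_eq)

text \<open>The fundamental theorem of calculus along the segment from x to x + z, followed by
  Cauchy-Schwarz on the unit interval.\<close>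

lemma increment_sq_le_gradient:
  fixes f :: "'a::euclidean_space \<Rightarrow> real"
  assumes f: "smooth_on f UNIV"
  shows "ennreal ((f (x + z) - f x)\<^sup>2) \<le>
    ennreal ((norm z)\<^sup>2) * (\<integral>\<^sup>+t. indicator {0..1} t * ennreal ((norm (grad f (x + t *\<^sub>R z)))\<^sup>2) \<partial>lborel)"
proof -
  have cg: "continuous_on UNIV (grad f)" by (rule continuous_on_grad[OF f])
  have gc: "continuous_on UNIV (\<lambda>t. grad f (x + t *\<^sub>R z))"
    by (rule continuous_on_compose2[OF cg]) (auto intro!: continuous_intros)
  have [measurable]: "(\<lambda>t. grad f (x + t *\<^sub>R z)) \<in> borel_measurable borel"
    by (rule borel_measurable_continuous_onI[OF gc])
  let ?g = "\<lambda>t. grad f (x + t *\<^sub>R z)"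
  note D = smooth_has_derivative_grad[OF f]
  have "((\<lambda>t. f (x + t *\<^sub>R z)) has_vector_derivative ?g t \<bullet> z) (at t within {0..1})" for t
    unfolding has_vector_derivative_def
  proof (rule has_derivative_at_withinI)
    have "((\<lambda>t. x + t *\<^sub>R z) has_derivative (\<lambda>s. s *\<^sub>R z)) (at t)"
      by (auto intro!: derivative_eq_intros)
    from has_derivative_compose[OF this D]
    show "((\<lambda>t. f (x + t *\<^sub>R z)) has_derivative (\<lambda>s. s *\<^sub>R (?g t \<bullet> z))) (at t)" by simp
  qed
  then have "(\<integral>t. indicator {0..1} t *\<^sub>R (?g t \<bullet> z) \<partial>lborel) = f (x + 1 *\<^sub>R z) - f (x + 0 *\<^sub>R z)"
    by (intro integral_FTC_atLeastAtMost)
      (auto intro!: continuous_intros continuous_on_subset[OF gc])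
  then have "ennreal \<bar>f (x + z) - f x\<bar> \<le> (\<integral>\<^sup>+t. ennreal \<bar>indicator {0..1} t *\<^sub>R (?g t \<bullet> z)\<bar> \<partial>lborel)"
    using ennreal_integral_le_nn_integral[of lborel "\<lambda>t. indicator {0..1} t *\<^sub>R (?g t \<bullet> z)"] by simp
  \<comment> \<open>The indicator is doubled so that Cauchy-Schwarz can take it as one factor, of
    square integral 1, and still keep the other factor on the interval.\<close>
  also have "\<dots> \<le> (\<integral>\<^sup>+t. indicator {0..1} t * (ennreal (norm z) * (indicator {0..1} t * ennreal (norm (?g t)))) \<partial>lborel)"
  proof (rule nn_integral_mono)
    fix t :: real
    have "\<bar>?g t \<bullet> z\<bar> \<le> norm z * norm (?g t)" using Cauchy_Schwarz_ineq2[of "?g t" z] by (simp add: mult.commute)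
    then show "ennreal \<bar>indicator {0..1} t *\<^sub>R (?g t \<bullet> z)\<bar> \<le>
        indicator {0..1} t * (ennreal (norm z) * (indicator {0..1} t * ennreal (norm (?g t))))"
      by (auto simp: indicator_def ennreal_mult[symmetric] ennreal_leI)
  qed
  finally have "(ennreal \<bar>f (x + z) - f x\<bar>)\<^sup>2 \<le>
    (\<integral>\<^sup>+t. indicator {0..1} t * (ennreal (norm z) * (indicator {0..1} t * ennreal (norm (?g t)))) \<partial>lborel)\<^sup>2"
    by (intro power_mono) auto
  also have "\<dots> \<le> (\<integral>\<^sup>+t. (indicator {0..1::real} t)\<^sup>2 \<partial>lborel) *
      (\<integral>\<^sup>+t. (ennreal (norm z) * (indicator {0..1} t * ennreal (norm (?g t))))\<^sup>2 \<partial>lborel)"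
    by (rule Cauchy_Schwarz_nn_integral) measurable
  also have "(\<integral>\<^sup>+t. (indicator {0..1::real} t)\<^sup>2 \<partial>lborel) = (\<integral>\<^sup>+t. indicator {0..1::real} t \<partial>lborel)"
    by (intro nn_integral_cong) (auto simp: indicator_def)
  also have "\<dots> = 1" by simp
  also have "(\<integral>\<^sup>+t. (ennreal (norm z) * (indicator {0..1} t * ennreal (norm (?g t))))\<^sup>2 \<partial>lborel) =
     (\<integral>\<^sup>+t. ennreal ((norm z)\<^sup>2) * (indicator {0..1} t * ennreal ((norm (?g t))\<^sup>2)) \<partial>lborel)"
    by (intro nn_integral_cong) (auto simp: indicator_def power_mult_distrib ennreal_power)
  also have "\<dots> = ennreal ((norm z)\<^sup>2) * (\<integral>\<^sup>+t. indicator {0..1} t * ennreal ((norm (?g t))\<^sup>2) \<partial>lborel)"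
    by (rule nn_integral_cmult) measurable
  finally show ?thesis by (simp add: ennreal_power)
qed

text \<open>For fixed displacement z and parameter t, translation invariance turns the integral over
  x of the squared gradient at x + t z into the integral over \<open>Q\<close>. What remains is the
  measure of \<open>Z\<close>, which contains all displacements, and the unit interval.\<close>

lemma increments_on_convex_le_gradient:
  fixes f :: "'a::euclidean_space \<Rightarrow> real"
  assumes f: "smooth_on f UNIV" and [measurable]: "Q \<in> sets borel" "Z \<in> sets borel" and Q: "convex Q"
    and D: "\<And>x y. x \<in> Q \<Longrightarrow> y \<in> Q \<Longrightarrow> norm (y - x) \<le> D" "\<And>x y. x \<in> Q \<Longrightarrow> y \<in> Q \<Longrightarrow> y - x \<in> Z"
  shows "(\<integral>\<^sup>+x. indicator Q x * (\<integral>\<^sup>+y. indicator Q y * ennreal ((f y - f x)\<^sup>2) \<partial>lborel) \<partial>lborel) \<le>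
    ennreal (D\<^sup>2) * emeasure lborel Z * (\<integral>\<^sup>+x. indicator Q x * ennreal ((norm (grad f x))\<^sup>2) \<partial>lborel)"
proof -
  have [measurable]: "f \<in> borel_measurable borel" "grad f \<in> borel_measurable borel"
    by (intro borel_measurable_continuous_onI continuous_on_grad smooth_on_continuous f)+
  let ?E = "\<integral>\<^sup>+x. indicator Q x * ennreal ((norm (grad f x))\<^sup>2) \<partial>lborel"
  let ?G = "\<lambda>x. indicator Q x * ennreal ((norm (grad f x))\<^sup>2)"
  have "(\<integral>\<^sup>+x. indicator Q x * (\<integral>\<^sup>+y. indicator Q y * ennreal ((f y - f x)\<^sup>2) \<partial>lborel) \<partial>lborel) =
    (\<integral>\<^sup>+x. indicator Q x * (\<integral>\<^sup>+z. indicator Q (x + z) * ennreal ((f (x + z) - f x)\<^sup>2) \<partial>lborel) \<partial>lborel)"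
  proof (rule nn_integral_cong, rule arg_cong2[of _ _ _ _ times, OF refl])
    fix x
    show "(\<integral>\<^sup>+y. indicator Q y * ennreal ((f y - f x)\<^sup>2) \<partial>lborel) =
        (\<integral>\<^sup>+z. indicator Q (x + z) * ennreal ((f (x + z) - f x)\<^sup>2) \<partial>lborel)"
      using lborel_nn_integral_affine[of "\<lambda>y. indicator Q y * ennreal ((f y - f x)\<^sup>2)" 1 x] by simp
  qed
  also have "\<dots> = (\<integral>\<^sup>+x. (\<integral>\<^sup>+z. indicator Q x * (indicator Q (x + z) * ennreal ((f (x + z) - f x)\<^sup>2)) \<partial>lborel) \<partial>lborel)"
    by (subst nn_integral_cmult) auto
  \<comment> \<open>By convexity the segment stays in \<open>Q\<close>, so the indicator can be
    moved from its end points to the intermediate point, where it follows the translation.\<close>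
  also have "\<dots> \<le> (\<integral>\<^sup>+x. (\<integral>\<^sup>+z. (\<integral>\<^sup>+t. ennreal (D\<^sup>2) * (indicator Z z * (indicator {0..1} t * ?G (x + t *\<^sub>R z))) \<partial>lborel) \<partial>lborel) \<partial>lborel)"
  proof (intro nn_integral_mono)
    fix x z :: 'a
    show "indicator Q x * (indicator Q (x + z) * ennreal ((f (x + z) - f x)\<^sup>2)) \<le>
      (\<integral>\<^sup>+t. ennreal (D\<^sup>2) * (indicator Z z * (indicator {0..1} t * ?G (x + t *\<^sub>R z))) \<partial>lborel)"
    proof (cases "x \<in> Q \<and> x + z \<in> Q")
      case True
      then have z: "norm z \<le> D" "z \<in> Z" using D[of x "x + z"] by auto
      have seg: "x + t *\<^sub>R z \<in> Q" if "t \<in> {0..1}" for t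
        using convexD_alt[OF Q, of x "x + z" t] True that by (simp add: algebra_simps)
      have "ennreal ((f (x + z) - f x)\<^sup>2) \<le>
          ennreal ((norm z)\<^sup>2) * (\<integral>\<^sup>+t. indicator {0..1} t * ennreal ((norm (grad f (x + t *\<^sub>R z)))\<^sup>2) \<partial>lborel)"
        by (rule increment_sq_le_gradient[OF f])
      also have "\<dots> \<le> ennreal (D\<^sup>2) * (\<integral>\<^sup>+t. indicator {0..1} t * ennreal ((norm (grad f (x + t *\<^sub>R z)))\<^sup>2) \<partial>lborel)"
        using z by (intro mult_right_mono ennreal_leI power_mono) auto
      also have "\<dots> = ennreal (D\<^sup>2) * (\<integral>\<^sup>+t. indicator Z z * (indicator {0..1} t * ?G (x + t *\<^sub>R z)) \<partial>lborel)"
        by (rule arg_cong2[of _ _ _ _ times, OF refl], rule nn_integral_cong)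
          (use z seg in \<open>auto simp: indicator_def\<close>)
      also have "\<dots> = (\<integral>\<^sup>+t. ennreal (D\<^sup>2) * (indicator Z z * (indicator {0..1} t * ?G (x + t *\<^sub>R z))) \<partial>lborel)"
        by (rule nn_integral_cmult[symmetric]) measurable
      finally show ?thesis using True by simp
    qed (auto simp: indicator_def)
  qed
  \<comment> \<open>Two exchanges bring x to the innermost place, where the translation by t z can
    be undone.\<close>
  also have "\<dots> = (\<integral>\<^sup>+z. (\<integral>\<^sup>+x. (\<integral>\<^sup>+t. ennreal (D\<^sup>2) * (indicator Z z * (indicator {0..1} t * ?G (x + t *\<^sub>R z))) \<partial>lborel) \<partial>lborel) \<partial>lborel)"
    by (rule lborel_pair.Fubini') measurable
  also have "\<dots> = (\<integral>\<^sup>+z. (\<integral>\<^sup>+t. (\<integral>\<^sup>+x. ennreal (D\<^sup>2) * (indicator Z z * (indicator {0..1} t * ?G (x + t *\<^sub>R z))) \<partial>lborel) \<partial>lborel) \<partial>lborel)"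
    by (intro nn_integral_cong lborel_pair.Fubini') measurable
  also have "\<dots> = (\<integral>\<^sup>+z. (\<integral>\<^sup>+t. ennreal (D\<^sup>2) * (indicator Z z * (indicator {0..1::real} t * ?E)) \<partial>lborel) \<partial>lborel)"
  proof (intro nn_integral_cong)
    fix z :: 'a and t :: real
    have "(\<integral>\<^sup>+x. ?G (x + t *\<^sub>R z) \<partial>lborel) = ?E"
      using lborel_nn_integral_affine[of ?G 1 "t *\<^sub>R z"] by (simp add: add.commute)
    then show "(\<integral>\<^sup>+x. ennreal (D\<^sup>2) * (indicator Z z * (indicator {0..1} t * ?G (x + t *\<^sub>R z))) \<partial>lborel) =
      ennreal (D\<^sup>2) * (indicator Z z * (indicator {0..1} t * ?E))"
      by (simp add: nn_integral_cmult)
  qed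
  also have "\<dots> = (\<integral>\<^sup>+z. (\<integral>\<^sup>+t. ennreal (D\<^sup>2) * ?E * indicator Z z * indicator {0..1::real} t \<partial>lborel) \<partial>lborel)"
    by (simp add: mult_ac)
  also have "\<dots> = (\<integral>\<^sup>+z. ennreal (D\<^sup>2) * ?E * indicator Z z * (\<integral>\<^sup>+t. indicator {0..1::real} t \<partial>lborel) \<partial>lborel)"
    by (rule nn_integral_cong, rule nn_integral_cmult) measurable
  also have "\<dots> = ennreal (D\<^sup>2) * ?E * emeasure lborel Z"
    by (simp add: nn_integral_cmult_indicator)
  finally show ?thesis by (simp add: mult_ac)
qed

lemma integrable_continuous_bounded:
  fixes f :: "'a::euclidean_space \<Rightarrow> real"
  assumes f: "continuous_on UNIV f" and Q: "Q \<in> sets borel" "bounded Q"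
  shows "integrable lborel (\<lambda>x. indicator Q x * f x)"
proof -
  obtain R where R: "Q \<subseteq> ball 0 R" using bounded_subset_ballD[OF Q(2)] by blast
  have "integrable lborel (\<lambda>x. indicator (cball 0 R) x *\<^sub>R f x)"
    by (rule borel_integrable_compact) (auto intro: continuous_on_subset[OF f])
  from integrable_mult_indicator[OF _ this, of Q] Q
  have "integrable lborel (\<lambda>x. indicator Q x *\<^sub>R (indicator (cball 0 R) x *\<^sub>R f x))" by simp
  moreover have "(\<lambda>x. indicator Q x *\<^sub>R (indicator (cball 0 R) x *\<^sub>R f x)) = (\<lambda>x. indicator Q x * f x)"
    using R by (auto simp: fun_eq_iff indicator_def)
  ultimately show ?thesis by simp
qed

text \<open>Expanding the square, the double integral of (f y - f x)^2 over \<open>Q\<close> is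
  twice q times the integral of f^2, minus twice the square of the integral of f. The preceding
  bound applies to its left-hand form.\<close>

lemma poincare_convex:
  fixes f :: "'a::euclidean_space \<Rightarrow> real"
  assumes f: "smooth_on f UNIV" and Q: "Q \<in> sets borel" "bounded Q" "convex Q"
    and Z: "Z \<in> sets borel" "emeasure lborel Z = ennreal \<zeta>" "0 \<le> \<zeta>"
    and D: "\<And>x y. x \<in> Q \<Longrightarrow> y \<in> Q \<Longrightarrow> norm (y - x) \<le> D" "\<And>x y. x \<in> Q \<Longrightarrow> y \<in> Q \<Longrightarrow> y - x \<in> Z"
    and q: "measure lborel Q = q"
  shows "2 * q * (\<integral>x. indicator Q x * (f x)\<^sup>2 \<partial>lborel) \<le> 2 * (\<integral>x. indicator Q x * f x \<partial>lborel)\<^sup>2 +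
    D\<^sup>2 * \<zeta> * (\<integral>x. indicator Q x * (norm (grad f x))\<^sup>2 \<partial>lborel)"
proof -
  have cf: "continuous_on UNIV f" "continuous_on UNIV (grad f)"
    using f by (auto intro: smooth_on_continuous continuous_on_grad)
  note int = integrable_continuous_bounded[OF _ Q(1,2)]
  have i0: "integrable lborel (indicator Q :: 'a \<Rightarrow> real)" using int[of "\<lambda>_. 1"] by simp
  have i1: "integrable lborel (\<lambda>x. indicator Q x * f x)" by (rule int[OF cf(1)])
  have i2: "integrable lborel (\<lambda>x. indicator Q x * (f x)\<^sup>2)"
    by (rule int) (intro continuous_intros cf)
  have i3: "integrable lborel (\<lambda>x. indicator Q x * (norm (grad f x))\<^sup>2)"
    by (rule int) (intro continuous_intros cf)
  define a where "a = (\<integral>x. indicator Q x * f x \<partial>lborel)"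
  define b where "b = (\<integral>x. indicator Q x * (f x)\<^sup>2 \<partial>lborel)"
  define e where "e = (\<integral>x. indicator Q x * (norm (grad f x))\<^sup>2 \<partial>lborel)"
  have q': "(\<integral>x. indicator Q x \<partial>lborel) = q" using q by simp
  \<comment> \<open>For fixed c the inner integral is a quadratic polynomial in c. Its nonnegativity
    is recorded because \<open>ennreal\<close> would truncate negative values.\<close>
  have inner: "(\<integral>\<^sup>+y. indicator Q y * ennreal ((f y - c)\<^sup>2) \<partial>lborel) = ennreal (b - 2 * c * a + c\<^sup>2 * q)"
    and inner0: "0 \<le> b - 2 * c * a + c\<^sup>2 * q" for c
  proof -
    have eq: "indicator Q y * (f y - c)\<^sup>2 =
        indicator Q y * (f y)\<^sup>2 - 2 * c * (indicator Q y * f y) + c\<^sup>2 * indicator Q y" for y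
      by (auto simp: indicator_def power2_diff)
    have i: "integrable lborel (\<lambda>y. indicator Q y * (f y - c)\<^sup>2)"
      unfolding eq using i0 i1 i2 by auto
    have v: "(\<integral>y. indicator Q y * (f y - c)\<^sup>2 \<partial>lborel) = b - 2 * c * a + c\<^sup>2 * q"
      unfolding eq a_def b_def using i0 i1 i2 q' by simp
    have "(\<integral>\<^sup>+y. indicator Q y * ennreal ((f y - c)\<^sup>2) \<partial>lborel) =
        (\<integral>\<^sup>+y. ennreal (indicator Q y * (f y - c)\<^sup>2) \<partial>lborel)"
      by (intro nn_integral_cong) (auto simp: indicator_def)
    also have "\<dots> = ennreal (b - 2 * c * a + c\<^sup>2 * q)"
      by (subst nn_integral_eq_integral[OF i]) (auto simp: v)
    finally show "(\<integral>\<^sup>+y. indicator Q y * ennreal ((f y - c)\<^sup>2) \<partial>lborel) = ennreal (b - 2 * c * a + c\<^sup>2 * q)" .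
    show "0 \<le> b - 2 * c * a + c\<^sup>2 * q" unfolding v[symmetric] by (intro integral_nonneg_AE) auto
  qed
  have eq: "indicator Q x * (b - 2 * f x * a + (f x)\<^sup>2 * q) =
      b * indicator Q x - 2 * a * (indicator Q x * f x) + q * (indicator Q x * (f x)\<^sup>2)" for x
    by (auto simp: indicator_def)
  have i: "integrable lborel (\<lambda>x. indicator Q x * (b - 2 * f x * a + (f x)\<^sup>2 * q))"
    unfolding eq using i0 i1 i2 by auto
  have v: "(\<integral>x. indicator Q x * (b - 2 * f x * a + (f x)\<^sup>2 * q) \<partial>lborel) = b * q - 2 * a * a + q * b"
    unfolding eq using i0 i1 i2 q' by (simp add: a_def b_def)
  have "(\<integral>\<^sup>+x. indicator Q x * (\<integral>\<^sup>+y. indicator Q y * ennreal ((f y - f x)\<^sup>2) \<partial>lborel) \<partial>lborel) =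
     (\<integral>\<^sup>+x. ennreal (indicator Q x * (b - 2 * f x * a + (f x)\<^sup>2 * q)) \<partial>lborel)"
    unfolding inner by (intro nn_integral_cong) (auto simp: indicator_def)
  also have "\<dots> = ennreal (b * q - 2 * a * a + q * b)"
    by (subst nn_integral_eq_integral[OF i]) (use inner0 in \<open>auto simp: v intro!: AE_I2\<close>)
  finally have "ennreal (b * q - 2 * a * a + q * b) \<le> ennreal (D\<^sup>2) * ennreal \<zeta> *
      (\<integral>\<^sup>+x. indicator Q x * ennreal ((norm (grad f x))\<^sup>2) \<partial>lborel)"
    using increments_on_convex_le_gradient[OF f Q(1) Z(1) Q(3) D] Z(2) by simp
  also have "(\<integral>\<^sup>+x. indicator Q x * ennreal ((norm (grad f x))\<^sup>2) \<partial>lborel) =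
      (\<integral>\<^sup>+x. ennreal (indicator Q x * (norm (grad f x))\<^sup>2) \<partial>lborel)"
    by (intro nn_integral_cong) (auto simp: indicator_def)
  also have "\<dots> = ennreal e" unfolding e_def by (rule nn_integral_eq_integral[OF i3]) auto
  also have "ennreal (D\<^sup>2) * ennreal \<zeta> * ennreal e = ennreal (D\<^sup>2 * \<zeta> * e)"
    using Z(3) by (simp add: ennreal_mult' e_def)
  finally have "b * q - 2 * a * a + q * b \<le> D\<^sup>2 * \<zeta> * e"
    using Z(3) by (subst (asm) ennreal_le_iff) (auto simp: e_def intro!: mult_nonneg_nonneg integral_nonneg_AE)
  then show ?thesis unfolding a_def[symmetric] b_def[symmetric] e_def[symmetric]
    by (simp add: power2_eq_square algebra_simps)
qed

text \<open>Half-open cubes, so that every point lies in exactly one of them.\<close>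

definition cell :: "real \<Rightarrow> ('a::euclidean_space \<Rightarrow> int) \<Rightarrow> 'a set" where
  "cell h k = {x. \<forall>b\<in>Basis. h * of_int (k b) \<le> x \<bullet> b \<and> x \<bullet> b < h * (of_int (k b) + 1)}"

text \<open>The restriction fixes the values off \<open>Basis\<close>; a cell then has a single
  index, and the indices form a countable set.\<close>

definition cell_index :: "real \<Rightarrow> 'a::euclidean_space \<Rightarrow> 'a \<Rightarrow> int" where
  "cell_index h x = restrict (\<lambda>b. \<lfloor>x \<bullet> b / h\<rfloor>) Basis"

lemma cell_index_in: "cell_index h x \<in> PiE Basis (\<lambda>_. UNIV)"
  by (auto simp: cell_index_def)

lemma mem_cell_iff:
  assumes "0 < h" "k \<in> PiE Basis (\<lambda>_. UNIV)"
  shows "x \<in> cell h k \<longleftrightarrow> cell_index h x = k"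
proof -
  have "cell_index h x = k \<longleftrightarrow> (\<forall>b\<in>Basis. \<lfloor>x \<bullet> b / h\<rfloor> = k b)"
    using assms(2) by (fastforce simp: cell_index_def PiE_def extensional_def fun_eq_iff)
  also have "\<dots> \<longleftrightarrow> x \<in> cell h k"
    using assms(1) by (auto simp: cell_def floor_eq_iff field_simps)
  finally show ?thesis by simp
qed

text \<open>The two data of the convex Poincare inequality: a bound on the diameter, through the l1
  norm, and a cube of side 2h that contains all displacements.\<close>

lemma cell_diff:
  assumes "x \<in> cell h k" "y \<in> cell h k"
  shows "norm (y - x) \<le> h * DIM('a)" "y - x \<in> cbox (- h *\<^sub>R One) (h *\<^sub>R One :: 'a::euclidean_space)"
proof -
  have *: "\<bar>(y - x) \<bullet> b\<bar> \<le> h" if "b \<in> Basis" for b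
    using assms that unfolding cell_def by (fastforce simp: inner_diff_left abs_le_iff algebra_simps)
  have "norm (y - x) \<le> (\<Sum>b\<in>Basis. \<bar>(y - x) \<bullet> b\<bar>)" by (rule norm_le_l1)
  also have "\<dots> \<le> (\<Sum>b\<in>(Basis::'a set). h)" by (intro sum_mono *)
  finally show "norm (y - x) \<le> h * DIM('a)" by (simp add: mult.commute)
  show "y - x \<in> cbox (- h *\<^sub>R One) (h *\<^sub>R One)"
    using * by (auto simp: mem_box abs_le_iff) (metis minus_le_iff)
qed

lemma cell_measurable: "cell h k \<in> sets borel"
proof -
  have "cell h k = (\<Inter>b\<in>Basis. {x. h * of_int (k b) \<le> x \<bullet> b} \<inter> {x. x \<bullet> b < h * (of_int (k b) + 1)})"
    by (auto simp: cell_def)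
  also have "\<dots> \<in> sets borel"
    by (intro sets.finite_INT finite_Basis nonempty_Basis sets.Int borel_closed borel_open
        closed_halfspace_component_ge open_halfspace_component_lt)
  finally show ?thesis .
qed

lemma cell_convex: "convex (cell h k)"
proof (rule is_interval_convex)
  show "is_interval (cell h k)" unfolding is_interval_def cell_def by force
qed

lemma cell_between:
  "box (\<Sum>b\<in>Basis. (h * of_int (k b)) *\<^sub>R b) (\<Sum>b\<in>Basis. (h * (of_int (k b) + 1)) *\<^sub>R b) \<subseteq> cell h k"
  "cell h k \<subseteq> cbox (\<Sum>b\<in>Basis. (h * of_int (k b)) *\<^sub>R b) (\<Sum>b\<in>Basis. (h * (of_int (k b) + 1)) *\<^sub>R b)"
  by (auto simp: cell_def mem_box less_imp_le)

lemma cell_bounded: "bounded (cell h k)"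
  using cell_between(2) bounded_cbox bounded_subset by blast

lemma measure_cell:
  assumes "0 < h"
  shows "measure lborel (cell h k :: 'a::euclidean_space set) = h ^ DIM('a)"
proof -
  let ?l = "\<Sum>b\<in>Basis. (h * of_int (k b)) *\<^sub>R (b::'a)" and ?u = "\<Sum>b\<in>Basis. (h * (of_int (k b) + 1)) *\<^sub>R (b::'a)"
  have le: "?l \<bullet> b \<le> ?u \<bullet> b" if "b \<in> Basis" for b using assms that by simp
  have "(\<Prod>b\<in>Basis. (?u - ?l) \<bullet> b) = (\<Prod>b\<in>(Basis::'a set). h)"
    by (intro prod.cong refl) (simp add: inner_diff_left, simp add: algebra_simps)
  then have p: "(\<Prod>b\<in>Basis. (?u - ?l) \<bullet> b) = h ^ DIM('a)" by simp
  have "emeasure lborel (cell h k) = ennreal (h ^ DIM('a))"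
  proof (rule antisym)
    show "emeasure lborel (cell h k) \<le> ennreal (h ^ DIM('a))"
    proof -
      have "emeasure lborel (cell h k) \<le> emeasure lborel (cbox ?l ?u)"
        by (intro emeasure_mono cell_between) simp
      also have "\<dots> = ennreal (h ^ DIM('a))" by (subst emeasure_lborel_cbox[OF le]) (simp_all add: p)
      finally show ?thesis .
    qed
    show "ennreal (h ^ DIM('a)) \<le> emeasure lborel (cell h k)"
    proof -
      have "ennreal (h ^ DIM('a)) = emeasure lborel (box ?l ?u)"
        by (subst emeasure_lborel_box[OF le]) (simp_all add: p)
      also have "\<dots> \<le> emeasure lborel (cell h k)"
        by (intro emeasure_mono cell_between) (simp add: cell_measurable)
      finally show ?thesis .
    qed
  qed
  then show ?thesis using assms by (simp add: measure_def)
qed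

text \<open>The convex case with q = h^d, D = h d and \<zeta> = (2h)^d. Dividing by the volume
  leaves the factor h^2 in front of the gradient, which makes fine grids useful.\<close>

lemma poincare_cell:
  fixes f :: "'a::euclidean_space \<Rightarrow> real"
  assumes f: "smooth_on f UNIV" and h: "0 < h"
  shows "(\<integral>x. indicator (cell h k) x * (f x)\<^sup>2 \<partial>lborel) \<le>
    inverse (h ^ DIM('a)) * (\<integral>x. indicator (cell h k) x * f x \<partial>lborel)\<^sup>2 +
    (real (DIM('a)))\<^sup>2 * 2 ^ DIM('a) * h\<^sup>2 * (\<integral>x. indicator (cell h k) x * (norm (grad f x))\<^sup>2 \<partial>lborel)"
proof -
  let ?d = "DIM('a)"
  have "(\<Prod>b\<in>Basis. (h *\<^sub>R One - - h *\<^sub>R (One::'a)) \<bullet> b) = (\<Prod>b\<in>(Basis::'a set). 2 * h)"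
    by (intro prod.cong refl) (simp add: inner_diff_left inner_add_left)
  then have Z: "emeasure lborel (cbox (- h *\<^sub>R One) (h *\<^sub>R One :: 'a)) = ennreal ((2 * h) ^ ?d)"
    using h by (subst emeasure_lborel_cbox) auto
  have "2 * h ^ ?d * (\<integral>x. indicator (cell h k) x * (f x)\<^sup>2 \<partial>lborel) \<le>
    2 * (\<integral>x. indicator (cell h k) x * f x \<partial>lborel)\<^sup>2 +
    (h * ?d)\<^sup>2 * (2 * h) ^ ?d * (\<integral>x. indicator (cell h k) x * (norm (grad f x))\<^sup>2 \<partial>lborel)"
    by (rule poincare_convex[OF f cell_measurable cell_bounded cell_convex _ Z _ _ _ measure_cell[OF h]])
      (use h cell_diff in auto)
  then show ?thesis
  proof -
    assume *: "2 * h ^ ?d * (\<integral>x. indicator (cell h k) x * (f x)\<^sup>2 \<partial>lborel) \<le>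
      2 * (\<integral>x. indicator (cell h k) x * f x \<partial>lborel)\<^sup>2 +
      (h * ?d)\<^sup>2 * (2 * h) ^ ?d * (\<integral>x. indicator (cell h k) x * (norm (grad f x))\<^sup>2 \<partial>lborel)"
    define b where "b = (\<integral>x. indicator (cell h k) x * (f x)\<^sup>2 \<partial>lborel)"
    define a where "a = (\<integral>x. indicator (cell h k) x * f x \<partial>lborel)\<^sup>2"
    define e where "e = (\<integral>x. indicator (cell h k) x * (norm (grad f x))\<^sup>2 \<partial>lborel)"
    define c where "c = h ^ ?d"
    have c: "0 < c" using h by (simp add: c_def)
    have e: "0 \<le> e" unfolding e_def by (intro integral_nonneg_AE) auto
    have "2 * c * b \<le> 2 * a + (real ?d)\<^sup>2 * 2 ^ ?d * h\<^sup>2 * e * c"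
      using * by (simp add: a_def b_def c_def e_def power_mult_distrib mult_ac)
    \<comment> \<open>A factor 2 on the gradient term is given away, so that the whole inequality
      can be halved.\<close>
    also have "\<dots> \<le> 2 * (a + (real ?d)\<^sup>2 * 2 ^ ?d * h\<^sup>2 * e * c)"
      using e c by simp
    finally have "c * b \<le> a + (real ?d)\<^sup>2 * 2 ^ ?d * h\<^sup>2 * e * c" by simp
    then have "b \<le> inverse c * a + (real ?d)\<^sup>2 * 2 ^ ?d * h\<^sup>2 * e"
      using c by (simp add: field_simps)
    then show ?thesis by (simp add: a_def b_def c_def e_def)
  qed
qed

section \<open>Norms on finite unions of cells\<close>

lemma L2_norm_sq_borel:
  fixes f :: "'a::euclidean_space \<Rightarrow> 'b::euclidean_space"
  assumes "A \<in> sets borel" "f \<in> borel_measurable borel"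
  shows "(L2_norm A f)\<^sup>2 = (\<integral>x. indicator A x * (norm (f x))\<^sup>2 \<partial>lborel)"
proof -
  have "(L2_norm A f)\<^sup>2 = (\<integral>x. indicator A x *\<^sub>R (norm (f x))\<^sup>2 \<partial>lebesgue)"
    unfolding L2_norm_sq using assms by (subst integral_restrict_space) auto
  also have "\<dots> = (\<integral>x. indicator A x *\<^sub>R (norm (f x))\<^sup>2 \<partial>lborel)"
    using assms by (intro integral_completion) auto
  finally show ?thesis by simp
qed

lemma continuous_L2_bounded:
  fixes f :: "'a::euclidean_space \<Rightarrow> 'b::euclidean_space"
  assumes f: "continuous_on UNIV f" and A: "A \<in> sets borel" "bounded A"
  shows "f \<in> L2 A"
proof -
  have [measurable]: "f \<in> borel_measurable borel" by (rule borel_measurable_continuous_onI[OF f])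
  have "integrable lborel (\<lambda>x. indicator A x * (norm (f x))\<^sup>2)"
    by (rule integrable_continuous_bounded) (intro continuous_intros f A)+
  then have "integrable lebesgue (\<lambda>x. indicator A x * (norm (f x))\<^sup>2)"
    using A by (subst integrable_completion) auto
  then have "integrable (lebesgue_on A) (\<lambda>x. (norm (f x))\<^sup>2)"
    using A by (subst integrable_restrict_space) auto
  moreover have "f \<in> borel_measurable (lebesgue_on A)"
    by (intro measurable_restrict_space1 measurable_completion) simp
  ultimately show ?thesis by (simp add: L2_def)
qed

text \<open>The cells are disjoint, so the inequality adds up. Apart from a gradient term of order
  h^2, the norm on \<open>S\<close> is governed by finitely many numbers, the cell
  integrals.\<close>

lemma poincare_grid:
  fixes f :: "'a::euclidean_space \<Rightarrow> real"
  assumes f: "smooth_on f UNIV" and h: "0 < h" and T: "finite T" "T \<subseteq> PiE Basis (\<lambda>_. UNIV)"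
  defines "S \<equiv> \<Union>k\<in>T. cell h k"
  shows "(L2_norm S f)\<^sup>2 \<le>
    inverse (h ^ DIM('a)) * (\<Sum>k\<in>T. (\<integral>x. indicator (cell h k) x * f x \<partial>lborel)\<^sup>2) +
    (real (DIM('a)))\<^sup>2 * 2 ^ DIM('a) * h\<^sup>2 * (L2_norm S (grad f))\<^sup>2"
proof -
  have S: "S \<in> sets borel" unfolding S_def using T(1) cell_measurable by (intro sets.finite_UN)
  have c: "continuous_on UNIV f" "continuous_on UNIV (grad f)"
    using f by (auto intro: smooth_on_continuous continuous_on_grad)
  have dis: "disjoint_family_on (cell h) T"
    unfolding disjoint_family_on_def
  proof (intro ballI impI)
    fix k l assume kl: "k \<in> T" "l \<in> T" "k \<noteq> l"
    show "cell h k \<inter> cell h l = {}"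
    proof (rule equals0I)
      fix x assume "x \<in> cell h k \<inter> cell h l"
      then have "cell_index h x = k" "cell_index h x = l"
        using mem_cell_iff[OF h subsetD[OF T(2) kl(1)], of x] mem_cell_iff[OF h subsetD[OF T(2) kl(2)], of x]
        by auto
      with kl(3) show False by simp
    qed
  qed
  have ind: "indicator S x = (\<Sum>k\<in>T. indicator (cell h k) x :: real)" for x
    unfolding S_def by (rule indicator_UN_disjoint[OF T(1) dis])
  have sm: "(\<integral>x. indicator S x * g x \<partial>lborel) = (\<Sum>k\<in>T. \<integral>x. indicator (cell h k) x * g x \<partial>lborel)"
    if "continuous_on UNIV g" for g :: "'a \<Rightarrow> real"
    unfolding ind sum_distrib_right
    by (intro Bochner_Integration.integral_sum integrable_continuous_bounded that cell_measurable cell_bounded)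
  have "(L2_norm S f)\<^sup>2 = (\<Sum>k\<in>T. \<integral>x. indicator (cell h k) x * (f x)\<^sup>2 \<partial>lborel)"
    using L2_norm_sq_borel[OF S borel_measurable_continuous_onI[OF c(1)]]
    by (simp add: sm continuous_on_power c)
  also have "\<dots> \<le> (\<Sum>k\<in>T. inverse (h ^ DIM('a)) * (\<integral>x. indicator (cell h k) x * f x \<partial>lborel)\<^sup>2 +
    (real (DIM('a)))\<^sup>2 * 2 ^ DIM('a) * h\<^sup>2 * (\<integral>x. indicator (cell h k) x * (norm (grad f x))\<^sup>2 \<partial>lborel))"
    by (intro sum_mono poincare_cell f h)
  also have "\<dots> = inverse (h ^ DIM('a)) * (\<Sum>k\<in>T. (\<integral>x. indicator (cell h k) x * f x \<partial>lborel)\<^sup>2) +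
    (real (DIM('a)))\<^sup>2 * 2 ^ DIM('a) * h\<^sup>2 * (\<integral>x. indicator S x * (norm (grad f x))\<^sup>2 \<partial>lborel)"
    by (subst sm) (auto simp: sum.distrib sum_distrib_left intro!: continuous_intros c)
  finally show ?thesis
    by (simp add: L2_norm_sq_borel[OF S borel_measurable_continuous_onI[OF c(2)]])
qed

subsection \<open>Local compactness\<close>

lemma finite_cell_index:
  fixes A :: "'a::euclidean_space set"
  assumes "bounded A" "0 < h"
  shows "finite (cell_index h ` A)"
proof -
  obtain R where R: "\<And>x. x \<in> A \<Longrightarrow> norm x \<le> R" using assms(1) by (auto simp: bounded_iff)
  have "cell_index h ` A \<subseteq> PiE Basis (\<lambda>_. {\<lfloor>- R / h\<rfloor>..\<lfloor>R / h\<rfloor>})"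
  proof (rule image_subsetI)
    fix x assume "x \<in> A"
    have "\<lfloor>x \<bullet> b / h\<rfloor> \<in> {\<lfloor>- R / h\<rfloor>..\<lfloor>R / h\<rfloor>}" if "b \<in> Basis" for b
    proof -
      have "\<bar>x \<bullet> b\<bar> \<le> R" using R[OF \<open>x \<in> A\<close>] Basis_le_norm[OF that, of x] by linarith
      then have "- R / h \<le> x \<bullet> b / h" "x \<bullet> b / h \<le> R / h"
        using assms(2) by (intro divide_right_mono; linarith)+
      then show ?thesis by (auto intro: floor_mono)
    qed
    then show "cell_index h x \<in> PiE Basis (\<lambda>_. {\<lfloor>- R / h\<rfloor>..\<lfloor>R / h\<rfloor>})"
      by (auto simp: cell_index_def)
  qed
  then show ?thesis by (rule finite_subset) (intro finite_PiE finite_Basis; simp)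
qed

lemma countable_cell_indices: "countable (PiE (Basis :: 'a::euclidean_space set) (\<lambda>_. UNIV :: int set))"
  by (rule countable_PiE) auto

text \<open>The mesh is chosen after the accuracy: it makes the gradient term small uniformly along
  the sequence, and on that fixed mesh only finitely many convergent cell integrals are
  left.\<close>

lemma locally_L2_Cauchy_subsequence:
  fixes W :: "nat \<Rightarrow> 'a::euclidean_space \<Rightarrow> real"
  assumes \<Omega>: "open \<Omega>" and W: "\<And>n. smooth_on (W n) UNIV"
    "\<And>n. integrable lborel (\<lambda>x. (W n x)\<^sup>2)" "\<And>n. (\<integral>x. (W n x)\<^sup>2 \<partial>lborel) \<le> B"
    and B': "0 \<le> B'"
    and gr: "\<And>K. compact K \<Longrightarrow> K \<subseteq> \<Omega> \<Longrightarrow> \<forall>\<^sub>F n in sequentially. L2_norm K (grad (W n)) \<le> B'"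
  obtains s :: "nat \<Rightarrow> nat" where "strict_mono s"
    "\<And>A e. open A \<Longrightarrow> compactly_contained A \<Omega> \<Longrightarrow> 0 < e \<Longrightarrow>
      \<exists>N. \<forall>m\<ge>N. \<forall>n\<ge>N. L2_norm A (\<lambda>x. W (s m) x - W (s n) x) < e"
proof -
  \<comment> \<open>A sequence of mesh sizes tending to 0 keeps the set of all cells countable.
    Sizes at most 1 give cells of volume at most 1, hence the common bound 1 + B on the cell
    integrals.\<close>
  define H where "H m = inverse (real (Suc m))" for m
  have H: "0 < H m" "H m \<le> 1" for m by (auto simp: H_def field_simps)
  have cW: "continuous_on UNIV (W n)" for n using W(1) by (rule smooth_on_continuous)
  have cG: "continuous_on UNIV (grad (W n))" for n using W(1) by (rule continuous_on_grad)
  \<comment> \<open>The mesh size belongs to the index \<open>p\<close>, so that one subsequence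
    serves every mesh, and thereby every accuracy and every set \<open>A\<close>.\<close>
  define a where "a n p = (\<integral>x. indicator (cell (H (fst p)) (snd p)) x * W n x \<partial>lborel)"
    for n and p :: "nat \<times> ('a \<Rightarrow> int)"
  have ai: "integrable lborel (\<lambda>x. indicator (cell h k) x * W n x)" for h k n
    by (intro integrable_continuous_bounded cW cell_measurable cell_bounded)
  have a_le: "norm (a n p) \<le> 1 + B" for n p
  proof -
    let ?Q = "cell (H (fst p)) (snd p)"
    have iQ: "integrable lborel (indicator ?Q :: 'a \<Rightarrow> real)"
      using integrable_continuous_bounded[OF continuous_on_const[of _ 1] cell_measurable cell_bounded,
          of "H (fst p)" "snd p"] by simp
    have "norm (a n p) \<le> (\<integral>x. norm (indicator ?Q x * W n x) \<partial>lborel)"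
      unfolding a_def by (rule integral_norm_bound)
    also have "\<dots> \<le> (\<integral>x. indicator ?Q x + (W n x)\<^sup>2 \<partial>lborel)"
    proof (rule integral_mono)
      show "integrable lborel (\<lambda>x. norm (indicator ?Q x * W n x))" by (intro integrable_norm ai)
      show "integrable lborel (\<lambda>x. indicator ?Q x + (W n x)\<^sup>2)" by (intro Bochner_Integration.integrable_add iQ W)
      fix x
      show "norm (indicator ?Q x * W n x) \<le> indicator ?Q x + (W n x)\<^sup>2"
        using abs_le_one_plus_sq[of "W n x"] by (auto simp: indicator_def)
    qed
    also have "\<dots> = measure lborel ?Q + (\<integral>x. (W n x)\<^sup>2 \<partial>lborel)"
      using iQ W(2) by simp
    also have "\<dots> \<le> 1 + B"
      using W(3)[of n] measure_cell[OF H(1), of "fst p" "snd p"] power_le_one[of "H (fst p)" "DIM('a)"] H[of "fst p"]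
      by linarith
    finally show ?thesis .
  qed
  have "countable (UNIV \<times> PiE Basis (\<lambda>_. UNIV) :: (nat \<times> ('a \<Rightarrow> int)) set)"
    by (intro countable_SIGMA countable_cell_indices) auto
  from function_convergent_subsequence[of _ a "1 + B", OF this a_le]
  obtain s :: "nat \<Rightarrow> nat" where s: "strict_mono s"
    and conv: "\<And>p. p \<in> UNIV \<times> PiE Basis (\<lambda>_. UNIV) \<Longrightarrow> \<exists>l. (\<lambda>n. a (s n) p) \<longlonglongrightarrow> l"
    by blast
  show ?thesis
  proof (rule that[OF s])
    fix A :: "'a set" and e :: real
    assume A: "open A" "compactly_contained A \<Omega>" and e: "0 < e"
    have Ac: "bounded A" "compact (closure A)" "closure A \<subseteq> \<Omega>" using A(2) by (auto simp: compactly_contained_def)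
    show "\<exists>N. \<forall>m\<ge>N. \<forall>n\<ge>N. L2_norm A (\<lambda>x. W (s m) x - W (s n) x) < e"
    proof (cases "A = {}")
      case True
      have "L2_norm A (\<lambda>x. W (s m) x - W (s n) x) = 0" for m n
        unfolding L2_norm_def True by (subst integral_restrict_space) auto
      then show ?thesis using e by auto
    next
      case False
      \<comment> \<open>A margin around \<open>A\<close>: cells that meet \<open>A\<close> stick out
        of it, but remain in the compact set \<open>K\<close> inside \<Omega>, on which the
        gradients are eventually bounded.\<close>
      obtain \<delta> where \<delta>: "0 < \<delta>" "(\<Union>x\<in>closure A. cball x \<delta>) \<subseteq> \<Omega>"
        using compact_subset_open_imp_cball_epsilon_subset[OF Ac(2) \<Omega> Ac(3)] by metis
      define K where "K = {x. infdist x (closure A) \<le> \<delta>}"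
      have K: "compact K" unfolding K_def using False Ac \<delta> by (intro compact_infdist_le) auto
      have K\<Omega>: "K \<subseteq> \<Omega>"
      proof
        fix x assume "x \<in> K"
        obtain y where "y \<in> closure A" "infdist x (closure A) = dist x y"
          using infdist_attains_inf[of "closure A" x] False by auto
        then have "x \<in> cball y \<delta>" "y \<in> closure A"
          using \<open>x \<in> K\<close> by (auto simp: K_def dist_commute)
        then show "x \<in> \<Omega>" using \<delta>(2) by blast
      qed
      have Kb: "K \<in> sets borel" using K by (simp add: borel_compact)
      define C0 where "C0 = (real (DIM('a)))\<^sup>2 * 2 ^ DIM('a)"
      have C0: "0 \<le> C0" by (simp add: C0_def)
      have dpos: "0 < real (DIM('a))" by simp
      have "0 < min (\<delta> / DIM('a)) (e / (4 * (1 + sqrt C0 * B')))"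
        using \<delta>(1) e C0 B' dpos by (auto intro!: divide_pos_pos mult_pos_pos add_pos_nonneg)
      \<comment> \<open>The first bound keeps the diameter of the cells below the margin \<delta>.
        The second makes the gradient term, for differences of gradient norm at most 2B', no larger
        than a quarter of the square of e.\<close>
      then obtain m0 where m0: "H m0 < min (\<delta> / DIM('a)) (e / (4 * (1 + sqrt C0 * B')))"
        unfolding H_def using reals_Archimedean by blast
      define h where "h = H m0"
      have h: "0 < h" "h * DIM('a) \<le> \<delta>" using m0 H dpos by (auto simp: h_def field_simps)
      have hC: "C0 * h\<^sup>2 * (2 * B')\<^sup>2 \<le> e\<^sup>2 / 4"
      proof -
        have p: "0 < 1 + sqrt C0 * B'" using C0 B' by (intro add_pos_nonneg) auto
        have "h * (4 * (1 + sqrt C0 * B')) < e"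
          using m0 p unfolding h_def by (simp add: pos_less_divide_eq)
        then have "2 * (sqrt C0 * h * B') \<le> e / 2" using h(1) by (simp add: algebra_simps)
        then have "(2 * (sqrt C0 * h * B'))\<^sup>2 \<le> (e / 2)\<^sup>2"
          using C0 h(1) B' by (intro power_mono) auto
        then show ?thesis using C0 by (simp add: power_mult_distrib power_divide mult_ac)
      qed
      define T where "T = cell_index h ` A"
      have T: "finite T" "T \<subseteq> PiE Basis (\<lambda>_. UNIV)"
        unfolding T_def using finite_cell_index[OF Ac(1) h(1)] cell_index_in by auto
      define S where "S = (\<Union>k\<in>T. cell h k)"
      have AS: "A \<subseteq> S" unfolding S_def T_def using mem_cell_iff[OF h(1) cell_index_in] by blast
      have Sb: "S \<in> sets borel" unfolding S_def using T(1) cell_measurable by (intro sets.finite_UN)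
      have Sbd: "bounded S" unfolding S_def using T(1) cell_bounded by blast
      have SK: "S \<subseteq> K"
      proof
        fix y assume "y \<in> S"
        then obtain x where x: "x \<in> A" "y \<in> cell h (cell_index h x)" by (auto simp: S_def T_def)
        have "x \<in> cell h (cell_index h x)" using mem_cell_iff[OF h(1) cell_index_in] by blast
        from cell_diff(1)[OF this x(2)] have "dist y x \<le> \<delta>" using h(2) by (simp add: dist_norm)
        moreover have "infdist y (closure A) \<le> dist y x" using x(1) closure_subset by (intro infdist_le) auto
        ultimately show "y \<in> K" by (simp add: K_def)
      qed
      obtain N1 where N1: "\<And>n. n \<ge> N1 \<Longrightarrow> L2_norm K (grad (W n)) \<le> B'"
        using gr[OF K K\<Omega>] by (auto simp: eventually_sequentially)
      \<comment> \<open>Solved from the requirement that the cell integrals contribute at most half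
        of the square of e; the added 1 avoids a zero denominator if \<open>T\<close> is
        empty.\<close>
      define \<eta> where "\<eta> = sqrt (e\<^sup>2 * h ^ DIM('a) / (2 * (real (card T) + 1)))"
      have \<eta>: "0 < \<eta>" unfolding \<eta>_def using e h(1) by simp
      have "\<exists>N. \<forall>m\<ge>N. \<forall>n\<ge>N. \<bar>a (s m) (m0, k) - a (s n) (m0, k)\<bar> < \<eta>" if "k \<in> T" for k
      proof -
        have "Cauchy (\<lambda>n. a (s n) (m0, k))"
          using conv[of "(m0, k)"] that T(2) by (auto intro: LIMSEQ_imp_Cauchy)
        from CauchyD[OF this \<eta>] show ?thesis by simp
      qed
      then obtain Nf where Nf: "\<And>k m n. k \<in> T \<Longrightarrow> m \<ge> Nf k \<Longrightarrow> n \<ge> Nf k \<Longrightarrow>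
          \<bar>a (s m) (m0, k) - a (s n) (m0, k)\<bar> < \<eta>" by metis
      define N where "N = max N1 (Max (insert 0 (Nf ` T)))"
      have NN: "N1 \<le> N" "\<And>k. k \<in> T \<Longrightarrow> Nf k \<le> N"
        using T(1) by (auto simp: N_def intro!: max.coboundedI2 Max_ge)
      have "L2_norm A (\<lambda>x. W (s m) x - W (s n) x) < e" if mn: "m \<ge> N" "n \<ge> N" for m n
      proof -
        let ?f = "\<lambda>x. W (s m) x - W (s n) x"
        have f: "smooth_on ?f UNIV" by (intro smooth_diff W)
        have fL: "?f \<in> L2 S" by (intro continuous_L2_bounded smooth_on_continuous[OF f] Sb Sbd)
        have sg: "s m \<ge> N1" "s n \<ge> N1"
          using mn NN(1) strict_mono_imp_increasing[OF s] by (meson order_trans)+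
        have gK: "grad (W n) \<in> L2 K" for n
          using K by (intro continuous_L2_bounded cG Kb compact_imp_bounded)
        have gS: "grad (W n) \<in> L2 S" "L2_norm S (grad (W n)) \<le> L2_norm K (grad (W n))" for n
          using L2_subset[OF gK SK] Kb Sb by auto
        have "L2_norm S (grad ?f) = L2_norm S (\<lambda>x. grad (W (s m)) x - grad (W (s n)) x)"
          by (rule arg_cong[of _ _ "L2_norm S"], rule ext, rule grad_diff[OF W(1) W(1)])
        also have "\<dots> \<le> L2_norm S (grad (W (s m))) + L2_norm S (grad (W (s n)))"
          using L2_norm_triangle[OF gS(1) L2_scaleR[OF gS(1), of "-1"], of "s m" "s n"]
            L2_norm_scaleR[of S "-1" "grad (W (s n))"] by simp
        also have "\<dots> \<le> 2 * B'" using gS(2)[of "s m"] gS(2)[of "s n"] N1[OF sg(1)] N1[OF sg(2)] by linarith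
        finally have g2: "(L2_norm S (grad ?f))\<^sup>2 \<le> (2 * B')\<^sup>2" by (intro power_mono) auto
        have "(\<integral>x. indicator (cell h k) x * ?f x \<partial>lborel) = a (s m) (m0, k) - a (s n) (m0, k)" for k
          using ai[of h k "s m"] ai[of h k "s n"] by (simp add: a_def h_def right_diff_distrib)
        then have "(\<Sum>k\<in>T. (\<integral>x. indicator (cell h k) x * ?f x \<partial>lborel)\<^sup>2) \<le> (\<Sum>k\<in>T. \<eta>\<^sup>2)"
        proof (intro sum_mono)
          fix k assume k: "k \<in> T"
          assume *: "\<And>k. (\<integral>x. indicator (cell h k) x * ?f x \<partial>lborel) = a (s m) (m0, k) - a (s n) (m0, k)"
          have "\<bar>a (s m) (m0, k) - a (s n) (m0, k)\<bar> \<le> \<eta>"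
            using Nf[OF k, of m n] NN(2)[OF k] mn by simp
          then show "(\<integral>x. indicator (cell h k) x * ?f x \<partial>lborel)\<^sup>2 \<le> \<eta>\<^sup>2"
            unfolding * using \<eta> by (intro abs_le_square_iff[THEN iffD1]) simp
        qed
        also have "\<dots> = real (card T) * \<eta>\<^sup>2" by simp
        also have "\<dots> \<le> (real (card T) + 1) * \<eta>\<^sup>2" by (intro mult_right_mono) auto
        also have "\<eta>\<^sup>2 = e\<^sup>2 * h ^ DIM('a) / (2 * (real (card T) + 1))"
          unfolding \<eta>_def using h(1) by (intro real_sqrt_pow2) auto
        also have "(real (card T) + 1) * \<dots> = e\<^sup>2 * h ^ DIM('a) / 2" by (simp add: field_simps)
        finally have "inverse (h ^ DIM('a)) * (\<Sum>k\<in>T. (\<integral>x. indicator (cell h k) x * ?f x \<partial>lborel)\<^sup>2) \<le> e\<^sup>2 / 2"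
          using h(1) by (simp add: field_simps)
        moreover have "C0 * h\<^sup>2 * (L2_norm S (grad ?f))\<^sup>2 \<le> C0 * h\<^sup>2 * (2 * B')\<^sup>2"
          using C0 by (intro mult_left_mono g2) auto
        ultimately have "(L2_norm S ?f)\<^sup>2 \<le> e\<^sup>2 / 2 + e\<^sup>2 / 4"
          using poincare_grid[OF f h(1) T, folded S_def C0_def] hC by linarith
        also have "\<dots> < e\<^sup>2" using e by simp
        finally have "L2_norm S ?f < e" using e by (simp add: power2_less_imp_less)
        moreover have "L2_norm A ?f \<le> L2_norm S ?f" using A(1) Sb by (intro L2_subset(2)[OF fL AS]) auto
        ultimately show ?thesis by simp
      qed
      then show ?thesis by blast
    qed
  qed
qed

section \<open>Inner regions, extension by zero and localisation\<close>

lemma open_inner_region: "open S \<Longrightarrow> open (inner_region S \<rho>)"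
proof (cases "frontier S = {}")
  case False
  assume "open S"
  have "inner_region S \<rho> = S \<inter> {x. \<rho> < infdist x (frontier S)}" using False by (auto simp: inner_region_def)
  moreover have "open {x. \<rho> < infdist x (frontier S)}"
    by (intro open_Collect_less continuous_intros)
  ultimately show ?thesis using \<open>open S\<close> by auto
qed (simp add: inner_region_def)

lemma inner_region_subset: "inner_region S \<rho> \<subseteq> S"
  by (auto simp: inner_region_def)

text \<open>A ball is connected: if it met \<open>S\<close> and also left it, it would contain a
  frontier point at distance less than \<rho> from its centre. An empty frontier is excluded by the
  same argument.\<close>

lemma ball_subset_of_inner_region:
  assumes "x \<in> inner_region S \<rho>" "0 < \<rho>"
  shows "ball x \<rho> \<subseteq> S"
proof (rule ccontr)
  assume "\<not> ball x \<rho> \<subseteq> S"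
  moreover have "x \<in> ball x \<rho> \<inter> S" using assms by (auto simp: inner_region_def)
  ultimately have "ball x \<rho> \<inter> frontier S \<noteq> {}"
    by (intro connected_Int_frontier connected_ball) blast+
  then obtain y where "y \<in> frontier S" "dist x y < \<rho>" by auto
  then show False using assms infdist_le[of y "frontier S" x] by (auto simp: inner_region_def)
qed

text \<open>The distance to the frontier attains a minimum on \<open>K\<close>, and it is positive
  since an open set is disjoint from its frontier.\<close>

lemma compact_subset_inner_region:
  assumes S: "open S" and K: "compact K" "K \<subseteq> S"
  obtains \<delta> where "0 < \<delta>" "\<And>\<rho>. \<rho> < \<delta> \<Longrightarrow> K \<subseteq> inner_region S \<rho>"
proof (cases "K = {} \<or> frontier S = {}")
  case True
  then show ?thesis using K by (intro that[of 1]) (auto simp: inner_region_def)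
next
  case False
  then have "\<exists>x\<in>K. \<forall>y\<in>K. infdist x (frontier S) \<le> infdist y (frontier S)"
    by (intro continuous_attains_inf K continuous_intros) auto
  then obtain x where x: "x \<in> K" "\<And>y. y \<in> K \<Longrightarrow> infdist x (frontier S) \<le> infdist y (frontier S)"
    by blast
  have "x \<notin> frontier S" using x(1) K S frontier_disjoint_eq[of S] by blast
  then have "0 < infdist x (frontier S)"
    using False infdist_pos_not_in_closed[of "frontier S" x] by simp
  then show ?thesis using x K False by (intro that) (fastforce simp: inner_region_def)+
qed

text \<open>Turns gradients that are bounded on varying subdomains into a bounded sequence on one
  fixed domain.\<close>

lemma L2_extend:
  assumes f: "f \<in> L2 B" and B: "B \<subseteq> A" "B \<in> sets lebesgue" "A \<in> sets lebesgue"
  shows "(\<lambda>x. indicator B x *\<^sub>R f x) \<in> L2 A" "L2_norm A (\<lambda>x. indicator B x *\<^sub>R f x) = L2_norm B f"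
proof -
  have e: "indicator A x *\<^sub>R (norm (indicator B x *\<^sub>R f x))\<^sup>2 = indicator B x *\<^sub>R (norm (f x))\<^sup>2"
    "(norm (indicator B x *\<^sub>R f x))\<^sup>2 = indicator B x *\<^sub>R (norm (f x))\<^sup>2" for x
    using B(1) by (auto simp: indicator_def)
  have "integrable lebesgue (\<lambda>x. indicator B x *\<^sub>R (norm (f x))\<^sup>2)"
    using L2_indicator(2)[OF f B(2)] by (simp only: e(2))
  then have "integrable (lebesgue_on A) (\<lambda>x. (norm (indicator B x *\<^sub>R f x))\<^sup>2)"
    using B(3) by (subst integrable_restrict_space) (simp_all only: e(1) Int_UNIV_right space_completion space_lborel space_borel)
  then show "(\<lambda>x. indicator B x *\<^sub>R f x) \<in> L2 A"
    using L2_indicator(1)[OF f B(2)] unfolding L2_def by (auto intro: measurable_restrict_space1)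
  show "L2_norm A (\<lambda>x. indicator B x *\<^sub>R f x) = L2_norm B f"
    unfolding L2_norm_def using B(2,3)
    by (subst (1 2) integral_restrict_space) (auto simp only: e(1) Int_UNIV_right space_completion space_lborel space_borel)
qed

lemma lborel_square_integrable_L2:
  fixes f :: "'a::euclidean_space \<Rightarrow> real"
  assumes f: "f \<in> borel_measurable borel" "integrable lborel (\<lambda>x. (f x)\<^sup>2)" and A: "A \<in> sets lebesgue"
  shows "f \<in> L2 A" "(L2_norm A f)\<^sup>2 \<le> (\<integral>x. (f x)\<^sup>2 \<partial>lborel)"
proof -
  have "integrable lebesgue (\<lambda>x. (norm (f x))\<^sup>2)" using f by (subst integrable_completion) auto
  moreover have "f \<in> borel_measurable lebesgue" using f by (intro measurable_completion) simp
  ultimately have U: "f \<in> L2 UNIV" by (simp add: L2_def lebesgue_on_UNIV_eq)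
  then show "f \<in> L2 A" using A by (intro L2_subset(1)[OF U]) auto
  have "(L2_norm A f)\<^sup>2 \<le> (L2_norm UNIV f)\<^sup>2" using A by (intro power_mono L2_subset(2)[OF U]) auto
  also have "\<dots> = (\<integral>x. (f x)\<^sup>2 \<partial>lborel)" using L2_norm_sq_borel[of UNIV f] f by simp
  finally show "(L2_norm A f)\<^sup>2 \<le> (\<integral>x. (f x)\<^sup>2 \<partial>lborel)" .
qed

lemma is_weak_gradient_cong:
  assumes "\<And>x. x \<in> A \<Longrightarrow> f x = g x" "\<And>x. x \<in> A \<Longrightarrow> F x = G x" "is_weak_gradient A f F"
  shows "is_weak_gradient A g G"
proof -
  have "(\<integral>x. f x * pd \<phi> i x \<partial>lebesgue_on A) = (\<integral>x. g x * pd \<phi> i x \<partial>lebesgue_on A)"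
    "(\<integral>x. (F x \<bullet> i) * \<phi> x \<partial>lebesgue_on A) = (\<integral>x. (G x \<bullet> i) * \<phi> x \<partial>lebesgue_on A)" for \<phi> i
    using assms(1,2) by (auto intro!: Bochner_Integration.integral_cong)
  then show ?thesis using assms(3) by (simp add: is_weak_gradient_def)
qed

text \<open>A test function is supported in a compact set, so the relation is only ever tested
  inside one of the sets \<open>U\<close>.\<close>

lemma is_weak_gradient_local:
  assumes A: "open A" and loc: "\<And>K. compact K \<Longrightarrow> K \<subseteq> A \<Longrightarrow> \<exists>U. open U \<and> K \<subseteq> U \<and> U \<subseteq> A \<and> is_weak_gradient U f G"
  shows "is_weak_gradient A f G"
  unfolding is_weak_gradient_def
proof (intro allI impI ballI)
  fix \<phi> i assume \<phi>: "test_function A \<phi>" and i: "i \<in> (Basis :: 'a set)"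
  then obtain K where K: "compact K" "K \<subseteq> A" "\<And>x. x \<notin> K \<Longrightarrow> \<phi> x = 0"
    by (auto simp: test_function_def)
  obtain U where U: "open U" "K \<subseteq> U" "U \<subseteq> A" "is_weak_gradient U f G" using loc[OF K(1,2)] by blast
  have \<phi>U: "test_function U \<phi>" using \<phi> K U unfolding test_function_def by blast
  have z: "\<phi> x = 0" "pd \<phi> i x = 0" if "x \<notin> U" for x
    using \<phi>U test_function_pd[OF \<phi>U i] that by (auto simp: test_function_def)
  have eq: "(\<integral>x. g x \<partial>lebesgue_on A) = (\<integral>x. g x \<partial>lebesgue_on U)" if "\<And>x. x \<notin> U \<Longrightarrow> g x = (0::real)" for g
  proof -
    have "indicator A x *\<^sub>R g x = indicator U x *\<^sub>R g x" for x
      using that U(3) by (auto simp: indicator_def)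
    then have "(\<integral>x. indicator A x *\<^sub>R g x \<partial>lebesgue) = (\<integral>x. indicator U x *\<^sub>R g x \<partial>lebesgue)"
      by (simp only:)
    then show ?thesis
      using A U(1) integral_restrict_space[of A lebesgue g] integral_restrict_space[of U lebesgue g] by simp
  qed
  have "(\<integral>x. f x * pd \<phi> i x \<partial>lebesgue_on A) = (\<integral>x. f x * pd \<phi> i x \<partial>lebesgue_on U)"
    by (rule eq) (simp add: z)
  also have "\<dots> = - (\<integral>x. (G x \<bullet> i) * \<phi> x \<partial>lebesgue_on U)"
    using U(4) \<phi>U i by (simp add: is_weak_gradient_def)
  also have "(\<integral>x. (G x \<bullet> i) * \<phi> x \<partial>lebesgue_on U) = (\<integral>x. (G x \<bullet> i) * \<phi> x \<partial>lebesgue_on A)"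
    by (rule eq[symmetric]) (simp add: z)
  finally show "(\<integral>x. f x * pd \<phi> i x \<partial>lebesgue_on A) = - (\<integral>x. (G x \<bullet> i) * \<phi> x \<partial>lebesgue_on A)" .
qed

subsection \<open>Proof of the theorem\<close>

text \<open>A Lebesgue measurable function agrees almost everywhere with a Borel one; applied to the
  zero extension, it yields a function on the whole space with the same norm.\<close>

lemma L2_borel_version:
  fixes u :: "'a::euclidean_space \<Rightarrow> real"
  assumes \<Omega>: "open \<Omega>" and u: "u \<in> L2 \<Omega>"
  obtains v where "v \<in> borel_measurable borel" "integrable lborel (\<lambda>x. (v x)\<^sup>2)"
    "(\<integral>x. (v x)\<^sup>2 \<partial>lborel) = (L2_norm \<Omega> u)\<^sup>2" "AE x in lborel. x \<in> \<Omega> \<longrightarrow> u x = v x"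
proof -
  have \<Omega>s: "\<Omega> \<in> sets lebesgue" "\<Omega> \<in> sets borel" using \<Omega> by auto
  let ?f = "\<lambda>x. indicator \<Omega> x *\<^sub>R u x"
  have f: "?f \<in> borel_measurable lebesgue" "integrable lebesgue (\<lambda>x. (norm (?f x))\<^sup>2)"
    using L2_indicator[OF u \<Omega>s(1)] by auto
  obtain v where v [measurable]: "v \<in> borel_measurable borel" and ae: "AE x in lborel. ?f x = v x"
    using completion_ex_borel_measurable_real[of ?f lborel] f(1) by auto
  have ae': "AE x in lebesgue. (norm (?f x))\<^sup>2 = (v x)\<^sup>2"
    using AE_completion[OF ae] by eventually_elim (metis power2_abs real_norm_def)
  have vm: "(\<lambda>x. (v x)\<^sup>2) \<in> borel_measurable lebesgue" by (intro measurable_completion) simp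
  have "integrable lebesgue (\<lambda>x. (v x)\<^sup>2)"
    using f(2) integrable_cong_AE[OF borel_measurable_integrable[OF f(2)] vm ae'] by simp
  then have i: "integrable lborel (\<lambda>x. (v x)\<^sup>2)" by (subst (asm) integrable_completion) auto
  have "(L2_norm \<Omega> u)\<^sup>2 = (\<integral>x. (norm (?f x))\<^sup>2 \<partial>lebesgue)"
    unfolding L2_norm_sq using \<Omega>s(1)
    by (subst integral_restrict_space) (auto simp: indicator_def intro!: Bochner_Integration.integral_cong)
  also have "\<dots> = (\<integral>x. (v x)\<^sup>2 \<partial>lebesgue)"
    by (rule integral_cong_AE[OF borel_measurable_integrable[OF f(2)] vm ae'])
  also have "\<dots> = (\<integral>x. (v x)\<^sup>2 \<partial>lborel)" by (rule integral_completion) simp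
  finally have n: "(\<integral>x. (v x)\<^sup>2 \<partial>lborel) = (L2_norm \<Omega> u)\<^sup>2" by simp
  have "AE x in lborel. x \<in> \<Omega> \<longrightarrow> u x = v x" using ae by eventually_elim auto
  from that[OF v i n this] show ?thesis .
qed

lemma nn_integral_lebesgue_on_le:
  fixes F :: "'a::euclidean_space \<Rightarrow> ennreal"
  assumes A: "A \<in> sets borel" and I [measurable]: "I \<in> borel_measurable borel"
    and le: "AE x in lborel. x \<in> A \<longrightarrow> F x \<le> ennreal c * I x"
    and M: "(\<integral>\<^sup>+x. I x * indicator A x \<partial>lborel) \<le> ennreal M" and pos: "0 \<le> c" "0 \<le> M"
  shows "(\<integral>\<^sup>+x. F x \<partial>lebesgue_on A) \<le> ennreal (c * M)"
proof -
  have [measurable]: "A \<in> sets borel" by (rule A)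
  have "(\<integral>\<^sup>+x. F x \<partial>lebesgue_on A) = (\<integral>\<^sup>+x. F x * indicator A x \<partial>lborel)"
    by (rule nn_integral_lebesgue_on[OF A])
  also have "\<dots> \<le> (\<integral>\<^sup>+x. ennreal c * (I x * indicator A x) \<partial>lborel)"
    by (rule nn_integral_mono_AE) (use le in eventually_elim, auto simp: indicator_def)
  also have "\<dots> = ennreal c * (\<integral>\<^sup>+x. I x * indicator A x \<partial>lborel)" by (rule nn_integral_cmult) measurable
  also have "\<dots> \<le> ennreal c * ennreal M" using M by (intro mult_left_mono) auto
  finally show ?thesis using pos by (simp add: ennreal_mult)
qed

lemma mollified_family:
  fixes \<Omega> :: "'a::euclidean_space set" and k r :: real
  assumes \<Omega>: "open \<Omega>" and r: "0 < r" "r \<le> k"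
  obtains C where "0 < C"
    "\<And>u \<epsilon> M. \<lbrakk>u \<in> L2 \<Omega>; 0 < \<epsilon>; 0 \<le> M;
       (\<integral>\<^sup>+ x. (\<integral>\<^sup>+ \<xi>. ennreal (\<bar>(u (x + \<epsilon> *\<^sub>R \<xi>) - u x) / \<epsilon>\<bar>\<^sup>2) \<partial>lebesgue_on (ball 0 r))
          \<partial>lebesgue_on (inner_region \<Omega> (k * \<epsilon>))) \<le> ennreal M\<rbrakk> \<Longrightarrow>
      \<exists>w. smooth_on w UNIV \<and> integrable lborel (\<lambda>x. (w x)\<^sup>2) \<and>
        (\<integral>x. (w x)\<^sup>2 \<partial>lborel) \<le> (C * L2_norm \<Omega> u)\<^sup>2 \<and>
        L2_norm (inner_region \<Omega> (k * \<epsilon>)) (\<lambda>x. u x - w x) \<le> C * sqrt M * \<epsilon> \<and>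
        grad w \<in> L2 (inner_region \<Omega> (k * \<epsilon>)) \<and>
        L2_norm (inner_region \<Omega> (k * \<epsilon>)) (grad w) \<le> C * sqrt M"
proof -
  obtain \<rho> :: "'a \<Rightarrow> real" where \<rho>: "test_function (ball 0 r) \<rho>" "(\<integral>x. \<rho> x \<partial>lborel) = 1"
    using exists_mollifier[OF r(1)] by metis
  have \<rho>U: "test_function UNIV \<rho>" by (rule test_function_UNIV[OF \<rho>(1)])
  obtain D where D: "0 < D"
    "\<And>u \<epsilon> x. \<lbrakk>u \<in> borel_measurable borel; integrable lborel (\<lambda>x. (u x)\<^sup>2); 0 < \<epsilon>\<rbrakk> \<Longrightarrow>
       ennreal ((u x - conv (scaled \<epsilon> \<rho>) u x)\<^sup>2) \<le>
       ennreal (D * \<epsilon>\<^sup>2) * sq_increments r \<epsilon> u x"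
    "\<And>u \<epsilon> x. \<lbrakk>u \<in> borel_measurable borel; integrable lborel (\<lambda>x. (u x)\<^sup>2); 0 < \<epsilon>\<rbrakk> \<Longrightarrow>
       ennreal ((norm (grad (conv (scaled \<epsilon> \<rho>) u) x))\<^sup>2) \<le>
       ennreal D * sq_increments r \<epsilon> u x"
    "\<And>u \<epsilon> x. \<lbrakk>u \<in> borel_measurable borel; integrable lborel (\<lambda>x. (u x)\<^sup>2); 0 < \<epsilon>\<rbrakk> \<Longrightarrow>
       ennreal ((conv (scaled \<epsilon> \<rho>) u x)\<^sup>2) \<le>
       ennreal D * (\<integral>\<^sup>+z. ennreal ((u (x + \<epsilon> *\<^sub>R z))\<^sup>2) * indicator (ball 0 r) z \<partial>lborel)"
    by (rule mollifier_estimates[OF \<rho>]) blast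
  define b where "b = measure lborel (ball (0::'a) r)"
  have b: "0 \<le> b" "emeasure lborel (ball (0::'a) r) = ennreal b"
    using emeasure_eq_ennreal_measure[OF less_imp_neq[OF emeasure_lborel_ball_finite[of "0::'a" r, unfolded infinity_ennreal_def]]]
    by (auto simp: b_def)
  \<comment> \<open>The root of D covers the distance to \<open>u\<close> and the gradient, the root
    of D b covers the norm on the whole space.\<close>
  define C where "C = 1 + sqrt D + sqrt (D * b)"
  have C: "0 < C" "sqrt D \<le> C" "sqrt (D * b) \<le> C"
    using D(1) b(1) by (auto simp: C_def intro!: add_pos_nonneg)
  have DC: "D \<le> C\<^sup>2" "D * b \<le> C\<^sup>2"
    using power_mono[OF C(2), of 2] power_mono[OF C(3), of 2] D(1) b(1) by auto
  show ?thesis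
  proof (rule that[OF C(1)])
    fix u :: "'a \<Rightarrow> real" and \<epsilon> M :: real
    let ?A = "inner_region \<Omega> (k * \<epsilon>)"
    assume u: "u \<in> L2 \<Omega>" and \<epsilon>: "0 < \<epsilon>" and M: "0 \<le> M"
      and hyp: "(\<integral>\<^sup>+ x. (\<integral>\<^sup>+ \<xi>. ennreal (\<bar>(u (x + \<epsilon> *\<^sub>R \<xi>) - u x) / \<epsilon>\<bar>\<^sup>2) \<partial>lebesgue_on (ball 0 r))
          \<partial>lebesgue_on ?A) \<le> ennreal M"
    have A: "open ?A" by (rule open_inner_region[OF \<Omega>])
    have As: "?A \<in> sets borel" "?A \<in> sets lebesgue" using A by auto
    obtain v where v: "v \<in> borel_measurable borel" "integrable lborel (\<lambda>x. (v x)\<^sup>2)"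
      "(\<integral>x. (v x)\<^sup>2 \<partial>lborel) = (L2_norm \<Omega> u)\<^sup>2" and ae: "AE x in lborel. x \<in> \<Omega> \<longrightarrow> u x = v x"
      by (rule L2_borel_version[OF \<Omega> u]) (rule that; assumption)
    note [measurable] = v(1)
    define w where "w = conv (scaled \<epsilon> \<rho>) v"
    have ws: "smooth_on w UNIV" unfolding w_def
      by (intro smooth_conv test_function_scaled \<rho>U \<epsilon> locally_integrable_square_integrable v)
    have [measurable]: "w \<in> borel_measurable borel" "grad w \<in> borel_measurable borel"
      by (intro borel_measurable_continuous_onI smooth_on_continuous continuous_on_grad ws)+
    \<comment> \<open>Within the integrand the ball goes by an opaque name, known to the
      measurability prover as a Borel set.\<close>
    obtain B where B: "B = ball (0::'a) r" by blast
    have [measurable]: "B \<in> sets borel" by (simp add: B)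
    define I where "I x = (\<integral>\<^sup>+z. ennreal (((v (x + \<epsilon> *\<^sub>R z) - v x) / \<epsilon>)\<^sup>2) * indicator B z \<partial>lborel)" for x
    have Im: "I \<in> borel_measurable borel" unfolding I_def[abs_def] by measurable
    have "(\<integral>\<^sup>+x. I x * indicator ?A x \<partial>lborel) =
      (\<integral>\<^sup>+x. (\<integral>\<^sup>+ \<xi>. ennreal (\<bar>(u (x + \<epsilon> *\<^sub>R \<xi>) - u x) / \<epsilon>\<bar>\<^sup>2) \<partial>lebesgue_on (ball 0 r)) * indicator ?A x \<partial>lborel)"
    \<comment> \<open>Two exceptional sets occur: x has to be a point where \<open>u\<close> and
      \<open>v\<close> agree, and for such x the point x + \<epsilon>\<xi> has to be one for almost
      every \<xi>.\<close>
    proof (rule nn_integral_cong_AE)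
      show "AE x in lborel. I x * indicator ?A x =
        (\<integral>\<^sup>+ \<xi>. ennreal (\<bar>(u (x + \<epsilon> *\<^sub>R \<xi>) - u x) / \<epsilon>\<bar>\<^sup>2) \<partial>lebesgue_on (ball 0 r)) * indicator ?A x"
        using ae
      proof eventually_elim
        case (elim x)
        show ?case
        proof (cases "x \<in> ?A")
          case True
          then have ux: "u x = v x" using elim inner_region_subset by blast
          have "(\<integral>\<^sup>+ \<xi>. ennreal (\<bar>(u (x + \<epsilon> *\<^sub>R \<xi>) - u x) / \<epsilon>\<bar>\<^sup>2) \<partial>lebesgue_on (ball 0 r)) =
             (\<integral>\<^sup>+ \<xi>. ennreal (\<bar>(u (x + \<epsilon> *\<^sub>R \<xi>) - u x) / \<epsilon>\<bar>\<^sup>2) * indicator (ball 0 r) \<xi> \<partial>lborel)"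
            by (rule nn_integral_lebesgue_on) simp
          also have "\<dots> = I x" unfolding I_def
          proof (rule nn_integral_cong_AE)
            show "AE \<xi> in lborel. ennreal (\<bar>(u (x + \<epsilon> *\<^sub>R \<xi>) - u x) / \<epsilon>\<bar>\<^sup>2) * indicator (ball 0 r) \<xi> =
              ennreal (((v (x + \<epsilon> *\<^sub>R \<xi>) - v x) / \<epsilon>)\<^sup>2) * indicator B \<xi>"
              using lborel_AE_affine[OF ae \<epsilon>, of x]
            proof eventually_elim
              case (elim \<xi>)
              \<comment> \<open>Here r \<le> k enters: the displacement is shorter than k\<epsilon>,
                and the ball of that radius about a point of the inner region lies in
                \<Omega>.\<close>
              have "x + \<epsilon> *\<^sub>R \<xi> \<in> \<Omega>" if "\<xi> \<in> ball 0 r"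
              proof -
                have "\<epsilon> * norm \<xi> < \<epsilon> * k" using that \<epsilon> r by (intro mult_strict_left_mono) auto
                then have "x + \<epsilon> *\<^sub>R \<xi> \<in> ball x (k * \<epsilon>)" using \<epsilon> by (simp add: dist_norm mult.commute)
                then show ?thesis
                  using ball_subset_of_inner_region[OF True] \<epsilon> r by auto
              qed
              then show ?case using elim ux by (auto simp: B indicator_def simp del: abs_divide)
            qed
          qed
          finally show ?thesis by simp
        qed simp
      qed
    qed
    also have "\<dots> \<le> ennreal M"
      using hyp by (simp only: nn_integral_lebesgue_on[OF As(1)])
    finally have IM: "(\<integral>\<^sup>+x. I x * indicator ?A x \<partial>lborel) \<le> ennreal M" .
    have "(\<integral>\<^sup>+x. ennreal ((w x)\<^sup>2) \<partial>lborel) \<le>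
        ennreal D * (emeasure lborel (ball (0::'a) r) * (\<integral>\<^sup>+x. ennreal ((v x)\<^sup>2) \<partial>lborel))"
      unfolding w_def by (rule conv_scaled_L2_bound[OF _ v(1) \<epsilon>]) (auto intro: D(4)[OF v(1,2) \<epsilon>])
    also have "(\<integral>\<^sup>+x. ennreal ((v x)\<^sup>2) \<partial>lborel) = ennreal ((L2_norm \<Omega> u)\<^sup>2)"
      using nn_integral_eq_integral[OF v(2)] v(3) by simp
    also have "ennreal D * (emeasure lborel (ball (0::'a) r) * \<dots>) = ennreal (D * (b * (L2_norm \<Omega> u)\<^sup>2))"
      using D(1) b by (simp add: ennreal_mult)
    also have "\<dots> \<le> ennreal ((C * L2_norm \<Omega> u)\<^sup>2)"
      using mult_right_mono[OF DC(2), of "(L2_norm \<Omega> u)\<^sup>2"]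
      by (intro ennreal_leI) (simp add: power_mult_distrib mult.assoc)
    finally have wn: "(\<integral>\<^sup>+x. ennreal ((w x)\<^sup>2) \<partial>lborel) \<le> ennreal ((C * L2_norm \<Omega> u)\<^sup>2)" .
    then have wi: "integrable lborel (\<lambda>x. (w x)\<^sup>2)"
      by (intro integrableI_nonneg) (auto intro: order_le_less_trans[OF _ ennreal_less_top])
    have "ennreal (\<integral>x. (w x)\<^sup>2 \<partial>lborel) \<le> ennreal ((C * L2_norm \<Omega> u)\<^sup>2)"
      using wn nn_integral_eq_integral[OF wi] by simp
    then have wI: "(\<integral>x. (w x)\<^sup>2 \<partial>lborel) \<le> (C * L2_norm \<Omega> u)\<^sup>2" by simp
    have uA: "u \<in> L2 ?A" using L2_subset(1)[OF u inner_region_subset] \<Omega> As by auto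
    have wA: "w \<in> L2 ?A" by (rule lborel_square_integrable_L2(1)) (use wi As in auto)
    have "(\<integral>\<^sup>+x. ennreal ((norm (u x - w x))\<^sup>2) \<partial>lebesgue_on ?A) \<le> ennreal (D * \<epsilon>\<^sup>2 * M)"
    proof (rule nn_integral_lebesgue_on_le[OF As(1) Im _ IM])
      show "AE x in lborel. x \<in> ?A \<longrightarrow> ennreal ((norm (u x - w x))\<^sup>2) \<le> ennreal (D * \<epsilon>\<^sup>2) * I x"
        using ae
      proof eventually_elim
        case (elim x)
        then show ?case using D(2)[OF v(1,2) \<epsilon>, of x] inner_region_subset[of \<Omega> "k * \<epsilon>"]
          by (auto simp: w_def I_def B)
      qed
    qed (use D(1) M in auto)
    also have "\<dots> \<le> ennreal ((C * sqrt M * \<epsilon>)\<^sup>2)"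
    proof (rule ennreal_leI)
      show "D * \<epsilon>\<^sup>2 * M \<le> (C * sqrt M * \<epsilon>)\<^sup>2"
        using mult_right_mono[OF DC(1), of "\<epsilon>\<^sup>2 * M"] M by (simp add: power_mult_distrib mult_ac)
    qed
    finally have uw: "L2_norm ?A (\<lambda>x. u x - w x) \<le> C * sqrt M * \<epsilon>"
      using L2_D(1)[OF L2_diff[OF uA wA]] C(1) M \<epsilon> by (intro L2_nn_integralI(2)) auto
    have "(\<integral>\<^sup>+x. ennreal ((norm (grad w x))\<^sup>2) \<partial>lebesgue_on ?A) \<le> ennreal (D * M)"
      by (rule nn_integral_lebesgue_on_le[OF As(1) Im _ IM])
        (use D(1) M D(3)[OF v(1,2) \<epsilon>] in \<open>auto simp: w_def I_def B\<close>)
    also have "\<dots> \<le> ennreal ((C * sqrt M)\<^sup>2)"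
      using mult_right_mono[OF DC(1), of M] M by (intro ennreal_leI) (simp add: power_mult_distrib)
    finally have g: "(\<integral>\<^sup>+x. ennreal ((norm (grad w x))\<^sup>2) \<partial>lebesgue_on ?A) \<le> ennreal ((C * sqrt M)\<^sup>2)" .
    have gm: "grad w \<in> borel_measurable (lebesgue_on ?A)"
      by (intro measurable_restrict_space1 measurable_completion) simp
    have cM: "0 \<le> C * sqrt M" using C(1) M by simp
    show "\<exists>w. smooth_on w UNIV \<and> integrable lborel (\<lambda>x. (w x)\<^sup>2) \<and>
        (\<integral>x. (w x)\<^sup>2 \<partial>lborel) \<le> (C * L2_norm \<Omega> u)\<^sup>2 \<and>
        L2_norm ?A (\<lambda>x. u x - w x) \<le> C * sqrt M * \<epsilon> \<and>
        grad w \<in> L2 ?A \<and> L2_norm ?A (grad w) \<le> C * sqrt M"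
      using ws wi wI uw L2_nn_integralI[OF gm cM g] by blast
  qed
qed

lemma smooth_H1:
  fixes w :: "'a::euclidean_space \<Rightarrow> real"
  assumes A: "open A" and w: "smooth_on w UNIV" "w \<in> L2 A" "grad w \<in> L2 A"
  shows "w \<in> H1 A" "H1_norm A w \<le> L2_norm A w + L2_norm A (grad w)"
proof -
  have g: "is_weak_gradient A w (grad w)" by (rule smooth_is_weak_gradient[OF w(1) A])
  show "w \<in> H1 A" by (rule H1_I[OF w(2,3) g])
  show "H1_norm A w \<le> L2_norm A w + L2_norm A (grad w)"
    unfolding H1_norm_eq[OF A w(2,3) g] L2_norm_Pair[OF w(2,3)] by (rule sqrt_sum_squares_le_sum) auto
qed

text \<open>The limit appears twice: as the limit on \<Omega> of hull elements, which places it in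
  H^1 of \<Omega>, and as the limit of the Cauchy subsequence on compactly contained sets. Nearness
  of the hull to its generators shows that the two agree.\<close>

lemma subsequence_convergence:
  fixes W :: "nat \<Rightarrow> 'a::euclidean_space \<Rightarrow> real" and A :: "nat \<Rightarrow> 'a set"
  assumes \<Omega>: "open \<Omega>" and W: "\<And>n. smooth_on (W n) UNIV"
    "\<And>n. integrable lborel (\<lambda>x. (W n x)\<^sup>2)" "\<And>n. (\<integral>x. (W n x)\<^sup>2 \<partial>lborel) \<le> B\<^sup>2"
    and B: "0 \<le> B"
    and A: "\<And>n. open (A n)" "\<And>n. A n \<subseteq> \<Omega>"
    and gr: "\<And>n. grad (W n) \<in> L2 (A n)" "\<And>n. L2_norm (A n) (grad (W n)) \<le> B"
    and ex: "\<And>K. compact K \<Longrightarrow> K \<subseteq> \<Omega> \<Longrightarrow>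
      \<exists>U. open U \<and> K \<subseteq> U \<and> U \<subseteq> \<Omega> \<and> (\<forall>\<^sub>F n in sequentially. U \<subseteq> A n)"
  obtains s :: "nat \<Rightarrow> nat" and v where "strict_mono s" "v \<in> H1 \<Omega>"
    "\<And>D. open D \<Longrightarrow> compactly_contained D \<Omega> \<Longrightarrow> L2_strong_conv D (\<lambda>n. W (s n)) v"
    "\<And>D. open D \<Longrightarrow> compactly_contained D \<Omega> \<Longrightarrow> H1_weak_conv D (\<lambda>n. W (s n)) v"
proof -
  have \<Omega>s: "\<Omega> \<in> sets lebesgue" and As: "A n \<in> sets lebesgue" for n using \<Omega> A by auto
  have Wb: "W n \<in> borel_measurable borel" for n
    by (intro borel_measurable_continuous_onI smooth_on_continuous W)
  have WL: "W n \<in> L2 D" "L2_norm D (W n) \<le> B" if "D \<in> sets lebesgue" for n D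
  proof -
    show "W n \<in> L2 D" by (rule lborel_square_integrable_L2(1)[OF Wb W(2) that])
    have "(L2_norm D (W n))\<^sup>2 \<le> B\<^sup>2"
      using lborel_square_integrable_L2(2)[OF Wb W(2) that] W(3)[of n] by (rule order_trans)
    then show "L2_norm D (W n) \<le> B" using B by (rule power2_le_imp_le)
  qed
  have grD: "grad (W n) \<in> L2 D" "L2_norm D (grad (W n)) \<le> B" if "D \<subseteq> A n" "D \<in> sets lebesgue" for n D
    using L2_subset[OF gr(1) that(1) As that(2)] gr(2)[of n] by auto
  have grK: "\<forall>\<^sub>F n in sequentially. L2_norm K (grad (W n)) \<le> B" if "compact K" "K \<subseteq> \<Omega>" for K
  proof -
    obtain U where "K \<subseteq> U" "\<forall>\<^sub>F n in sequentially. U \<subseteq> A n" using ex[OF \<open>compact K\<close> \<open>K \<subseteq> \<Omega>\<close>] by blast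
    from this(2) show ?thesis
      by eventually_elim (use \<open>K \<subseteq> U\<close> \<open>compact K\<close> in \<open>intro grD(2), auto simp: borel_compact\<close>)
  qed
  obtain s :: "nat \<Rightarrow> nat" where s: "strict_mono s"
    and cau: "\<And>D e. open D \<Longrightarrow> compactly_contained D \<Omega> \<Longrightarrow> 0 < e \<Longrightarrow>
      \<exists>N. \<forall>m\<ge>N. \<forall>n\<ge>N. L2_norm D (\<lambda>x. W (s m) x - W (s n) x) < e"
    by (rule locally_L2_Cauchy_subsequence[OF \<Omega> W B]) (erule (1) grK, (rule that; assumption))
  \<comment> \<open>The gradient is known on \<open>A (s n)\<close> only and is cut off outside, so
    that the pairs are bounded on \<Omega>. The second component is the true gradient on a fixed
    \<open>U\<close> once \<open>A (s n)\<close> contains it.\<close>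
  define F where "F n x = (W (s n) x, indicator (A (s n)) x *\<^sub>R grad (W (s n)) x)" for n x
  have F: "F n \<in> L2 \<Omega>" "L2_norm \<Omega> (F n) \<le> 2 * B" for n
  proof -
    note g = L2_extend[OF gr(1) A(2) As \<Omega>s, of "s n"]
    show "F n \<in> L2 \<Omega>" unfolding F_def[abs_def] by (intro L2_Pair WL \<Omega>s g)
    have "L2_norm \<Omega> (F n) \<le> L2_norm \<Omega> (W (s n)) +
        L2_norm \<Omega> (\<lambda>x. indicator (A (s n)) x *\<^sub>R grad (W (s n)) x)"
      unfolding F_def[abs_def] L2_norm_Pair[OF WL(1)[OF \<Omega>s] g(1)] by (rule sqrt_sum_squares_le_sum) auto
    then show "L2_norm \<Omega> (F n) \<le> 2 * B" using g(2) gr(2)[of "s n"] WL(2)[OF \<Omega>s, of "s n"] by linarith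
  qed
  obtain y H where y: "\<And>m. y m \<in> tail_hull F m" "\<And>m. y m \<in> L2 \<Omega>" and H: "H \<in> L2 \<Omega>"
    and yH: "(\<lambda>m. L2_norm \<Omega> (\<lambda>x. y m x - H x)) \<longlonglongrightarrow> 0"
    by (rule tail_hull_converges[where F = F, OF F]) (rule that; assumption)
  define v where "v x = fst (H x)" for x
  have vL: "v \<in> L2 \<Omega>" unfolding v_def[abs_def] by (rule L2_fst[OF H])
  have evA: "\<forall>\<^sub>F n in sequentially. U \<subseteq> A (s n)" if "\<forall>\<^sub>F n in sequentially. U \<subseteq> A n" for U
    using that s by (rule eventually_subseq[rotated])
  have "is_weak_gradient \<Omega> v (\<lambda>x. snd (H x))"
  proof (rule is_weak_gradient_local[OF \<Omega>])
    fix K assume "compact K" "K \<subseteq> \<Omega>"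
    then obtain U where U: "open U" "K \<subseteq> U" "U \<subseteq> \<Omega>" "\<forall>\<^sub>F n in sequentially. U \<subseteq> A n" using ex by blast
    then have Us: "U \<in> sets lebesgue" by simp
    obtain N where N: "\<And>n. n \<ge> N \<Longrightarrow> U \<subseteq> A (s n)" using evA[OF U(4)] by (auto simp: eventually_sequentially)
    have FU: "F n \<in> L2 U" for n by (rule L2_subset(1)[OF F(1) U(3) \<Omega>s Us])
    have Fw: "is_weak_gradient U (\<lambda>x. fst (F n x)) (\<lambda>x. snd (F n x))" if "n \<ge> N" for n
      by (rule is_weak_gradient_cong[OF _ _ smooth_is_weak_gradient[OF W(1)[of "s n"] U(1)]])
        (use N[OF that] in \<open>auto simp: F_def indicator_def\<close>)
    have "is_weak_gradient U (\<lambda>x. fst (H x)) (\<lambda>x. snd (H x))"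
    \<comment> \<open>The shift by \<open>N\<close> leaves hull elements built solely from pairs
      whose second component is the gradient on \<open>U\<close>.\<close>
    proof (rule is_weak_gradient_limit[where y = "\<lambda>m. y (m + N)", OF U(1)])
      show "y (m + N) \<in> L2 U" for m by (rule L2_subset(1)[OF y(2) U(3) \<Omega>s Us])
      show "is_weak_gradient U (\<lambda>x. fst (y (m + N) x)) (\<lambda>x. snd (y (m + N) x))" for m
        by (rule tail_hull_weak_gradient[OF U(1) FU _ y(1)]) (rule Fw, simp)
      show "H \<in> L2 U" by (rule L2_subset(1)[OF H U(3) \<Omega>s Us])
      show "(\<lambda>m. L2_norm U (\<lambda>x. y (m + N) x - H x)) \<longlonglongrightarrow> 0"
      proof (rule Lim_null_comparison[OF _ LIMSEQ_ignore_initial_segment[OF yH, of N]])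
        show "\<forall>\<^sub>F m in sequentially. norm (L2_norm U (\<lambda>x. y (m + N) x - H x)) \<le>
            L2_norm \<Omega> (\<lambda>x. y (m + N) x - H x)"
          using L2_subset(2)[OF L2_diff[OF y(2) H] U(3) \<Omega>s Us] by simp
      qed
    qed
    then show "\<exists>U. open U \<and> K \<subseteq> U \<and> U \<subseteq> \<Omega> \<and> is_weak_gradient U v (\<lambda>x. snd (H x))"
      using U unfolding v_def by blast
  qed
  then have vH: "v \<in> H1 \<Omega>" by (rule H1_I[OF vL L2_snd[OF H]])
  have conv: "(\<lambda>n. L2_norm D (\<lambda>x. W (s n) x - v x)) \<longlonglongrightarrow> 0" if D: "open D" "compactly_contained D \<Omega>" for D
  proof (rule LIMSEQ_I)
    fix e :: real assume e: "0 < e"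
    have Ds: "D \<in> sets lebesgue" using D by simp
    have D\<Omega>: "D \<subseteq> \<Omega>" using D(2) closure_subset by (fastforce simp: compactly_contained_def)
    have vD: "v \<in> L2 D" by (rule L2_subset(1)[OF vL D\<Omega> \<Omega>s Ds])
    obtain N where N: "\<And>m n. m \<ge> N \<Longrightarrow> n \<ge> N \<Longrightarrow> L2_norm D (\<lambda>x. W (s m) x - W (s n) x) < e / 2"
      using cau[OF D, of "e / 2"] e by auto
    \<comment> \<open>For m \<ge> N the element \<open>y m\<close> is built from functions within
      e/2 of \<open>W (s n)\<close> on \<open>D\<close>, so it is equally close; letting m tend to
      infinity replaces it by \<open>v\<close>.\<close>
    have "L2_norm D (\<lambda>x. W (s n) x - v x) \<le> e / 2" if n: "n \<ge> N" for n
    proof (rule LIMSEQ_le_const)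
      show "(\<lambda>m. e / 2 + L2_norm \<Omega> (\<lambda>x. y m x - H x)) \<longlonglongrightarrow> e / 2"
        using tendsto_add[OF tendsto_const yH, of "e / 2"] by simp
      have "L2_norm D (\<lambda>x. W (s n) x - v x) \<le> e / 2 + L2_norm \<Omega> (\<lambda>x. y m x - H x)" if m: "m \<ge> N" for m
      proof -
        have yD: "(\<lambda>x. fst (y m x)) \<in> L2 D" by (intro L2_fst L2_subset(1)[OF y(2) D\<Omega> \<Omega>s Ds])
        have "L2_norm D (\<lambda>x. fst (y m x) - W (s n) x) \<le> e / 2"
          using m n N
          by (intro tail_hull_fst_near[OF y(1) F(1) WL(1)[OF Ds] D\<Omega> \<Omega>s Ds]) (auto simp: F_def less_imp_le)
        moreover have "L2_norm D (\<lambda>x. fst (y m x) - v x) \<le> L2_norm \<Omega> (\<lambda>x. fst (y m x) - v x)"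
          by (intro L2_subset(2)[OF L2_diff[OF L2_fst[OF y(2)] vL] D\<Omega> \<Omega>s Ds])
        moreover have "L2_norm \<Omega> (\<lambda>x. fst (y m x) - v x) \<le> L2_norm \<Omega> (\<lambda>x. y m x - H x)"
          by (rule L2_norm_mono[OF L2_diff[OF y(2) H] L2_diff[OF L2_fst[OF y(2)] vL]])
            (metis fst_diff norm_fst_le' v_def)
        ultimately show ?thesis
          using L2_norm_diff_triangle[OF WL(1)[OF Ds, of "s n"] yD vD]
            L2_norm_minus_commute[of D "W (s n)" "\<lambda>x. fst (y m x)"] by linarith
      qed
      then show "\<exists>N. \<forall>m\<ge>N. L2_norm D (\<lambda>x. W (s n) x - v x) \<le> e / 2 + L2_norm \<Omega> (\<lambda>x. y m x - H x)"
        by blast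
    qed
    then show "\<exists>no. \<forall>n\<ge>no. norm (L2_norm D (\<lambda>x. W (s n) x - v x) - 0) < e"
      using e by (intro exI[of _ N]) fastforce
  qed
  show ?thesis
  proof (rule that[OF s vH])
    fix D :: "'a set" assume D: "open D" "compactly_contained D \<Omega>"
    have Ds: "D \<in> sets lebesgue" using D by simp
    have D\<Omega>: "D \<subseteq> \<Omega>" using D(2) closure_subset by (fastforce simp: compactly_contained_def)
    have vD: "v \<in> L2 D" by (rule L2_subset(1)[OF vL D\<Omega> \<Omega>s Ds])
    show "L2_strong_conv D (\<lambda>n. W (s n)) v"
      unfolding L2_strong_conv_def using WL(1)[OF Ds] vD conv[OF D] by simp
    have "compact (closure D)" "closure D \<subseteq> \<Omega>" using D(2) by (auto simp: compactly_contained_def)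
    then obtain U where U: "closure D \<subseteq> U" "\<forall>\<^sub>F n in sequentially. U \<subseteq> A n" using ex by blast
    obtain N where "\<And>n. n \<ge> N \<Longrightarrow> U \<subseteq> A (s n)" using evA[OF U(2)] by (auto simp: eventually_sequentially)
    then have DN: "D \<subseteq> A (s (n + N))" for n using U(1) closure_subset by (meson le_add2 order_trans)
    \<comment> \<open>From index \<open>N\<close> on the domains contain \<open>D\<close>. The
      shifted sequence has gradient bounds at every index, and dropping an initial segment does not
      affect the limit.\<close>
    have "H1_weak_conv D (\<lambda>n. W (s (n + N))) v"
    proof (rule H1_weak_convI[where g = "\<lambda>n. grad (W (s (n + N)))" and B = "2 * B", OF D(1)])
      fix n
      show "W (s (n + N)) \<in> L2 D" "grad (W (s (n + N))) \<in> L2 D"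
        by (rule WL(1)[OF Ds], rule grD(1)[OF DN Ds])
      then have "L2_norm D (\<lambda>x. (W (s (n + N)) x, grad (W (s (n + N))) x)) \<le>
          L2_norm D (W (s (n + N))) + L2_norm D (grad (W (s (n + N))))"
        by (subst L2_norm_Pair) (auto intro: sqrt_sum_squares_le_sum)
      then show "L2_norm D (\<lambda>x. (W (s (n + N)) x, grad (W (s (n + N))) x)) \<le> 2 * B"
        using WL(2)[OF Ds, of "s (n + N)"] grD(2)[OF DN Ds, of n] by linarith
      show "is_weak_gradient D (W (s (n + N))) (grad (W (s (n + N))))"
        by (rule smooth_is_weak_gradient[OF W(1) D(1)])
    qed (use vD LIMSEQ_ignore_initial_segment[OF conv[OF D], of N] in auto)
    then show "H1_weak_conv D (\<lambda>n. W (s n)) v"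
      unfolding H1_weak_conv_def
      using eventually_sequentially_seg[of "\<lambda>n. W (s n) \<in> H1 D" N] LIMSEQ_offset[of "\<lambda>n. _ (W (s n))" N]
      by blast
  qed
qed

text \<open>The constant is fixed by the mollifier before the family is given, and \<open>w\<close>
  is chosen before any sequence in \<open>E\<close>; only \<open>s\<close> and the limit depend on
  the sequence.\<close>

theorem theoremB1:
  fixes \<Omega> :: "'a::euclidean_space set" and k r :: real
  assumes "open \<Omega>" and "lipschitz_boundary \<Omega>" and "0 < r" and "r \<le> k"
  shows "\<exists>C>0. \<forall>(E :: real set) (u :: real \<Rightarrow> 'a \<Rightarrow> real) (M :: real).
    E \<subseteq> {0<..} \<longrightarrow>
    (\<forall>\<epsilon>\<in>E. u \<epsilon> \<in> L2 \<Omega>) \<longrightarrow>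
    (\<exists>B. \<forall>\<epsilon>\<in>E. L2_norm \<Omega> (u \<epsilon>) \<le> B) \<longrightarrow>
    0 \<le> M \<longrightarrow>
    (\<forall>\<epsilon>\<in>E.
       (\<integral>\<^sup>+ x. (\<integral>\<^sup>+ \<xi>. ennreal (\<bar>(u \<epsilon> (x + \<epsilon> *\<^sub>R \<xi>) - u \<epsilon> x) / \<epsilon>\<bar>\<^sup>2) \<partial>lebesgue_on (ball 0 r))
          \<partial>lebesgue_on (inner_region \<Omega> (k * \<epsilon>))) \<le> ennreal M) \<longrightarrow>
    (\<exists>w :: real \<Rightarrow> 'a \<Rightarrow> real.
       (\<forall>\<epsilon>\<in>E. smooth_on (w \<epsilon>) (inner_region \<Omega> (k * \<epsilon>)) \<and> w \<epsilon> \<in> H1 (inner_region \<Omega> (k * \<epsilon>))) \<and>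
       (\<exists>B. \<forall>\<epsilon>\<in>E. H1_norm (inner_region \<Omega> (k * \<epsilon>)) (w \<epsilon>) \<le> B) \<and>
       (\<forall>\<epsilon>\<in>E. L2_norm (inner_region \<Omega> (k * \<epsilon>)) (\<lambda>x. u \<epsilon> x - w \<epsilon> x) \<le> C * sqrt M * \<epsilon> \<and>
               H1_norm (inner_region \<Omega> (k * \<epsilon>)) (w \<epsilon>) \<le> C * (sqrt M + L2_norm \<Omega> (u \<epsilon>))) \<and>
       (\<forall>\<epsilon> :: nat \<Rightarrow> real. (\<forall>n. \<epsilon> n \<in> E) \<longrightarrow> \<epsilon> \<longlonglongrightarrow> 0 \<longrightarrow>
          (\<exists>(s :: nat \<Rightarrow> nat) v. strict_mono s \<and> v \<in> H1 \<Omega> \<and>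
             (\<forall>\<Omega>'. open \<Omega>' \<and> compactly_contained \<Omega>' \<Omega> \<longrightarrow>
                L2_strong_conv \<Omega>' (\<lambda>n. u (\<epsilon> (s n))) v \<and>
                L2_strong_conv \<Omega>' (\<lambda>n. w (\<epsilon> (s n))) v \<and>
                H1_weak_conv \<Omega>' (\<lambda>n. w (\<epsilon> (s n))) v))))"
proof -
  have \<Omega>: "open \<Omega>" and k: "0 < k" using assms by auto
  have \<Omega>s: "\<Omega> \<in> sets lebesgue" using \<Omega> by simp
  obtain C where C: "0 < C" and mol: "\<And>u \<epsilon> M. \<lbrakk>u \<in> L2 \<Omega>; 0 < \<epsilon>; 0 \<le> M;
       (\<integral>\<^sup>+ x. (\<integral>\<^sup>+ \<xi>. ennreal (\<bar>(u (x + \<epsilon> *\<^sub>R \<xi>) - u x) / \<epsilon>\<bar>\<^sup>2) \<partial>lebesgue_on (ball 0 r))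
          \<partial>lebesgue_on (inner_region \<Omega> (k * \<epsilon>))) \<le> ennreal M\<rbrakk> \<Longrightarrow>
      \<exists>w. smooth_on w UNIV \<and> integrable lborel (\<lambda>x. (w x)\<^sup>2) \<and>
        (\<integral>x. (w x)\<^sup>2 \<partial>lborel) \<le> (C * L2_norm \<Omega> u)\<^sup>2 \<and>
        L2_norm (inner_region \<Omega> (k * \<epsilon>)) (\<lambda>x. u x - w x) \<le> C * sqrt M * \<epsilon> \<and>
        grad w \<in> L2 (inner_region \<Omega> (k * \<epsilon>)) \<and>
        L2_norm (inner_region \<Omega> (k * \<epsilon>)) (grad w) \<le> C * sqrt M"
    by (rule mollified_family[OF \<Omega> assms(3,4)]) blast
  show ?thesis
  proof (intro exI[of _ C] conjI C allI impI)
    fix E :: "real set" and u :: "real \<Rightarrow> 'a \<Rightarrow> real" and M :: real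
    assume E: "E \<subseteq> {0<..}" and u: "\<forall>\<epsilon>\<in>E. u \<epsilon> \<in> L2 \<Omega>" and "\<exists>B. \<forall>\<epsilon>\<in>E. L2_norm \<Omega> (u \<epsilon>) \<le> B"
      and M: "0 \<le> M" and hyp: "\<forall>\<epsilon>\<in>E.
       (\<integral>\<^sup>+ x. (\<integral>\<^sup>+ \<xi>. ennreal (\<bar>(u \<epsilon> (x + \<epsilon> *\<^sub>R \<xi>) - u \<epsilon> x) / \<epsilon>\<bar>\<^sup>2) \<partial>lebesgue_on (ball 0 r))
          \<partial>lebesgue_on (inner_region \<Omega> (k * \<epsilon>))) \<le> ennreal M"
    then obtain B where B: "\<And>\<epsilon>. \<epsilon> \<in> E \<Longrightarrow> L2_norm \<Omega> (u \<epsilon>) \<le> B" by blast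
    let ?A = "\<lambda>\<epsilon>. inner_region \<Omega> (k * \<epsilon>)"
    have A: "open (?A \<epsilon>)" "?A \<epsilon> \<subseteq> \<Omega>" "?A \<epsilon> \<in> sets lebesgue" for \<epsilon>
      using open_inner_region[OF \<Omega>] inner_region_subset by auto
    have "\<forall>\<epsilon>\<in>E. \<exists>w. smooth_on w UNIV \<and> integrable lborel (\<lambda>x. (w x)\<^sup>2) \<and>
        (\<integral>x. (w x)\<^sup>2 \<partial>lborel) \<le> (C * L2_norm \<Omega> (u \<epsilon>))\<^sup>2 \<and>
        L2_norm (?A \<epsilon>) (\<lambda>x. u \<epsilon> x - w x) \<le> C * sqrt M * \<epsilon> \<and>
        grad w \<in> L2 (?A \<epsilon>) \<and> L2_norm (?A \<epsilon>) (grad w) \<le> C * sqrt M"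
      using mol u hyp E M by blast
    then obtain w where w: "\<And>\<epsilon>. \<epsilon> \<in> E \<Longrightarrow> smooth_on (w \<epsilon>) UNIV"
      "\<And>\<epsilon>. \<epsilon> \<in> E \<Longrightarrow> integrable lborel (\<lambda>x. (w \<epsilon> x)\<^sup>2)"
      "\<And>\<epsilon>. \<epsilon> \<in> E \<Longrightarrow> (\<integral>x. (w \<epsilon> x)\<^sup>2 \<partial>lborel) \<le> (C * L2_norm \<Omega> (u \<epsilon>))\<^sup>2"
      "\<And>\<epsilon>. \<epsilon> \<in> E \<Longrightarrow> L2_norm (?A \<epsilon>) (\<lambda>x. u \<epsilon> x - w \<epsilon> x) \<le> C * sqrt M * \<epsilon>"
      "\<And>\<epsilon>. \<epsilon> \<in> E \<Longrightarrow> grad (w \<epsilon>) \<in> L2 (?A \<epsilon>)"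
      "\<And>\<epsilon>. \<epsilon> \<in> E \<Longrightarrow> L2_norm (?A \<epsilon>) (grad (w \<epsilon>)) \<le> C * sqrt M"
      unfolding bchoice_iff by blast
    have wb: "w \<epsilon> \<in> borel_measurable borel" if "\<epsilon> \<in> E" for \<epsilon>
      by (intro borel_measurable_continuous_onI smooth_on_continuous w that)
    have wL: "w \<epsilon> \<in> L2 D" if "\<epsilon> \<in> E" "D \<in> sets lebesgue" for \<epsilon> D
      by (rule lborel_square_integrable_L2(1)[OF wb w(2)]) (use that in auto)
    have wH: "w \<epsilon> \<in> H1 (?A \<epsilon>)" "H1_norm (?A \<epsilon>) (w \<epsilon>) \<le> C * (sqrt M + L2_norm \<Omega> (u \<epsilon>))" if e: "\<epsilon> \<in> E" for \<epsilon>
    proof -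
      note h = smooth_H1[OF A(1) w(1)[OF e] wL[OF e A(3)] w(5)[OF e]]
      show "w \<epsilon> \<in> H1 (?A \<epsilon>)" by (rule h(1))
      have "(L2_norm (?A \<epsilon>) (w \<epsilon>))\<^sup>2 \<le> (C * L2_norm \<Omega> (u \<epsilon>))\<^sup>2"
        using lborel_square_integrable_L2(2)[OF wb[OF e] w(2)[OF e] A(3)] w(3)[OF e] by (rule order_trans)
      then have "L2_norm (?A \<epsilon>) (w \<epsilon>) \<le> C * L2_norm \<Omega> (u \<epsilon>)"
        by (rule power2_le_imp_le) (use C in simp)
      then show "H1_norm (?A \<epsilon>) (w \<epsilon>) \<le> C * (sqrt M + L2_norm \<Omega> (u \<epsilon>))"
        using h(2) w(6)[OF e] by (simp add: distrib_left)
    qed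
    have wHB: "H1_norm (?A \<epsilon>) (w \<epsilon>) \<le> C * (sqrt M + B)" if "\<epsilon> \<in> E" for \<epsilon>
    proof -
      have "C * L2_norm \<Omega> (u \<epsilon>) \<le> C * B" by (intro mult_left_mono B that) (use C in simp)
      then show ?thesis using wH(2)[OF that] unfolding distrib_left by linarith
    qed
    have sub: "\<exists>(s :: nat \<Rightarrow> nat) v. strict_mono s \<and> v \<in> H1 \<Omega> \<and>
             (\<forall>\<Omega>'. open \<Omega>' \<and> compactly_contained \<Omega>' \<Omega> \<longrightarrow>
                L2_strong_conv \<Omega>' (\<lambda>n. u (\<epsilon> (s n))) v \<and>
                L2_strong_conv \<Omega>' (\<lambda>n. w (\<epsilon> (s n))) v \<and>
                H1_weak_conv \<Omega>' (\<lambda>n. w (\<epsilon> (s n))) v)"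
      if \<epsilon>: "\<forall>n. \<epsilon> n \<in> E" "\<epsilon> \<longlonglongrightarrow> 0" for \<epsilon> :: "nat \<Rightarrow> real"
    proof -
      have eE: "\<epsilon> n \<in> E" for n using \<epsilon>(1) by simp
      \<comment> \<open>One bound for both the norms of \<open>w\<close> on the whole space and its
        gradients on the inner regions; the absolute value makes both summands visibly
        nonnegative.\<close>
      define B' where "B' = C * \<bar>B\<bar> + C * sqrt M"
      have B': "0 \<le> B'" "C * sqrt M \<le> B'" "C * \<bar>B\<bar> \<le> B'"
        using C M by (auto simp: B'_def)
      have W3: "(\<integral>x. (w (\<epsilon> n) x)\<^sup>2 \<partial>lborel) \<le> B'\<^sup>2" for n
      proof -
        have "C * L2_norm \<Omega> (u (\<epsilon> n)) \<le> B'"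
          using mult_left_mono[of "L2_norm \<Omega> (u (\<epsilon> n))" "\<bar>B\<bar>" C] B[OF eE, of n] C B'(3) by linarith
        then have "(C * L2_norm \<Omega> (u (\<epsilon> n)))\<^sup>2 \<le> B'\<^sup>2" using C by (intro power_mono) auto
        with w(3)[OF eE] show ?thesis by (rule order_trans)
      qed
      have evD: "\<forall>\<^sub>F n in sequentially. k * \<epsilon> n < \<delta>" if "0 < \<delta>" for \<delta>
        using order_tendstoD(2)[OF tendsto_mult_right_zero[OF \<epsilon>(2), of k] that] .
      have ex: "\<exists>U. open U \<and> K \<subseteq> U \<and> U \<subseteq> \<Omega> \<and> (\<forall>\<^sub>F n in sequentially. U \<subseteq> ?A (\<epsilon> n))"
        if "compact K" "K \<subseteq> \<Omega>" for K
      proof -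
        \<comment> \<open>Inner regions grow as the width decreases: the one of width \<delta>/2 is
          open, contains \<open>K\<close> and lies in all those of width k\<epsilon> <
          \<delta>/2.\<close>
        obtain \<delta> where \<delta>: "0 < \<delta>" "\<And>\<rho>. \<rho> < \<delta> \<Longrightarrow> K \<subseteq> inner_region \<Omega> \<rho>"
          by (rule compact_subset_inner_region[OF \<Omega> \<open>compact K\<close> \<open>K \<subseteq> \<Omega>\<close>]) blast
        have "\<forall>\<^sub>F n in sequentially. inner_region \<Omega> (\<delta> / 2) \<subseteq> ?A (\<epsilon> n)"
          using evD[of "\<delta> / 2"] \<delta>(1) by (auto elim!: eventually_mono simp: inner_region_def)
        then show ?thesis
          using open_inner_region[OF \<Omega>] inner_region_subset \<delta>
          by (intro exI[of _ "inner_region \<Omega> (\<delta> / 2)"]) auto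
      qed
      obtain s v where s: "strict_mono s" and v: "v \<in> H1 \<Omega>"
        and st: "\<And>D. open D \<Longrightarrow> compactly_contained D \<Omega> \<Longrightarrow> L2_strong_conv D (\<lambda>n. w (\<epsilon> (s n))) v"
        and wk: "\<And>D. open D \<Longrightarrow> compactly_contained D \<Omega> \<Longrightarrow> H1_weak_conv D (\<lambda>n. w (\<epsilon> (s n))) v"
        by (rule subsequence_convergence[where W = "\<lambda>n. w (\<epsilon> n)" and A = "\<lambda>n. ?A (\<epsilon> n)",
              OF \<Omega> w(1)[OF eE] w(2)[OF eE] W3 B'(1) A(1) A(2) w(5)[OF eE]
                order_trans[OF w(6)[OF eE] B'(2)]]) (erule (1) ex, (rule that; assumption))
      have "L2_strong_conv D (\<lambda>n. u (\<epsilon> (s n))) v" if D: "open D" "compactly_contained D \<Omega>" for D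
      proof -
        have Ds: "D \<in> sets lebesgue" using D by simp
        have cD: "compact (closure D)" "closure D \<subseteq> \<Omega>" using D(2) by (auto simp: compactly_contained_def)
        have D\<Omega>: "D \<subseteq> \<Omega>" using cD closure_subset by blast
        have uD: "u (\<epsilon> n) \<in> L2 D" for n by (rule L2_subset(1)[OF _ D\<Omega> \<Omega>s Ds]) (use u eE in auto)
        have vD: "v \<in> L2 D" and lim: "(\<lambda>n. L2_norm D (\<lambda>x. w (\<epsilon> (s n)) x - v x)) \<longlonglongrightarrow> 0"
          using st[OF D] by (auto simp: L2_strong_conv_def)
        obtain U where U: "closure D \<subseteq> U" "\<forall>\<^sub>F n in sequentially. U \<subseteq> ?A (\<epsilon> n)"
          using ex[OF cD] by blast
        \<comment> \<open>Once \<open>D\<close> lies in the inner region, \<open>u\<close> and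
          \<open>w\<close> differ on it by a multiple of \<epsilon>, so the strong limit of
          \<open>w\<close> is also that of \<open>u\<close>.\<close>
        have "(\<lambda>n. L2_norm D (\<lambda>x. u (\<epsilon> (s n)) x - v x)) \<longlonglongrightarrow> 0"
        proof (rule Lim_null_comparison)
          show "\<forall>\<^sub>F n in sequentially. norm (L2_norm D (\<lambda>x. u (\<epsilon> (s n)) x - v x)) \<le>
              C * sqrt M * \<epsilon> (s n) + L2_norm D (\<lambda>x. w (\<epsilon> (s n)) x - v x)"
            using eventually_subseq[OF s U(2)]
          proof eventually_elim
            case (elim n)
            let ?e = "\<epsilon> (s n)"
            have DA: "D \<subseteq> ?A ?e" using elim U(1) closure_subset by blast
            have uA: "u ?e \<in> L2 (?A ?e)" by (rule L2_subset(1)[OF _ A(2) \<Omega>s A(3)]) (use u eE in auto)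
            have "L2_norm D (\<lambda>x. u ?e x - w ?e x) \<le> L2_norm (?A ?e) (\<lambda>x. u ?e x - w ?e x)"
              by (rule L2_subset(2)[OF L2_diff[OF uA wL[OF eE A(3)]] DA A(3) Ds])
            also have "\<dots> \<le> C * sqrt M * ?e" by (rule w(4)[OF eE])
            finally show ?case
              using L2_norm_diff_triangle[OF uD[of "s n"] wL[OF eE Ds, of "s n"] vD] by simp
          qed
          have "(\<lambda>n. C * sqrt M * \<epsilon> (s n) + L2_norm D (\<lambda>x. w (\<epsilon> (s n)) x - v x)) \<longlonglongrightarrow> C * sqrt M * 0 + 0"
            using LIMSEQ_subseq_LIMSEQ[OF \<epsilon>(2) s] by (intro tendsto_intros lim) (simp add: o_def)
          then show "(\<lambda>n. C * sqrt M * \<epsilon> (s n) + L2_norm D (\<lambda>x. w (\<epsilon> (s n)) x - v x)) \<longlonglongrightarrow> 0" by simp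
        qed
        then show ?thesis using uD vD by (simp add: L2_strong_conv_def)
      qed
      with s v st wk show ?thesis by blast
    qed
    show "\<exists>w :: real \<Rightarrow> 'a \<Rightarrow> real.
       (\<forall>\<epsilon>\<in>E. smooth_on (w \<epsilon>) (?A \<epsilon>) \<and> w \<epsilon> \<in> H1 (?A \<epsilon>)) \<and>
       (\<exists>B. \<forall>\<epsilon>\<in>E. H1_norm (?A \<epsilon>) (w \<epsilon>) \<le> B) \<and>
       (\<forall>\<epsilon>\<in>E. L2_norm (?A \<epsilon>) (\<lambda>x. u \<epsilon> x - w \<epsilon> x) \<le> C * sqrt M * \<epsilon> \<and>
               H1_norm (?A \<epsilon>) (w \<epsilon>) \<le> C * (sqrt M + L2_norm \<Omega> (u \<epsilon>))) \<and>
       (\<forall>\<epsilon> :: nat \<Rightarrow> real. (\<forall>n. \<epsilon> n \<in> E) \<longrightarrow> \<epsilon> \<longlonglongrightarrow> 0 \<longrightarrow>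
          (\<exists>(s :: nat \<Rightarrow> nat) v. strict_mono s \<and> v \<in> H1 \<Omega> \<and>
             (\<forall>\<Omega>'. open \<Omega>' \<and> compactly_contained \<Omega>' \<Omega> \<longrightarrow>
                L2_strong_conv \<Omega>' (\<lambda>n. u (\<epsilon> (s n))) v \<and>
                L2_strong_conv \<Omega>' (\<lambda>n. w (\<epsilon> (s n))) v \<and>
                H1_weak_conv \<Omega>' (\<lambda>n. w (\<epsilon> (s n))) v)))"
    proof (intro exI[of _ w] conjI ballI)
      show "smooth_on (w \<epsilon>) (?A \<epsilon>)" if "\<epsilon> \<in> E" for \<epsilon> using smooth_on_subset[OF w(1)[OF that]] by simp
      show "\<exists>B. \<forall>\<epsilon>\<in>E. H1_norm (?A \<epsilon>) (w \<epsilon>) \<le> B" using wHB by blast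
    qed (use wH w(4) sub in blast)+
  qed
qed

end
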